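(* Let $d$ be prime, $n\ge1$, $G$ invertible over $\mathbb Z_d$, $\alpha\in[1/2,+\infty]$, and $\Lambda_1,\Lambda_2$ $n$-qudit channels. (1) If $G$ is odd-parity positive, $H_\alpha(\Lambda_1\boxtimes\Lambda_2)\ge H_\alpha(\Lambda_2)$. (2) If $G$ is even-parity positive, $H_\alpha(\Lambda_1\boxtimes\Lambda_2)\ge H_\alpha(\Lambda_1)$. (3) If $G$ is positive, $H_\alpha(\Lambda_1\boxtimes\Lambda_2)\ge\max\{H_\alpha(\Lambda_1),H_\alpha(\Lambda_2)\}$.
   Context: Fix a prime $d$. $G=\begin{pmatrix}g_{00}&g_{01}\\ g_{10}&g_{11}\end{pmatrix}$ over $\mathbb Z_d$, $\det G\not\equiv0$, $N=(\det G)^{-1}$; nontrivial if at most one entry is $0$ mod $d$; odd-parity positive if nontrivial and $g_{01},g_{10}\not\equiv0$; even-parity positive if nontrivial and $g_{00},g_{11}\not\equiv0$; positive if both. Key unitary on $(\mathbb C^d)^{\otimes n}\otimes(\mathbb C^d)^{\otimes n}$: $U|\vec i\rangle|\vec j\rangle=|Ng_{11}\vec i-Ng_{10}\vec j\rangle|-Ng_{01}\vec i+Ng_{00}\vec j\rangle$; $\mathcal E(\cdot)=\mathrm{Tr}_B[U(\cdot)U^\dagger]$, $\mathcal E^{-1}(\rho)=U^\dagger(\rho\otimes I_n/d^n)U$. The convolution of $n$-qudit channels is $\Lambda_1\boxtimes\Lambda_2=\mathcal E\circ(\Lambda_1\otimes\Lambda_2)\circ\mathcal E^{-1}$ (equivalently,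 the channel whose Choi state is the convolution of the Choi states). Let $\mathcal R(\rho)=\mathrm{Tr}[\rho]I_n/d^n$. With $D_\alpha$ the sandwiched Rényi relative entropy, $D_\alpha(\Lambda\|\mathcal R)=\sup_{\rho_{AR}}D_\alpha((\Lambda\otimes\mathrm{id}_R)(\rho_{AR})\|(\mathcal R\otimes\mathrm{id}_R)(\rho_{AR}))$ over all ancillas $R$, and $H_\alpha(\Lambda)=n\log d-D_\alpha(\Lambda\|\mathcal R)$. *)

theory Defs
  imports "HOL-Library.Extended_Real" "HOL-Computational_Algebra.Primes"
          "HOL-Number_Theory.Cong" "Jordan_Normal_Form.Schur_Decomposition"
begin

definition mtrace :: "complex mat \<Rightarrow> complex" where
  "mtrace A = (\<Sum>i<dim_row A. A $$ (i,i))"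

definition psd :: "nat \<Rightarrow> complex mat \<Rightarrow> bool" where
  "psd n A \<longleftrightarrow> A \<in> carrier_mat n n \<and> mat_adjoint A = A \<and>
     (\<forall>v \<in> carrier_vec n. 0 \<le> Re (conjugate v \<bullet> (A *\<^sub>v v)))"

definition is_state :: "nat \<Rightarrow> complex mat \<Rightarrow> bool" where
  "is_state n \<rho> \<longleftrightarrow> psd n \<rho> \<and> mtrace \<rho> = 1"

definition is_channel :: "nat \<Rightarrow> (complex mat \<Rightarrow> complex mat) \<Rightarrow> bool" where
  "is_channel N \<Lambda> \<longleftrightarrow> (\<exists>Ks :: complex mat list.
     (\<forall>K \<in> set Ks. K \<in> carrier_mat N N) \<and>
     mat N N (\<lambda>(i,j). \<Sum>k<length Ks. (mat_adjoint (Ks!k) * Ks!k) $$ (i,j)) = 1\<^sub>m N \<and>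
     (\<forall>\<rho> \<in> carrier_mat N N.
        \<Lambda> \<rho> = mat N N (\<lambda>(i,j). \<Sum>k<length Ks. (Ks!k * \<rho> * mat_adjoint (Ks!k)) $$ (i,j))))"

definition unit_mat :: "nat \<Rightarrow> nat \<Rightarrow> nat \<Rightarrow> complex mat" where
  "unit_mat N a b = mat N N (\<lambda>(i,j). if i = a \<and> j = b then 1 else 0)"

(* tensor product of linear maps on C^N1 (x) C^N2; basis index of |i>|k> is i*N2+k *)
definition tensor_map :: "(complex mat \<Rightarrow> complex mat) \<Rightarrow> (complex mat \<Rightarrow> complex mat)
      \<Rightarrow> nat \<Rightarrow> nat \<Rightarrow> complex mat \<Rightarrow> complex mat" where
  "tensor_map \<Lambda>1 \<Lambda>2 N1 N2 X = mat (N1*N2) (N1*N2) (\<lambda>(p,q).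
     \<Sum>a<N1. \<Sum>b<N1. \<Sum>c<N2. \<Sum>e<N2.
        X $$ (a*N2+c, b*N2+e) * (\<Lambda>1 (unit_mat N1 a b)) $$ (p div N2, q div N2)
          * (\<Lambda>2 (unit_mat N2 c e)) $$ (p mod N2, q mod N2))"

definition depol :: "nat \<Rightarrow> complex mat \<Rightarrow> complex mat" where
  "depol N \<rho> = (mtrace \<rho> / of_nat N) \<cdot>\<^sub>m 1\<^sub>m N"

definition unitary_mat :: "nat \<Rightarrow> complex mat \<Rightarrow> bool" where
  "unitary_mat n U \<longleftrightarrow> U \<in> carrier_mat n n \<and> U * mat_adjoint U = 1\<^sub>m n \<and> mat_adjoint U * U = 1\<^sub>m n"

definition real_diag :: "nat \<Rightarrow> (nat \<Rightarrow> real) \<Rightarrow> complex mat" where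
  "real_diag n l = mat n n (\<lambda>(i,j). if i = j then complex_of_real (l i) else 0)"

definition matfun :: "(real \<Rightarrow> real) \<Rightarrow> complex mat \<Rightarrow> complex mat" where
  "matfun f A = (SOME B. \<exists>U l. unitary_mat (dim_row A) U \<and>
      A = U * real_diag (dim_row A) l * mat_adjoint U \<and>
      B = U * real_diag (dim_row A) (f \<circ> l) * mat_adjoint U)"

(* supp rho \<subseteq> supp sigma, i.e. ker sigma \<subseteq> ker rho *)
definition supp_le :: "complex mat \<Rightarrow> complex mat \<Rightarrow> bool" where
  "supp_le \<rho> \<sigma> \<longleftrightarrow> (\<forall>v \<in> carrier_vec (dim_row \<sigma>). \<sigma> *\<^sub>v v = 0\<^sub>v (dim_row \<sigma>) \<longrightarrow> \<rho> *\<^sub>v v = 0\<^sub>v (dim_row \<rho>))"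

definition log0 :: "real \<Rightarrow> real" where
  "log0 x = (if x > 0 then ln x else 0)"

(* sandwiched Renyi relative entropy D_alpha(rho||sigma), alpha in [1/2, \<infinity>],
   with alpha = 1 the Umegaki relative entropy and alpha = \<infinity> the max-relative entropy;
   natural logarithm; 0 powr p = 0 gives generalized inverses on the support *)
definition sandwiched_renyi :: "ereal \<Rightarrow> complex mat \<Rightarrow> complex mat \<Rightarrow> ereal" where
  "sandwiched_renyi \<alpha> \<rho> \<sigma> =
    (if \<alpha> = \<infinity> then
       (if \<not> supp_le \<rho> \<sigma> then \<infinity>
        else ereal (ln (Inf {c::real. 0 \<le> c \<and> psd (dim_row \<rho>) (of_real c \<cdot>\<^sub>m \<sigma> - \<rho>)})))
     else if \<alpha> = 1 then
       (if \<not> supp_le \<rho> \<sigma> then \<infinity>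
        else ereal (Re (mtrace (\<rho> * (matfun log0 \<rho> - matfun log0 \<sigma>)))))
     else
       (let a = real_of_ereal \<alpha>;
            \<gamma> = (1 - a) / (2 * a);
            S = matfun (\<lambda>x. x powr \<gamma>) \<sigma>;
            Q = Re (mtrace (matfun (\<lambda>x. x powr a) (S * \<rho> * S)))
        in if (a > 1 \<and> \<not> supp_le \<rho> \<sigma>) \<or> Q \<le> 0 then \<infinity>
           else ereal (ln Q / (a - 1))))"

definition chan_renyi :: "ereal \<Rightarrow> nat \<Rightarrow> (complex mat \<Rightarrow> complex mat) \<Rightarrow> ereal" where
  "chan_renyi \<alpha> N \<Lambda> = (SUP Rd \<in> {1..}. SUP \<rho> \<in> {\<rho>. is_state (N * Rd) \<rho>}.
      sandwiched_renyi \<alpha> (tensor_map \<Lambda> (\<lambda>X. X) N Rd \<rho>) (tensor_map (depol N) (\<lambda>X. X) N Rd \<rho>))"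

definition chan_entropy :: "ereal \<Rightarrow> nat \<Rightarrow> nat \<Rightarrow> (complex mat \<Rightarrow> complex mat) \<Rightarrow> ereal" where
  "chan_entropy \<alpha> d n \<Lambda> = ereal (real n * ln (real d)) - chan_renyi \<alpha> (d ^ n) \<Lambda>"

definition detG :: "int \<Rightarrow> int \<Rightarrow> int \<Rightarrow> int \<Rightarrow> int" where
  "detG g00 g01 g10 g11 = g00 * g11 - g01 * g10"

definition invdet :: "nat \<Rightarrow> int \<Rightarrow> int \<Rightarrow> int \<Rightarrow> int \<Rightarrow> int" where
  "invdet d g00 g01 g10 g11 = (SOME k. [detG g00 g01 g10 g11 * k = 1] (mod int d))"

definition nz :: "nat \<Rightarrow> int \<Rightarrow> bool" where
  "nz d x \<longleftrightarrow> \<not> [x = 0] (mod int d)"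

definition nontrivialG :: "nat \<Rightarrow> int \<Rightarrow> int \<Rightarrow> int \<Rightarrow> int \<Rightarrow> bool" where
  "nontrivialG d g00 g01 g10 g11 \<longleftrightarrow>
     card {k \<in> {0::nat..3}. \<not> nz d ([g00, g01, g10, g11] ! k)} \<le> 1"

definition odd_parity_pos :: "nat \<Rightarrow> int \<Rightarrow> int \<Rightarrow> int \<Rightarrow> int \<Rightarrow> bool" where
  "odd_parity_pos d g00 g01 g10 g11 \<longleftrightarrow> nontrivialG d g00 g01 g10 g11 \<and> nz d g01 \<and> nz d g10"

definition even_parity_pos :: "nat \<Rightarrow> int \<Rightarrow> int \<Rightarrow> int \<Rightarrow> int \<Rightarrow> bool" where
  "even_parity_pos d g00 g01 g10 g11 \<longleftrightarrow> nontrivialG d g00 g01 g10 g11 \<and> nz d g00 \<and> nz d g11"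

definition positiveG :: "nat \<Rightarrow> int \<Rightarrow> int \<Rightarrow> int \<Rightarrow> int \<Rightarrow> bool" where
  "positiveG d g00 g01 g10 g11 \<longleftrightarrow> odd_parity_pos d g00 g01 g10 g11 \<and> even_parity_pos d g00 g01 g10 g11"

(* t-th base-d digit of basis index k of (C^d)^{(x) n} *)
definition digit :: "nat \<Rightarrow> nat \<Rightarrow> nat \<Rightarrow> int" where
  "digit d k t = int ((k div d ^ t) mod d)"

(* basis index of the vector v in Z_d^n *)
definition encode :: "nat \<Rightarrow> nat \<Rightarrow> (nat \<Rightarrow> int) \<Rightarrow> nat" where
  "encode d n v = (\<Sum>t<n. nat (v t mod int d) * d ^ t)"

(* U |i>|j> = |N g11 i - N g10 j>|-N g01 i + N g00 j>, index of |i>|j> is a * d^n + b *)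
definition keyperm :: "nat \<Rightarrow> nat \<Rightarrow> int \<Rightarrow> int \<Rightarrow> int \<Rightarrow> int \<Rightarrow> nat \<Rightarrow> nat" where
  "keyperm d n g00 g01 g10 g11 q =
     (let Ni = invdet d g00 g01 g10 g11; a = q div d ^ n; b = q mod d ^ n in
      encode d n (\<lambda>t. Ni * g11 * digit d a t - Ni * g10 * digit d b t) * d ^ n
      + encode d n (\<lambda>t. - Ni * g01 * digit d a t + Ni * g00 * digit d b t))"

definition keyU :: "nat \<Rightarrow> nat \<Rightarrow> int \<Rightarrow> int \<Rightarrow> int \<Rightarrow> int \<Rightarrow> complex mat" where
  "keyU d n g00 g01 g10 g11 = mat (d^n * d^n) (d^n * d^n)
     (\<lambda>(p,q). if p = keyperm d n g00 g01 g10 g11 q then 1 else 0)"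

definition ptrace2 :: "nat \<Rightarrow> complex mat \<Rightarrow> complex mat" where
  "ptrace2 N X = mat N N (\<lambda>(i,j). \<Sum>k<N. X $$ (i*N+k, j*N+k))"

definition tensor_maxmixed :: "nat \<Rightarrow> complex mat \<Rightarrow> complex mat" where
  "tensor_maxmixed N \<rho> = mat (N*N) (N*N)
     (\<lambda>(p,q). \<rho> $$ (p div N, q div N) * (if p mod N = q mod N then 1 / of_nat N else 0))"

definition convE :: "nat \<Rightarrow> nat \<Rightarrow> int \<Rightarrow> int \<Rightarrow> int \<Rightarrow> int \<Rightarrow> complex mat \<Rightarrow> complex mat" where
  "convE d n g00 g01 g10 g11 X =
     (let U = keyU d n g00 g01 g10 g11 in ptrace2 (d^n) (U * X * mat_adjoint U))"

definition convEinv :: "nat \<Rightarrow> nat \<Rightarrow> int \<Rightarrow> int \<Rightarrow> int \<Rightarrow> int \<Rightarrow> complex mat \<Rightarrow> complex mat" where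
  "convEinv d n g00 g01 g10 g11 \<rho> =
     (let U = keyU d n g00 g01 g10 g11 in mat_adjoint U * tensor_maxmixed (d^n) \<rho> * U)"

definition chan_conv :: "nat \<Rightarrow> nat \<Rightarrow> int \<Rightarrow> int \<Rightarrow> int \<Rightarrow> int
     \<Rightarrow> (complex mat \<Rightarrow> complex mat) \<Rightarrow> (complex mat \<Rightarrow> complex mat) \<Rightarrow> complex mat \<Rightarrow> complex mat" where
  "chan_conv d n g00 g01 g10 g11 \<Lambda>1 \<Lambda>2 \<rho> =
     convE d n g00 g01 g10 g11
       (tensor_map \<Lambda>1 \<Lambda>2 (d^n) (d^n) (convEinv d n g00 g01 g10 g11 \<rho>))"

end

theory Submission
  imports Defs
begin

text \<open>
  Write D = d^n and let A, B be the two n-qudit systems. Given an input state \<rho> of A and an ancilla R,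
  let \<omega> be the state obtained from \<rho> and the maximally mixed state of B by the inverse of the key unitary U.
  If g01 and g10 are nonzero then \<omega> has marginal I/D \<otimes> \<rho>_R on A and R, so using A and R as an ancilla for \<Lambda>2
  bounds the divergence of (id \<otimes> \<Lambda>2)(\<omega>) from I/D^2 \<otimes> \<rho>_R by that of \<Lambda>2.
  The remaining map T, namely \<Lambda>1 on A followed by U and the trace over B, preserves the trace, satisfies
  T(I) = D I, and commutes with operators on R. Since the reference states are trivial off R, the operators that
  sandwich the state act on R only and pass through T, and monotonicity under T reduces to Jensen's inequality for
  eigenvalues: no general data processing inequality is needed.
  The formula for the convolution on matrix units is symmetric in (\<Lambda>1, g00, g10) and (\<Lambda>2, g01, g11), which gives
  the even case.
\<close>

section \<open>The spectral theorem\<close>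

text \<open>The obstacle is noncommutativity: X and its reference state have no common eigenbasis,
  so a divergence is not a function of two spectra. What helps is that the references before and
  after T have the same factor \<rho>_R and differ only in the dimension of the identity beside it,
  D^2 against D. Hence the operators built from them, powers or logarithms, agree on R up to a
  power, or the logarithm, of the ratio \<kappa> = D. Once they have been moved through T, only the
  spectra of a single operator and of its image under T have to be compared, and this is a statement
  about real numbers. The correction in \<kappa> that the references leave behind is exactly the one
  that Jensen's inequality produces when the weights in each row sum to \<kappa> instead of 1. This
  happens in the same way for a power and for x log x, while at \<alpha> = \<infinity> positivity of
  T is enough.\<close>

declare index_mult_mat(1) [simp del]

lemma mat_adjoint_dim [simp]:
  "dim_row (mat_adjoint A) = dim_col A" "dim_col (mat_adjoint A) = dim_row A"
  by (auto simp: mat_adjoint_def)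

lemma mat_adjoint_carrier [simp]:
  "A \<in> carrier_mat n m \<Longrightarrow> mat_adjoint A \<in> carrier_mat m n"
  by auto

lemma mat_adjoint_index [simp]:
  fixes A :: "complex mat"
  assumes "i < dim_col A" "j < dim_row A"
  shows "mat_adjoint A $$ (i,j) = cnj (A $$ (j,i))"
  using assms by (simp add: mat_adjoint_def mat_of_rows_index)

text \<open>Products stay folded until an entry is asked for here, and then appear as sums over
  \<open>{..<m}\<close> instead of scalar products of rows and columns; all later index computations
  are manipulations of such sums.\<close>

lemma mat_mult_index:
  fixes A B :: "complex mat"
  assumes "A \<in> carrier_mat n m" "B \<in> carrier_mat m p" "i < n" "j < p"
  shows "(A * B) $$ (i,j) = (\<Sum>k<m. A $$ (i,k) * B $$ (k,j))"
  using assms by (auto simp: index_mult_mat(1) scalar_prod_def atLeast0LessThan)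

lemma mat_vec_index:
  fixes A :: "complex mat"
  assumes "A \<in> carrier_mat n m" "v \<in> carrier_vec m" "i < n"
  shows "(A *\<^sub>v v) $ i = (\<Sum>k<m. A $$ (i,k) * v $ k)"
  using assms by (auto simp: index_mult_mat(1) scalar_prod_def atLeast0LessThan)

lemma mat_adjoint_adjoint [simp]: "mat_adjoint (mat_adjoint A) = (A :: complex mat)"
  by (rule eq_matI) auto

lemma mat_adjoint_mult:
  fixes A B :: "complex mat"
  assumes A: "A \<in> carrier_mat n m" and B: "B \<in> carrier_mat m p"
  shows "mat_adjoint (A * B) = mat_adjoint B * mat_adjoint A"
proof (rule eq_matI)
  fix i j assume "i < dim_row (mat_adjoint B * mat_adjoint A)" "j < dim_col (mat_adjoint B * mat_adjoint A)"
  hence ij: "i < p" "j < n" using A B by auto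
  have "mat_adjoint (A * B) $$ (i,j) = cnj ((A * B) $$ (j,i))"
    using ij A B by simp
  also have "\<dots> = (\<Sum>k<m. mat_adjoint B $$ (i,k) * mat_adjoint A $$ (k,j))"
    unfolding mat_mult_index[OF A B ij(2,1)]
    using ij A B by (auto simp: mult.commute intro!: sum.cong)
  also have "\<dots> = (mat_adjoint B * mat_adjoint A) $$ (i,j)"
    using ij A B by (subst mat_mult_index[of _ p m _ n]) auto
  finally show "mat_adjoint (A * B) $$ (i,j) = (mat_adjoint B * mat_adjoint A) $$ (i,j)" .
qed (use A B in auto)

lemma real_diag_carrier [simp]: "real_diag n l \<in> carrier_mat n n"
  by (simp add: real_diag_def)

lemma real_diag_dim [simp]: "dim_row (real_diag n l) = n" "dim_col (real_diag n l) = n"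
  by (simp_all add: real_diag_def)

text \<open>With equations between dimensions as premises instead of carrier sets no variable is
  left undetermined, so this can serve as a rewrite rule that brings every product into
  right-associated form.\<close>

lemma mat_mult_assoc:
  fixes A B C :: "complex mat"
  assumes "dim_col A = dim_row B" "dim_col B = dim_row C"
  shows "A * B * C = A * (B * C)"
  using assms by (intro assoc_mult_mat[of A "dim_row A" "dim_col A" B "dim_col B" C "dim_col C"]) auto

lemma mult_real_diag_index:
  assumes A: "A \<in> carrier_mat m n" and ij: "i < m" "j < n"
  shows "(A * real_diag n l) $$ (i,j) = A $$ (i,j) * complex_of_real (l j)"
proof -
  have "(A * real_diag n l) $$ (i,j) = (\<Sum>k<n. if k = j then A $$ (i,j) * complex_of_real (l j) else 0)"
    using ij unfolding mat_mult_index[OF A real_diag_carrier ij]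
    by (intro sum.cong) (auto simp: real_diag_def)
  thus ?thesis using ij by simp
qed

lemma conj_real_diag_index:
  assumes A: "A \<in> carrier_mat m n" and ij: "i < m" "j < m"
  shows "(A * real_diag n l * mat_adjoint A) $$ (i,j)
    = (\<Sum>k<n. A $$ (i,k) * complex_of_real (l k) * cnj (A $$ (j,k)))"
proof -
  have "A * real_diag n l \<in> carrier_mat m n" using A by auto
  from mat_mult_index[OF this mat_adjoint_carrier[OF A] ij]
  show ?thesis using A ij by (auto simp: mult_real_diag_index[OF A] intro!: sum.cong)
qed

lemma unitary_mat_left:
  assumes "unitary_mat n U" "i < n" "j < n"
  shows "(\<Sum>k<n. cnj (U $$ (k,i)) * U $$ (k,j)) = (if i = j then 1 else 0)"
proof -
  have U: "U \<in> carrier_mat n n" "mat_adjoint U * U = 1\<^sub>m n"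
    using assms by (auto simp: unitary_mat_def)
  have "(mat_adjoint U * U) $$ (i,j) = (\<Sum>k<n. mat_adjoint U $$ (i,k) * U $$ (k,j))"
    by (rule mat_mult_index) (use U assms in auto)
  also have "\<dots> = (\<Sum>k<n. cnj (U $$ (k,i)) * U $$ (k,j))"
    using U assms by (auto intro!: sum.cong)
  finally show ?thesis using U assms by simp
qed

text \<open>Orthonormal columns suffice, because a left inverse of a square matrix is also a right
  inverse.\<close>

lemma unitary_matI:
  assumes U: "U \<in> carrier_mat n n"
    and "\<And>i j. i < n \<Longrightarrow> j < n \<Longrightarrow> (\<Sum>k<n. cnj (U $$ (k,i)) * U $$ (k,j)) = (if i = j then 1 else 0)"
  shows "unitary_mat n U"
proof -
  have "mat_adjoint U * U = 1\<^sub>m n"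
  proof (rule eq_matI)
    fix i j assume "i < dim_row (1\<^sub>m n :: complex mat)" "j < dim_col (1\<^sub>m n :: complex mat)"
    hence ij: "i < n" "j < n" by auto
    have "(mat_adjoint U * U) $$ (i,j) = (\<Sum>k<n. mat_adjoint U $$ (i,k) * U $$ (k,j))"
      by (rule mat_mult_index) (use U ij in auto)
    also have "\<dots> = (\<Sum>k<n. cnj (U $$ (k,i)) * U $$ (k,j))"
      using U ij by (auto intro!: sum.cong)
    finally show "(mat_adjoint U * U) $$ (i,j) = 1\<^sub>m n $$ (i,j)" using assms(2) ij by simp
  qed (use U in auto)
  moreover from mat_mult_left_right_inverse[OF mat_adjoint_carrier[OF U] U this]
  have "U * mat_adjoint U = 1\<^sub>m n" .
  ultimately show ?thesis using U by (simp add: unitary_mat_def)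
qed

lemma unitary_mat_mult:
  assumes "unitary_mat n U" "unitary_mat n V"
  shows "unitary_mat n (U * V)"
proof -
  have U: "U \<in> carrier_mat n n" "U * mat_adjoint U = 1\<^sub>m n" "mat_adjoint U * U = 1\<^sub>m n"
   and V: "V \<in> carrier_mat n n" "V * mat_adjoint V = 1\<^sub>m n" "mat_adjoint V * V = 1\<^sub>m n"
    using assms by (auto simp: unitary_mat_def)
  note c = U(1) V(1) mat_adjoint_carrier[OF U(1)] mat_adjoint_carrier[OF V(1)]
  have "U * V * (mat_adjoint V * mat_adjoint U) = U * (V * mat_adjoint V) * mat_adjoint U"
    using c by (auto simp: mat_mult_assoc)
  moreover have "mat_adjoint V * mat_adjoint U * (U * V) = mat_adjoint V * (mat_adjoint U * U) * V"
    using c by (auto simp: mat_mult_assoc)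
  ultimately show ?thesis
    using U V c by (simp add: unitary_mat_def mat_adjoint_mult[OF U(1) V(1)])
qed

text \<open>\<open>corthogonal\<close> demands orthogonality and nonzero norms, but not norm one;
  \<open>c j\<close> is the norm of the j-th vector.\<close>

lemma normalized_corthogonal_unitary:
  fixes ws :: "complex vec list"
  assumes ws: "set ws \<subseteq> carrier_vec n" "corthogonal ws" "length ws = n"
  defines "c \<equiv> \<lambda>j. sqrt (\<Sum>k<n. (cmod (ws ! j $ k))\<^sup>2)"
  shows "unitary_mat n (mat n n (\<lambda>(i,j). ws ! j $ i / complex_of_real (c j)))"
proof (rule unitary_matI)
  fix i j assume ij: "i < n" "j < n"
  have wc: "ws ! i \<in> carrier_vec n" "ws ! j \<in> carrier_vec n" using ws ij by auto
  have sp: "(\<Sum>k<n. cnj (ws ! i $ k) * ws ! j $ k) = ws ! j \<bullet>c ws ! i"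
    using wc by (auto simp: scalar_prod_def atLeast0LessThan mult.commute intro!: sum.cong)
  have "(\<Sum>k<n. cnj (mat n n (\<lambda>(i,j). ws ! j $ i / complex_of_real (c j)) $$ (k,i)) * mat n n (\<lambda>(i,j). ws ! j $ i / complex_of_real (c j)) $$ (k,j))
    = (\<Sum>k<n. cnj (ws ! i $ k) * ws ! j $ k) / (complex_of_real (c i) * complex_of_real (c j))"
    using ij by (simp add: sum_divide_distrib)
  also have "\<dots> = (if i = j then 1 else 0)"
  proof (cases "i = j")
    case True
    have sq: "(\<Sum>k<n. cnj (ws ! j $ k) * ws ! j $ k) = complex_of_real (\<Sum>k<n. (cmod (ws ! j $ k))\<^sup>2)"
      unfolding of_real_sum by (intro sum.cong refl) (metis complex_norm_square mult.commute)
    have "ws ! j \<bullet>c ws ! j \<noteq> 0" using corthogonalD[OF ws(2)] ij ws by auto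
    hence n0: "(\<Sum>k<n. (cmod (ws ! j $ k))\<^sup>2) \<noteq> 0"
      using sp True sq by (auto simp del: of_real_sum)
    have "complex_of_real (c j) * complex_of_real (c j) = complex_of_real (\<Sum>k<n. (cmod (ws ! j $ k))\<^sup>2)"
      unfolding c_def of_real_mult[symmetric] by (simp add: sum_nonneg del: of_real_sum)
    thus ?thesis using True sq n0 by (simp del: of_real_sum)
  next
    case False
    have "ws ! j \<bullet>c ws ! i = 0" using corthogonalD[OF ws(2)] ij ws False by auto
    thus ?thesis using sp False by simp
  qed
  finally show "(\<Sum>k<n. cnj (mat n n (\<lambda>(i,j). ws ! j $ i / complex_of_real (c j)) $$ (k,i)) * mat n n (\<lambda>(i,j). ws ! j $ i / complex_of_real (c j)) $$ (k,j)) = (if i = j then 1 else 0)" .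
qed auto

lemma exists_eigenvector:
  fixes A :: "complex mat"
  assumes A: "A \<in> carrier_mat n n" and n: "n \<noteq> 0"
  shows "\<exists>v e. v \<in> carrier_vec n \<and> v \<noteq> 0\<^sub>v n \<and> A *\<^sub>v v = e \<cdot>\<^sub>v v"
proof -
  have "degree (char_poly A) \<noteq> 0" using degree_monic_char_poly[OF A] n by simp
  hence "\<not> constant (poly (char_poly A))" by (simp add: constant_degree)
  then obtain e where "poly (char_poly A) e = 0" using fundamental_theorem_of_algebra by blast
  hence "eigenvalue A e" using eigenvalue_root_char_poly[OF A] by simp
  thus ?thesis using A by (auto simp: eigenvalue_def eigenvector_def)
qed

text \<open>Complete v to a basis and orthogonalize. Gram-Schmidt leaves the head of the list
  unchanged, so after normalization the first column is still a multiple of v.\<close>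

lemma unitary_first_column:
  fixes v :: "complex vec"
  assumes v: "v \<in> carrier_vec n" "v \<noteq> 0\<^sub>v n" and n: "n \<noteq> 0"
  shows "\<exists>U c. unitary_mat n U \<and> (\<forall>i<n. U $$ (i,0) = c * v $ i)"
proof -
  interpret cof_vec_space n "TYPE(complex)" .
  define ws where "ws = gram_schmidt n (basis_completion v)"
  note b = basis_completion[OF v]
  from b(6,7) n obtain vs where bv: "basis_completion v = v # vs" by (cases "basis_completion v") auto
  from gram_schmidt_result[OF b(2) b(4) b(5) ws_def] b(6)
  have ws: "set ws \<subseteq> carrier_vec n" "corthogonal ws" "length ws = n" by auto
  from gram_schmidt_hd[OF v(1), of vs, folded bv] have hd: "hd ws = v" unfolding ws_def .
  have w0: "ws ! 0 = v" using hd ws(3) n by (cases ws) auto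
  show ?thesis
    by (rule exI, rule exI, rule conjI, rule normalized_corthogonal_unitary[OF ws])
       (use n in \<open>auto simp: w0 divide_inverse mult.commute\<close>)
qed

text \<open>Deflation: a unitary W whose first column is an eigenvector turns A into a matrix B
  whose first column vanishes below the corner. Since B is hermitian its first row vanishes too, and
  the induction hypothesis applies to the remaining block \<open>B'\<close>.\<close>

lemma hermitian_spectral:
  assumes "A \<in> carrier_mat n n" "mat_adjoint A = (A :: complex mat)"
  shows "\<exists>U l. unitary_mat n U \<and> A = U * real_diag n l * mat_adjoint U"
  using assms
proof (induction n arbitrary: A)
  case 0
  have "unitary_mat 0 (1\<^sub>m 0)" by (auto simp: unitary_mat_def intro!: eq_matI)
  moreover have "A = 1\<^sub>m 0 * real_diag 0 (\<lambda>_. 0) * mat_adjoint (1\<^sub>m 0)"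
    using 0 by (auto intro!: eq_matI)
  ultimately show ?case by blast
next
  case (Suc n)
  note A = Suc.prems(1)
  from exists_eigenvector[OF A] obtain v e where v: "v \<in> carrier_vec (Suc n)" "v \<noteq> 0\<^sub>v (Suc n)"
    and ev: "A *\<^sub>v v = e \<cdot>\<^sub>v v" by auto
  from unitary_first_column[OF v] obtain W c where W: "unitary_mat (Suc n) W"
    and W0: "\<And>i. i < Suc n \<Longrightarrow> W $$ (i,0) = c * v $ i" by auto
  have Wc: "W \<in> carrier_mat (Suc n) (Suc n)" and WW: "W * mat_adjoint W = 1\<^sub>m (Suc n)"
    using W by (auto simp: unitary_mat_def)
  define B where "B = mat_adjoint W * A * W"
  have Bc: "B \<in> carrier_mat (Suc n) (Suc n)" using A Wc by (auto simp: B_def)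
  have Bh: "mat_adjoint B = B"
  proof -
    have "mat_adjoint B = mat_adjoint W * mat_adjoint (mat_adjoint W * A)"
      unfolding B_def by (rule mat_adjoint_mult) (use A Wc in auto)
    also have "mat_adjoint (mat_adjoint W * A) = A * W"
      using mat_adjoint_mult[OF mat_adjoint_carrier[OF Wc] A] Suc.prems(2) by simp
    also have "mat_adjoint W * (A * W) = B"
      unfolding B_def using A Wc by (intro assoc_mult_mat[symmetric]) auto
    finally show ?thesis .
  qed
  have AB: "A = W * B * mat_adjoint W"
  proof -
    have "W * B * mat_adjoint W = (W * mat_adjoint W) * A * (W * mat_adjoint W)"
      unfolding B_def using A Wc mat_adjoint_carrier[OF Wc] by (auto simp: mat_mult_assoc)
    thus ?thesis using A by (simp add: WW)
  qed
  have B0: "B $$ (i,0) = (if i = 0 then e else 0)" if i: "i < Suc n" for i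
  proof -
    have AW: "(A * W) $$ (k,0) = e * W $$ (k,0)" if k: "k < Suc n" for k
    proof -
      have "(A * W) $$ (k,0) = (\<Sum>j<Suc n. A $$ (k,j) * W $$ (j,0))"
        by (rule mat_mult_index[OF A Wc]) (use k in auto)
      also have "\<dots> = c * (\<Sum>j<Suc n. A $$ (k,j) * v $ j)"
        unfolding sum_distrib_left by (intro sum.cong) (auto simp: W0)
      also have "(\<Sum>j<Suc n. A $$ (k,j) * v $ j) = (A *\<^sub>v v) $ k"
        by (rule mat_vec_index[symmetric]) (use A v k in auto)
      also have "\<dots> = e * v $ k" unfolding ev using v k by auto
      finally show ?thesis using W0[OF k] by simp
    qed
    have "B = mat_adjoint W * (A * W)" unfolding B_def using A Wc by (intro assoc_mult_mat) auto
    hence "B $$ (i,0) = (\<Sum>k<Suc n. mat_adjoint W $$ (i,k) * (A * W) $$ (k,0))"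
      using mat_mult_index[OF mat_adjoint_carrier[OF Wc] mult_carrier_mat[OF A Wc] i, of 0] by simp
    also have "\<dots> = (\<Sum>k<Suc n. e * (cnj (W $$ (k,i)) * W $$ (k,0)))"
      using Wc i by (intro sum.cong) (auto simp: AW)
    also have "\<dots> = e * (\<Sum>k<Suc n. cnj (W $$ (k,i)) * W $$ (k,0))" by (simp only: sum_distrib_left)
    also have "\<dots> = (if i = 0 then e else 0)"
      using unitary_mat_left[OF W i, of 0] by simp
    finally show ?thesis .
  qed
  have Bcnj: "cnj (B $$ (j,i)) = B $$ (i,j)" if "i < Suc n" "j < Suc n" for i j
    using arg_cong[OF Bh, of "\<lambda>M. M $$ (i,j)"] Bc that by simp
  define B' where "B' = mat n n (\<lambda>(i,j). B $$ (Suc i, Suc j))"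
  have B': "B' \<in> carrier_mat n n" by (simp add: B'_def)
  have "mat_adjoint B' = B'"
    by (rule eq_matI) (use Bcnj in \<open>auto simp: B'_def\<close>)
  from Suc.IH[OF B' this] obtain U l where U: "unitary_mat n U"
    and B'U: "B' = U * real_diag n l * mat_adjoint U" by blast
  have Uc: "U \<in> carrier_mat n n" using U by (simp add: unitary_mat_def)
  define V where "V = mat (Suc n) (Suc n) (\<lambda>(i,j). if i = 0 \<or> j = 0 then (if i = j then 1 else 0)
      else U $$ (i - 1, j - 1))"
  have Vc: "V \<in> carrier_mat (Suc n) (Suc n)" by (simp add: V_def)
  have V: "unitary_mat (Suc n) V"
  proof (rule unitary_matI[OF Vc])
    fix i j assume ij: "i < Suc n" "j < Suc n"
    show "(\<Sum>k<Suc n. cnj (V $$ (k,i)) * V $$ (k,j)) = (if i = j then 1 else 0)"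
      unfolding sum.lessThan_Suc_shift
      using ij unitary_mat_left[OF U, of "i - 1" "j - 1"] by (cases i; cases j) (auto simp: V_def)
  qed
  define m where "m = (\<lambda>i. if i = 0 then Re e else l (i - 1))"
  \<comment> \<open>The corner entry of B is e and equals its own conjugate, so the eigenvalue is
    real and fits into \<open>real_diag\<close>.\<close>
  have e: "complex_of_real (Re e) = e"
    using Bcnj[of 0 0] B0[of 0] by (simp add: complex_eq_iff)
  have BV: "B = V * real_diag (Suc n) m * mat_adjoint V"
  proof (rule eq_matI)
    fix i j assume "i < dim_row (V * real_diag (Suc n) m * mat_adjoint V)"
      "j < dim_col (V * real_diag (Suc n) m * mat_adjoint V)"
    hence ij: "i < Suc n" "j < Suc n" using Vc by auto
    have "(V * real_diag (Suc n) m * mat_adjoint V) $$ (i,j)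
      = (\<Sum>k<Suc n. V $$ (i,k) * complex_of_real (m k) * cnj (V $$ (j,k)))"
      by (rule conj_real_diag_index[OF Vc ij])
    also have "\<dots> = B $$ (i,j)"
    proof (cases "i = 0 \<or> j = 0")
      case True
      have "B $$ (i,j) = (if i = 0 \<and> j = 0 then e else 0)"
        using True B0[OF ij(1)] B0[OF ij(2)] Bcnj[OF ij] by auto
      thus ?thesis unfolding sum.lessThan_Suc_shift using ij True e
        by (auto simp: V_def m_def)
    next
      case False
      then obtain i' j' where i': "i = Suc i'" "j = Suc j'" by (cases i; cases j) auto
      have "B $$ (i,j) = B' $$ (i',j')" using i' ij by (simp add: B'_def)
      also have "\<dots> = (\<Sum>k<n. U $$ (i',k) * complex_of_real (l k) * cnj (U $$ (j',k)))"
        unfolding B'U by (rule conj_real_diag_index[OF Uc]) (use i' ij in auto)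
      finally show ?thesis unfolding sum.lessThan_Suc_shift using ij i'
        by (auto simp: V_def m_def)
    qed
    finally show "B $$ (i,j) = (V * real_diag (Suc n) m * mat_adjoint V) $$ (i,j)" by simp
  qed (use Bc Vc in auto)
  have "A = (W * V) * real_diag (Suc n) m * mat_adjoint (W * V)"
  proof -
    have "W * (V * real_diag (Suc n) m * mat_adjoint V) * mat_adjoint W
      = (W * V) * real_diag (Suc n) m * (mat_adjoint V * mat_adjoint W)"
      using Wc Vc mat_adjoint_carrier[OF Wc] mat_adjoint_carrier[OF Vc] real_diag_carrier[of "Suc n" m]
      by (auto simp: mat_mult_assoc)
    thus ?thesis using AB BV mat_adjoint_mult[OF Wc Vc] by simp
  qed
  with unitary_mat_mult[OF W V] show ?case by blast
qed

section \<open>Functional calculus, Kraus maps and trace Jensen\<close>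

lemma real_diag_mult_index:
  assumes A: "A \<in> carrier_mat n m" and ij: "i < n" "j < m"
  shows "(real_diag n l * A) $$ (i,j) = complex_of_real (l i) * A $$ (i,j)"
proof -
  have "(real_diag n l * A) $$ (i,j) = (\<Sum>k<n. if k = i then complex_of_real (l i) * A $$ (i,j) else 0)"
    using ij unfolding mat_mult_index[OF real_diag_carrier A ij]
    by (intro sum.cong) (auto simp: real_diag_def)
  thus ?thesis using ij by simp
qed

lemma unitary_matD:
  assumes "unitary_mat n U"
  shows "U \<in> carrier_mat n n" "mat_adjoint U \<in> carrier_mat n n"
    "U * mat_adjoint U = 1\<^sub>m n" "mat_adjoint U * U = 1\<^sub>m n"
  using assms by (auto simp: unitary_mat_def)

text \<open>This makes the choice in \<open>matfun\<close> harmless. The matrix \<open>W\<close>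
  relating the two eigenbases satisfies \<open>l i * W(i,j) = W(i,j) * m j\<close>, so it vanishes
  unless \<open>l i = m j\<close>. The same relation therefore holds for f of the eigenvalues,
  whatever f is.\<close>

lemma spectral_fun_unique:
  assumes U: "unitary_mat n U" and V: "unitary_mat n V"
    and eq: "U * real_diag n l * mat_adjoint U = V * real_diag n m * mat_adjoint V"
  shows "U * real_diag n (f \<circ> l) * mat_adjoint U = V * real_diag n (f \<circ> m) * mat_adjoint V"
proof -
  note u = unitary_matD[OF U] and v = unitary_matD[OF V]
  define W where "W = mat_adjoint U * V"
  have W: "W \<in> carrier_mat n n" using u v by (auto simp: W_def)
  have "real_diag n l * W = (mat_adjoint U * U) * real_diag n l * W"
    using u left_mult_one_mat[OF real_diag_carrier] by simp
  also have "\<dots> = mat_adjoint U * (U * real_diag n l * mat_adjoint U) * V"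
    unfolding W_def using u(1,2) v(1,2) real_diag_carrier[of n l]
    by (auto simp: mat_mult_assoc)
  also have "\<dots> = mat_adjoint U * (V * real_diag n m * mat_adjoint V) * V" unfolding eq ..
  also have "\<dots> = W * real_diag n m * (mat_adjoint V * V)"
    unfolding W_def using u(1,2) v(1,2) real_diag_carrier[of n m]
    by (auto simp: mat_mult_assoc)
  also have "\<dots> = W * real_diag n m" using v right_mult_one_mat[OF mult_carrier_mat[OF W real_diag_carrier]] by simp
  finally have c: "real_diag n l * W = W * real_diag n m" .
  have "real_diag n (f \<circ> l) * W = W * real_diag n (f \<circ> m)"
  proof (rule eq_matI)
    fix i j assume "i < dim_row (W * real_diag n (f \<circ> m))" "j < dim_col (W * real_diag n (f \<circ> m))"
    hence ij: "i < n" "j < n" using W by (auto simp: real_diag_def)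
    have "complex_of_real (l i) * W $$ (i,j) = W $$ (i,j) * complex_of_real (m j)"
      using arg_cong[OF c, of "\<lambda>M. M $$ (i,j)"]
      unfolding real_diag_mult_index[OF W ij] mult_real_diag_index[OF W ij] .
    hence "W $$ (i,j) = 0 \<or> l i = m j" by auto
    thus "(real_diag n (f \<circ> l) * W) $$ (i,j) = (W * real_diag n (f \<circ> m)) $$ (i,j)"
      unfolding real_diag_mult_index[OF W ij] mult_real_diag_index[OF W ij] by auto
  qed (use W in \<open>auto simp: real_diag_def\<close>)
  hence c': "U * (real_diag n (f \<circ> l) * W) * mat_adjoint V = U * (W * real_diag n (f \<circ> m)) * mat_adjoint V"
    by simp
  have "U * (real_diag n (f \<circ> l) * W) * mat_adjoint V = U * real_diag n (f \<circ> l) * mat_adjoint U * (V * mat_adjoint V)"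
    unfolding W_def using u(1,2) v(1,2) real_diag_carrier[of n "f \<circ> l"]
    by (auto simp: mat_mult_assoc)
  moreover have "U * (W * real_diag n (f \<circ> m)) * mat_adjoint V = (U * mat_adjoint U) * V * real_diag n (f \<circ> m) * mat_adjoint V"
    unfolding W_def using u(1,2) v(1,2) real_diag_carrier[of n "f \<circ> m"]
    by (auto simp: mat_mult_assoc)
  ultimately show ?thesis using c' u v by (simp add: right_mult_one_mat[of _ n n])
qed

lemma conj_real_diag_carrier:
  "unitary_mat n U \<Longrightarrow> U * real_diag n l * mat_adjoint U \<in> carrier_mat n n"
  using unitary_matD[of n U] by auto

lemma matfun_eq:
  assumes U: "unitary_mat n U" and A: "A = U * real_diag n l * mat_adjoint U"
  shows "matfun f A = U * real_diag n (f \<circ> l) * mat_adjoint U"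
proof -
  have n: "dim_row A = n" using carrier_matD(1)[OF conj_real_diag_carrier[OF U, of l]] A by simp
  show ?thesis unfolding matfun_def n
  proof (rule someI2)
    show "\<exists>U' l'. unitary_mat n U' \<and> A = U' * real_diag n l' * mat_adjoint U' \<and>
      U * real_diag n (f \<circ> l) * mat_adjoint U = U' * real_diag n (f \<circ> l') * mat_adjoint U'"
      using U A by blast
  next
    fix B assume "\<exists>U' l'. unitary_mat n U' \<and> A = U' * real_diag n l' * mat_adjoint U' \<and>
      B = U' * real_diag n (f \<circ> l') * mat_adjoint U'"
    thus "B = U * real_diag n (f \<circ> l) * mat_adjoint U"
      using spectral_fun_unique[OF U _ A[symmetric, THEN trans], of _ _ f] A by metis
  qed
qed

lemma conj_real_diag_mult:
  assumes U: "unitary_mat n U"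
  shows "(U * real_diag n l * mat_adjoint U) * (U * real_diag n m * mat_adjoint U)
    = U * real_diag n (\<lambda>i. l i * m i) * mat_adjoint U"
proof -
  note u = unitary_matD[OF U]
  have d: "real_diag n l * real_diag n m = real_diag n (\<lambda>i. l i * m i)"
  proof (rule eq_matI)
    fix i j assume "i < dim_row (real_diag n (\<lambda>i. l i * m i))" "j < dim_col (real_diag n (\<lambda>i. l i * m i))"
    hence ij: "i < n" "j < n" by (auto simp: real_diag_def)
    show "(real_diag n l * real_diag n m) $$ (i,j) = real_diag n (\<lambda>i. l i * m i) $$ (i,j)"
      unfolding real_diag_mult_index[OF real_diag_carrier ij] using ij by (auto simp: real_diag_def)
  qed (auto simp: real_diag_def)
  have "(U * real_diag n l * mat_adjoint U) * (U * real_diag n m * mat_adjoint U)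
    = U * real_diag n l * (mat_adjoint U * U) * real_diag n m * mat_adjoint U"
    using u(1,2) real_diag_carrier[of n l] real_diag_carrier[of n m]
    by (auto simp: mat_mult_assoc)
  also have "\<dots> = U * (real_diag n l * real_diag n m) * mat_adjoint U"
    using u by (simp add: assoc_mult_mat[of _ n n _ n _ n] right_mult_one_mat[of _ n n])
  finally show ?thesis unfolding d .
qed

lemma conj_real_diag_smult:
  assumes U: "unitary_mat n U"
  shows "complex_of_real c \<cdot>\<^sub>m (U * real_diag n l * mat_adjoint U) = U * real_diag n (\<lambda>i. c * l i) * mat_adjoint U"
proof (rule eq_matI)
  note u = unitary_matD[OF U]
  fix i j assume "i < dim_row (U * real_diag n (\<lambda>i. c * l i) * mat_adjoint U)" "j < dim_col (U * real_diag n (\<lambda>i. c * l i) * mat_adjoint U)"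
  hence ij: "i < n" "j < n" using u by auto
  thus "(complex_of_real c \<cdot>\<^sub>m (U * real_diag n l * mat_adjoint U)) $$ (i,j) = (U * real_diag n (\<lambda>i. c * l i) * mat_adjoint U) $$ (i,j)"
    unfolding conj_real_diag_index[OF u(1) ij] using u
    by (subst index_smult_mat) (auto simp: conj_real_diag_index[OF u(1) ij] sum_distrib_left ac_simps intro!: sum.cong)
qed (use unitary_matD[OF U] in auto)

lemma conj_real_diag_adjoint:
  assumes U: "unitary_mat n U"
  shows "mat_adjoint (U * real_diag n l * mat_adjoint U) = U * real_diag n l * mat_adjoint U"
proof (rule eq_matI)
  note u = unitary_matD[OF U]
  fix i j assume "i < dim_row (U * real_diag n l * mat_adjoint U)" "j < dim_col (U * real_diag n l * mat_adjoint U)"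
  hence ij: "i < n" "j < n" using u by auto
  thus "mat_adjoint (U * real_diag n l * mat_adjoint U) $$ (i,j) = (U * real_diag n l * mat_adjoint U) $$ (i,j)"
    unfolding conj_real_diag_index[OF u(1) ij] using u
    by (subst mat_adjoint_index) (auto simp: conj_real_diag_index[OF u(1) ij(2,1)] ac_simps intro!: sum.cong)
qed (use unitary_matD[OF U] in auto)

lemma conj_real_diag_one:
  assumes U: "unitary_mat n U"
  shows "U * real_diag n (\<lambda>_. 1) * mat_adjoint U = 1\<^sub>m n"
proof -
  note u = unitary_matD[OF U]
  have "real_diag n (\<lambda>_. 1) = 1\<^sub>m n" by (rule eq_matI) (auto simp: real_diag_def)
  thus ?thesis using u by simp
qed

section \<open>Traces, quadratic forms and positive semidefinite matrices\<close>

lemma mtrace_carrier: "A \<in> carrier_mat n n \<Longrightarrow> mtrace A = (\<Sum>i<n. A $$ (i,i))"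
  by (simp add: mtrace_def)

lemma mtrace_conj_real_diag:
  assumes U: "unitary_mat n U"
  shows "mtrace (U * real_diag n l * mat_adjoint U) = (\<Sum>i<n. complex_of_real (l i))"
proof -
  note u = unitary_matD[OF U]
  have "mtrace (U * real_diag n l * mat_adjoint U) = (\<Sum>i<n. \<Sum>k<n. U $$ (i,k) * complex_of_real (l k) * cnj (U $$ (i,k)))"
    unfolding mtrace_carrier[OF conj_real_diag_carrier[OF U]]
    by (intro sum.cong) (auto simp: conj_real_diag_index[OF u(1)])
  also have "\<dots> = (\<Sum>k<n. complex_of_real (l k) * (\<Sum>i<n. cnj (U $$ (i,k)) * U $$ (i,k)))"
    unfolding sum_distrib_left by (subst sum.swap) (simp add: ac_simps)
  also have "\<dots> = (\<Sum>i<n. complex_of_real (l i))"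
    using unitary_mat_left[OF U] by (intro sum.cong) auto
  finally show ?thesis .
qed

text \<open>Vectors are plain functions here, so that restrictions to blocks and images under
  adjoint Kraus operators can be written as lambda terms without carrier conditions.\<close>

definition qform :: "nat \<Rightarrow> complex mat \<Rightarrow> (nat \<Rightarrow> complex) \<Rightarrow> complex" where
  "qform n A v = (\<Sum>i<n. \<Sum>j<n. cnj (v i) * A $$ (i,j) * v j)"

lemma qform_vec:
  assumes A: "A \<in> carrier_mat n n" and v: "v \<in> carrier_vec n"
  shows "conjugate v \<bullet> (A *\<^sub>v v) = qform n A (\<lambda>i. v $ i)"
proof -
  have "conjugate v \<bullet> (A *\<^sub>v v) = (\<Sum>i<n. cnj (v $ i) * (A *\<^sub>v v) $ i)"
    using A v by (auto simp: scalar_prod_def atLeast0LessThan intro!: sum.cong)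
  also have "\<dots> = qform n A (\<lambda>i. v $ i)"
    unfolding qform_def by (intro sum.cong refl) (simp add: mat_vec_index[OF A v] sum_distrib_left ac_simps del: index_mult_mat_vec)
  finally show ?thesis .
qed

lemma psd_iff_qform:
  "psd n A \<longleftrightarrow> A \<in> carrier_mat n n \<and> mat_adjoint A = A \<and> (\<forall>v. 0 \<le> Re (qform n A v))"
proof -
  have "(\<forall>v \<in> carrier_vec n. 0 \<le> Re (conjugate v \<bullet> (A *\<^sub>v v))) \<longleftrightarrow> (\<forall>v. 0 \<le> Re (qform n A v))"
    if A: "A \<in> carrier_mat n n"
  proof safe
    fix v assume h: "\<forall>v \<in> carrier_vec n. 0 \<le> Re (conjugate v \<bullet> (A *\<^sub>v v))"
    have "qform n A v = qform n A (\<lambda>i. vec n v $ i)" unfolding qform_def by (intro sum.cong) auto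
    moreover have "0 \<le> Re (conjugate (vec n v) \<bullet> (A *\<^sub>v vec n v))" using h by simp
    ultimately show "0 \<le> Re (qform n A v)" using qform_vec[OF A, of "vec n v"] by simp
  qed (auto simp: qform_vec[OF A])
  thus ?thesis by (auto simp: psd_def)
qed

lemma psdD:
  assumes "psd n A"
  shows "A \<in> carrier_mat n n" "mat_adjoint A = A" "0 \<le> Re (qform n A v)"
  using assms by (auto simp: psd_iff_qform)

lemma cnj_mult_self: "cnj z * z = complex_of_real ((cmod z)\<^sup>2)"
  by (metis complex_norm_square mult.commute)

lemma qform_conj_real_diag:
  assumes U: "U \<in> carrier_mat n m"
  shows "qform n (U * real_diag m l * mat_adjoint U) v
    = complex_of_real (\<Sum>k<m. l k * (cmod (\<Sum>a<n. cnj (U $$ (a,k)) * v a))\<^sup>2)"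
proof -
  have "qform n (U * real_diag m l * mat_adjoint U) v =
    (\<Sum>a<n. \<Sum>b<n. \<Sum>k<m. cnj (v a) * U $$ (a,k) * complex_of_real (l k) * (cnj (U $$ (b,k)) * v b))"
    unfolding qform_def
    by (intro sum.cong refl) (simp add: conj_real_diag_index[OF U] sum_distrib_left sum_distrib_right ac_simps)
  also have "\<dots> = (\<Sum>a<n. \<Sum>k<m. \<Sum>b<n. cnj (v a) * U $$ (a,k) * complex_of_real (l k) * (cnj (U $$ (b,k)) * v b))"
    by (rule sum.cong[OF refl], rule sum.swap)
  also have "\<dots> = (\<Sum>k<m. \<Sum>a<n. \<Sum>b<n. cnj (v a) * U $$ (a,k) * complex_of_real (l k) * (cnj (U $$ (b,k)) * v b))"
    by (rule sum.swap)
  also have "\<dots> = (\<Sum>k<m. complex_of_real (l k) * (cnj (\<Sum>a<n. cnj (U $$ (a,k)) * v a) * (\<Sum>b<n. cnj (U $$ (b,k)) * v b)))"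
    by (intro sum.cong refl) (simp add: sum_distrib_left sum_distrib_right ac_simps)
  also have "\<dots> = complex_of_real (\<Sum>k<m. l k * (cmod (\<Sum>a<n. cnj (U $$ (a,k)) * v a))\<^sup>2)"
    unfolding of_real_sum of_real_mult by (intro sum.cong refl) (simp only: cnj_mult_self)
  finally show ?thesis .
qed

lemma qform_eigenvector:
  assumes U: "unitary_mat n U" and i: "i < n"
  shows "qform n (U * real_diag n l * mat_adjoint U) (\<lambda>a. U $$ (a,i)) = complex_of_real (l i)"
proof -
  have "(\<Sum>j<n. l j * (cmod (\<Sum>a<n. cnj (U $$ (a,j)) * U $$ (a,i)))\<^sup>2) = (\<Sum>j<n. if j = i then l i else 0)"
    using unitary_mat_left[OF U _ i] by (intro sum.cong) auto
  thus ?thesis unfolding qform_conj_real_diag[OF unitary_matD(1)[OF U]] using i by simp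
qed

lemma psd_spectral:
  assumes "psd n A"
  obtains U l where "unitary_mat n U" "A = U * real_diag n l * mat_adjoint U" "\<And>i. i < n \<Longrightarrow> 0 \<le> l i"
proof -
  note A = psdD[OF assms]
  from hermitian_spectral[OF A(1,2)] obtain U l where U: "unitary_mat n U"
    and eq: "A = U * real_diag n l * mat_adjoint U" by blast
  have "0 \<le> l i" if i: "i < n" for i
    using A(3)[of "\<lambda>a. U $$ (a,i)"] unfolding eq qform_eigenvector[OF U i] by simp
  thus ?thesis using that U eq by blast
qed

lemma psd_conj_real_diag:
  assumes U: "unitary_mat n U" and "\<And>i. i < n \<Longrightarrow> 0 \<le> l i"
  shows "psd n (U * real_diag n l * mat_adjoint U)"
  unfolding psd_iff_qform
  using conj_real_diag_adjoint[OF U] conj_real_diag_carrier[OF U] assms(2)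
  by (auto simp: qform_conj_real_diag[OF unitary_matD(1)[OF U]] intro!: sum_nonneg simp del: of_real_sum)

text \<open>In the eigenbasis the form is a sum of nonnegative terms \<open>l k * |g k|^2\<close>.
  If it vanishes, then so does each \<open>l k * g k\<close>, and the vector A v is a combination of
  these numbers.\<close>

lemma psd_qform_zero:
  assumes psd: "psd n A" and z: "Re (qform n A v) \<le> 0" and i: "i < n"
  shows "(\<Sum>j<n. A $$ (i,j) * v j) = 0"
proof -
  from psd_spectral[OF psd] obtain U l where U: "unitary_mat n U"
    and eq: "A = U * real_diag n l * mat_adjoint U" and l: "\<And>i. i < n \<Longrightarrow> 0 \<le> l i" by blast
  note u = unitary_matD[OF U]
  let ?g = "\<lambda>k. \<Sum>a<n. cnj (U $$ (a,k)) * v a"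
  have "(\<Sum>k<n. l k * (cmod (?g k))\<^sup>2) \<le> 0"
    using z unfolding eq qform_conj_real_diag[OF u(1)] by simp
  hence "(\<Sum>k<n. l k * (cmod (?g k))\<^sup>2) = 0" using l by (intro antisym sum_nonneg) auto
  hence "\<forall>k\<in>{..<n}. l k * (cmod (?g k))\<^sup>2 = 0"
    using l by (subst (asm) sum_nonneg_eq_0_iff) auto
  hence zk: "complex_of_real (l k) * ?g k = 0" if "k < n" for k using that by auto
  have "(\<Sum>j<n. A $$ (i,j) * v j) = (\<Sum>j<n. \<Sum>k<n. U $$ (i,k) * (complex_of_real (l k) * (cnj (U $$ (j,k)) * v j)))"
    unfolding eq using i
    by (intro sum.cong refl) (simp add: conj_real_diag_index[OF u(1)] sum_distrib_left sum_distrib_right ac_simps)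
  also have "\<dots> = (\<Sum>k<n. U $$ (i,k) * (complex_of_real (l k) * ?g k))"
    by (subst sum.swap) (simp add: sum_distrib_left)
  also have "\<dots> = 0" using zk by (intro sum.neutral) simp
  finally show ?thesis .
qed

lemma psd_mtrace_nonneg: assumes "psd n A" shows "0 \<le> Re (mtrace A)"
proof -
  from psd_spectral[OF assms] obtain U l where U: "unitary_mat n U"
    and eq: "A = U * real_diag n l * mat_adjoint U" and l: "\<And>i. i < n \<Longrightarrow> 0 \<le> l i" by blast
  show ?thesis unfolding eq mtrace_conj_real_diag[OF U] using l by (auto intro!: sum_nonneg)
qed

lemma qform_diff:
  assumes "A \<in> carrier_mat n n" "B \<in> carrier_mat n n"
  shows "qform n (c \<cdot>\<^sub>m A - B) v = c * qform n A v - qform n B v"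
  unfolding qform_def sum_distrib_left sum_subtractf[symmetric]
  using assms by (intro sum.cong refl) (auto simp: algebra_simps)

text \<open>If \<sigma> v = 0, then the form of \<rho> at v is at most c times that of \<sigma>,
  hence at most 0, and \<open>psd_qform_zero\<close> gives \<rho> v = 0.\<close>

lemma supp_le_if_dominated:
  assumes \<rho>: "psd n \<rho>" and \<sigma>: "\<sigma> \<in> carrier_mat n n" and dom: "psd n (complex_of_real c \<cdot>\<^sub>m \<sigma> - \<rho>)"
  shows "supp_le \<rho> \<sigma>"
  unfolding supp_le_def
proof safe
  fix v assume v: "v \<in> carrier_vec (dim_row \<sigma>)" and z: "\<sigma> *\<^sub>v v = 0\<^sub>v (dim_row \<sigma>)"
  have v': "v \<in> carrier_vec n" using v \<sigma> by simp
  note r = psdD[OF \<rho>]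
  have "qform n \<sigma> (\<lambda>i. v $ i) = 0" using qform_vec[OF \<sigma> v'] z \<sigma> v' by simp
  hence q: "Re (qform n \<rho> (\<lambda>i. v $ i)) \<le> 0"
    using psdD(3)[OF dom, of "\<lambda>i. v $ i"] unfolding qform_diff[OF \<sigma> r(1)] by simp
  show "\<rho> *\<^sub>v v = 0\<^sub>v (dim_row \<rho>)"
  proof (rule eq_vecI)
    fix i assume "i < dim_vec (0\<^sub>v (dim_row \<rho>) :: complex vec)"
    hence i: "i < n" using r by simp
    show "(\<rho> *\<^sub>v v) $ i = 0\<^sub>v (dim_row \<rho>) $ i"
      unfolding mat_vec_index[OF r(1) v' i] psd_qform_zero[OF \<rho> q i] using i r by simp
  qed simp
qed

lemma supp_le_mult_zero:
  assumes s: "supp_le \<rho> \<sigma>" and c: "\<rho> \<in> carrier_mat n n" "\<sigma> \<in> carrier_mat n n" "M \<in> carrier_mat n m"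
    and z: "\<sigma> * M = 0\<^sub>m n m"
  shows "\<rho> * M = 0\<^sub>m n m"
proof (rule eq_matI)
  fix i j assume "i < dim_row (0\<^sub>m n m :: complex mat)" "j < dim_col (0\<^sub>m n m :: complex mat)"
  hence ij: "i < n" "j < m" by auto
  have "\<sigma> *\<^sub>v col M j = col (\<sigma> * M) j" using c ij by auto
  also have "\<dots> = 0\<^sub>v n" unfolding z using ij by auto
  finally have "\<rho> *\<^sub>v col M j = 0\<^sub>v n" using s c ij unfolding supp_le_def by auto
  hence "(\<rho> *\<^sub>v col M j) $ i = 0" using ij by simp
  thus "(\<rho> * M) $$ (i,j) = 0\<^sub>m n m $$ (i,j)" using c ij by (auto simp: index_mult_mat(1))
qed (use c in auto)

text \<open>Kraus operators may be rectangular, since T lowers the dimension. The index type is left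
  open because a channel is indexed by numbers and T by pairs.\<close>

definition kmap :: "nat \<Rightarrow> 's set \<Rightarrow> ('s \<Rightarrow> complex mat) \<Rightarrow> complex mat \<Rightarrow> complex mat" where
  "kmap n I W X = mat n n (\<lambda>(i,j). \<Sum>s\<in>I. (W s * X * mat_adjoint (W s)) $$ (i,j))"

lemma kmap_carrier [simp]: "kmap n I W X \<in> carrier_mat n n"
  by (simp add: kmap_def)

lemma conj_index:
  assumes W: "W \<in> carrier_mat n m" and X: "X \<in> carrier_mat m m" and ij: "i < n" "j < n"
  shows "(W * X * mat_adjoint W) $$ (i,j) = (\<Sum>p<m. \<Sum>q<m. W $$ (i,p) * X $$ (p,q) * cnj (W $$ (j,q)))"
proof -
  have "(W * X * mat_adjoint W) $$ (i,j) = (\<Sum>q<m. (W * X) $$ (i,q) * mat_adjoint W $$ (q,j))"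
    by (rule mat_mult_index) (use W X ij in auto)
  also have "\<dots> = (\<Sum>q<m. \<Sum>p<m. W $$ (i,p) * X $$ (p,q) * cnj (W $$ (j,q)))"
    using W X ij by (intro sum.cong refl) (simp add: mat_mult_index[OF W X] sum_distrib_right)
  also have "\<dots> = (\<Sum>p<m. \<Sum>q<m. W $$ (i,p) * X $$ (p,q) * cnj (W $$ (j,q)))" by (rule sum.swap)
  finally show ?thesis .
qed

lemma kmap_index:
  assumes W: "\<forall>s\<in>I. W s \<in> carrier_mat n m" and X: "X \<in> carrier_mat m m" and ij: "i < n" "j < n"
  shows "kmap n I W X $$ (i,j) = (\<Sum>s\<in>I. \<Sum>p<m. \<Sum>q<m. W s $$ (i,p) * X $$ (p,q) * cnj (W s $$ (j,q)))"
  unfolding kmap_def using ij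
  by (auto intro!: sum.cong simp: conj_index[OF bspec[OF W] X])

lemma qform_kmap:
  assumes W: "\<forall>s\<in>I. W s \<in> carrier_mat n m" and X: "X \<in> carrier_mat m m"
  shows "qform n (kmap n I W X) v = (\<Sum>s\<in>I. qform m X (\<lambda>p. \<Sum>i<n. cnj (W s $$ (i,p)) * v i))"
proof -
  have "qform n (kmap n I W X) v = (\<Sum>i<n. \<Sum>j<n. \<Sum>s\<in>I. \<Sum>p<m. \<Sum>q<m.
      cnj (v i) * W s $$ (i,p) * X $$ (p,q) * (cnj (W s $$ (j,q)) * v j))"
    unfolding qform_def
    by (intro sum.cong refl) (simp add: kmap_index[OF W X] sum_distrib_left sum_distrib_right ac_simps)
  also have "\<dots> = (\<Sum>s\<in>I. \<Sum>i<n. \<Sum>j<n. \<Sum>p<m. \<Sum>q<m.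
      cnj (v i) * W s $$ (i,p) * X $$ (p,q) * (cnj (W s $$ (j,q)) * v j))"
    by (simp only: sum.swap[of _ I])
  also have "\<dots> = (\<Sum>s\<in>I. \<Sum>p<m. \<Sum>q<m. \<Sum>i<n. \<Sum>j<n.
      cnj (v i) * W s $$ (i,p) * X $$ (p,q) * (cnj (W s $$ (j,q)) * v j))"
    by (simp only: sum.swap[of _ "{..<m}" "{..<n}"])
  also have "\<dots> = (\<Sum>s\<in>I. qform m X (\<lambda>p. \<Sum>i<n. cnj (W s $$ (i,p)) * v i))"
    unfolding qform_def
    by (intro sum.cong refl) (simp add: sum_distrib_left sum_distrib_right ac_simps)
  finally show ?thesis .
qed

lemma kmap_adjoint:
  assumes W: "\<forall>s\<in>I. W s \<in> carrier_mat n m" and X: "X \<in> carrier_mat m m"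
  shows "mat_adjoint (kmap n I W X) = kmap n I W (mat_adjoint X)"
proof (rule eq_matI)
  fix i j assume "i < dim_row (kmap n I W (mat_adjoint X))" "j < dim_col (kmap n I W (mat_adjoint X))"
  hence ij: "i < n" "j < n" by (auto simp: kmap_def)
  have "mat_adjoint (kmap n I W X) $$ (i,j) = cnj (kmap n I W X $$ (j,i))"
    using ij by (subst mat_adjoint_index) (auto simp: kmap_def)
  also have "\<dots> = (\<Sum>s\<in>I. \<Sum>p<m. \<Sum>q<m. cnj (W s $$ (j,p) * X $$ (p,q) * cnj (W s $$ (i,q))))"
    by (simp add: kmap_index[OF W X ij(2,1)])
  also have "\<dots> = (\<Sum>s\<in>I. \<Sum>q<m. \<Sum>p<m. cnj (W s $$ (j,p) * X $$ (p,q) * cnj (W s $$ (i,q))))"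
    by (rule sum.cong[OF refl], rule sum.swap)
  also have "\<dots> = kmap n I W (mat_adjoint X) $$ (i,j)"
    unfolding kmap_index[OF W mat_adjoint_carrier[OF X] ij] using X by (intro sum.cong refl) (auto simp: ac_simps)
  finally show "mat_adjoint (kmap n I W X) $$ (i,j) = kmap n I W (mat_adjoint X) $$ (i,j)" .
qed (auto simp: kmap_def)

lemma psd_kmap:
  assumes W: "\<forall>s\<in>I. W s \<in> carrier_mat n m" and X: "psd m X"
  shows "psd n (kmap n I W X)"
  unfolding psd_iff_qform
  using kmap_adjoint[OF W psdD(1)[OF X]] psdD[OF X]
  by (auto simp: qform_kmap[OF W psdD(1)[OF X]] intro!: sum_nonneg)

lemma kmap_diff:
  assumes W: "\<forall>s\<in>I. W s \<in> carrier_mat n m" and X: "X \<in> carrier_mat m m" and Y: "Y \<in> carrier_mat m m"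
  shows "kmap n I W (c \<cdot>\<^sub>m X - Y) = c \<cdot>\<^sub>m kmap n I W X - kmap n I W Y"
proof (rule eq_matI)
  fix i j assume "i < dim_row (c \<cdot>\<^sub>m kmap n I W X - kmap n I W Y)" "j < dim_col (c \<cdot>\<^sub>m kmap n I W X - kmap n I W Y)"
  hence ij: "i < n" "j < n" by (auto simp: kmap_def)
  have XY: "c \<cdot>\<^sub>m X - Y \<in> carrier_mat m m" using X Y by auto
  have "kmap n I W (c \<cdot>\<^sub>m X - Y) $$ (i,j) = c * kmap n I W X $$ (i,j) - kmap n I W Y $$ (i,j)"
    unfolding kmap_index[OF W XY ij] kmap_index[OF W X ij] kmap_index[OF W Y ij] sum_distrib_left sum_subtractf[symmetric]
    using X Y by (intro sum.cong refl) (auto simp: algebra_simps)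
  thus "kmap n I W (c \<cdot>\<^sub>m X - Y) $$ (i,j) = (c \<cdot>\<^sub>m kmap n I W X - kmap n I W Y) $$ (i,j)"
    using ij by (simp add: kmap_def)
qed (auto simp: kmap_def)

lemma kmap_intertwine:
  assumes W: "\<forall>s\<in>I. W s \<in> carrier_mat n m" and X: "X \<in> carrier_mat m m"
    and A: "A \<in> carrier_mat m m" "A' \<in> carrier_mat n n" and B: "B \<in> carrier_mat m m" "B' \<in> carrier_mat n n"
    and WA: "\<And>s. s \<in> I \<Longrightarrow> W s * A = A' * W s"
    and WB: "\<And>s. s \<in> I \<Longrightarrow> B * mat_adjoint (W s) = mat_adjoint (W s) * B'"
  shows "kmap n I W (A * X * B) = A' * kmap n I W X * B'"
proof (rule eq_matI)
  fix i j assume "i < dim_row (A' * kmap n I W X * B')" "j < dim_col (A' * kmap n I W X * B')"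
  hence ij: "i < n" "j < n" using A B by auto
  have step: "W s * (A * X * B) * mat_adjoint (W s) = A' * (W s * X * mat_adjoint (W s)) * B'" if s: "s \<in> I" for s
  proof -
    note c = bspec[OF W s] X A B
    have "W s * (A * X * B) * mat_adjoint (W s) = (W s * A) * X * (B * mat_adjoint (W s))"
      using c by (auto simp: mat_mult_assoc)
    also have "\<dots> = (A' * W s) * X * (mat_adjoint (W s) * B')" by (simp only: WA[OF s] WB[OF s])
    also have "\<dots> = A' * (W s * X * mat_adjoint (W s)) * B'"
      using c by (auto simp: mat_mult_assoc)
    finally show ?thesis .
  qed
  have tri: "(A' * M * B') $$ (i,j) = (\<Sum>q<n. \<Sum>p<n. A' $$ (i,p) * M $$ (p,q) * B' $$ (q,j))" if M: "M \<in> carrier_mat n n" for M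
  proof -
    have AM: "A' * M \<in> carrier_mat n n" using A M by auto
    show ?thesis unfolding mat_mult_index[OF AM B(2) ij]
      using ij by (intro sum.cong refl) (simp add: mat_mult_index[OF A(2) M] sum_distrib_right)
  qed
  have "kmap n I W (A * X * B) $$ (i,j) = (\<Sum>s\<in>I. (A' * (W s * X * mat_adjoint (W s)) * B') $$ (i,j))"
    unfolding kmap_def using ij step by (simp)
  also have "\<dots> = (\<Sum>s\<in>I. \<Sum>q<n. \<Sum>p<n. A' $$ (i,p) * (W s * X * mat_adjoint (W s)) $$ (p,q) * B' $$ (q,j))"
    using bspec[OF W] X by (intro sum.cong refl tri) (meson mat_adjoint_carrier mult_carrier_mat)
  also have "\<dots> = (\<Sum>q<n. \<Sum>p<n. \<Sum>s\<in>I. A' $$ (i,p) * (W s * X * mat_adjoint (W s)) $$ (p,q) * B' $$ (q,j))"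
    by (simp only: sum.swap[of _ "{..<n}" I])
  also have "\<dots> = (\<Sum>q<n. \<Sum>p<n. A' $$ (i,p) * kmap n I W X $$ (p,q) * B' $$ (q,j))"
    by (intro sum.cong refl) (simp add: kmap_def sum_distrib_left sum_distrib_right)
  also have "\<dots> = (A' * kmap n I W X * B') $$ (i,j)" by (rule tri[symmetric]) simp
  finally show "kmap n I W (A * X * B) $$ (i,j) = (A' * kmap n I W X * B') $$ (i,j)" .
qed (use A B in \<open>auto simp: kmap_def\<close>)

text \<open>With eigenvectors v_j of the input and u_i of the output, \<open>w i j\<close> is the
  form of the image of the projection onto v_j, evaluated at u_i. Row sums come from the image of
  the identity. Column sums are the trace of the image of a rank-one projection, taken in the basis
  of the u_i.\<close>

lemma kmap_spectral_weights:
  assumes W: "\<forall>s\<in>I. W s \<in> carrier_mat n m"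
    and tp: "\<And>X. X \<in> carrier_mat m m \<Longrightarrow> mtrace (kmap n I W X) = mtrace X"
    and un: "kmap n I W (1\<^sub>m m) = complex_of_real \<kappa> \<cdot>\<^sub>m 1\<^sub>m n"
    and V: "unitary_mat m V" and U: "unitary_mat n U"
    and eq: "kmap n I W (V * real_diag m l * mat_adjoint V) = U * real_diag n \<mu> * mat_adjoint U"
  obtains w :: "nat \<Rightarrow> nat \<Rightarrow> real" where "\<And>i j. 0 \<le> w i j"
    "\<And>i. i < n \<Longrightarrow> \<mu> i = (\<Sum>j<m. w i j * l j)"
    "\<And>i. i < n \<Longrightarrow> (\<Sum>j<m. w i j) = \<kappa>"
    "\<And>j. j < m \<Longrightarrow> (\<Sum>i<n. w i j) = 1"
proof -
  note u = unitary_matD[OF U] and v = unitary_matD[OF V]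
  define w where "w i j = (\<Sum>s\<in>I. (cmod (\<Sum>p<m. cnj (V $$ (p,j)) * (\<Sum>a<n. cnj (W s $$ (a,p)) * U $$ (a,i))))\<^sup>2)" for i j
  have nonneg: "0 \<le> w i j" for i j unfolding w_def by (intro sum_nonneg) auto
  \<comment> \<open>One identity for an arbitrary diagonal k has three uses: \<open>k = l\<close>
    yields the eigenvalues \<mu>, the constant 1 yields the row sums, and the indicator of j yields
    \<open>w i j\<close> itself.\<close>
  have q: "qform n (kmap n I W (V * real_diag m k * mat_adjoint V)) (\<lambda>a. U $$ (a,i)) = complex_of_real (\<Sum>j<m. w i j * k j)" for k i
  proof -
    have "qform n (kmap n I W (V * real_diag m k * mat_adjoint V)) (\<lambda>a. U $$ (a,i))
      = (\<Sum>s\<in>I. complex_of_real (\<Sum>j<m. k j * (cmod (\<Sum>p<m. cnj (V $$ (p,j)) * (\<Sum>a<n. cnj (W s $$ (a,p)) * U $$ (a,i))))\<^sup>2))"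
      unfolding qform_kmap[OF W conj_real_diag_carrier[OF V]] qform_conj_real_diag[OF v(1)] ..
    also have "\<dots> = complex_of_real (\<Sum>j<m. w i j * k j)"
      unfolding of_real_sum[symmetric] w_def sum_distrib_right by (subst sum.swap) (simp add: ac_simps)
    finally show ?thesis .
  qed
  note e = qform_eigenvector[OF U]
  have mu: "\<mu> i = (\<Sum>j<m. w i j * l j)" if "i < n" for i
    using q[of l i] e[OF that, of \<mu>] unfolding eq by (metis of_real_eq_iff)
  have row: "(\<Sum>j<m. w i j) = \<kappa>" if i: "i < n" for i
  proof -
    have "complex_of_real \<kappa> \<cdot>\<^sub>m (1\<^sub>m n :: complex mat) = U * real_diag n (\<lambda>_. \<kappa>) * mat_adjoint U"
      unfolding conj_real_diag_one[OF U, symmetric] conj_real_diag_smult[OF U] by simp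
    hence "complex_of_real (\<Sum>j<m. w i j * 1) = complex_of_real \<kappa>"
      using q[of "\<lambda>_. 1" i] e[OF i, of "\<lambda>_. \<kappa>"] unfolding conj_real_diag_one[OF V] un by metis
    thus ?thesis by (simp del: of_real_sum)
  qed
  have col: "(\<Sum>i<n. w i j) = 1" if j: "j < m" for j
  proof -
    let ?X = "V * real_diag m (\<lambda>k. if k = j then 1 else 0) * mat_adjoint V"
    have X: "psd m ?X" by (rule psd_conj_real_diag[OF V]) auto
    let ?Y = "kmap n I W ?X"
    have tY: "mtrace ?Y = 1" unfolding tp[OF psdD(1)[OF X]] mtrace_conj_real_diag[OF V] using j
      by (simp add: if_distrib cong: if_cong)
    have "(\<Sum>i<n. qform n ?Y (\<lambda>a. U $$ (a,i))) = mtrace ?Y"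
    proof -
      have "(\<Sum>i<n. qform n ?Y (\<lambda>a. U $$ (a,i))) = (\<Sum>i<n. \<Sum>a<n. \<Sum>b<n. ?Y $$ (a,b) * (U $$ (b,i) * cnj (U $$ (a,i))))"
        unfolding qform_def by (intro sum.cong refl) simp
      also have "\<dots> = (\<Sum>a<n. \<Sum>b<n. \<Sum>i<n. ?Y $$ (a,b) * (U $$ (b,i) * cnj (U $$ (a,i))))"
        by (rule trans[OF sum.swap], rule sum.cong[OF refl], rule sum.swap)
      also have "\<dots> = (\<Sum>a<n. \<Sum>b<n. ?Y $$ (a,b) * (U * mat_adjoint U) $$ (b,a))"
        using u by (intro sum.cong refl)
          (subst mat_mult_index[of _ n n _ n], auto simp: sum_distrib_left)
      also have "\<dots> = (\<Sum>a<n. \<Sum>b<n. if b = a then ?Y $$ (a,b) else 0)"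
        unfolding u(3) by (intro sum.cong refl) auto
      also have "\<dots> = mtrace ?Y" by (subst mtrace_carrier[of _ n]) auto
      finally show ?thesis .
    qed
    moreover have "qform n ?Y (\<lambda>a. U $$ (a,i)) = complex_of_real (w i j)" for i
      unfolding q using j by (simp add: if_distrib cong: if_cong)
    ultimately have "(\<Sum>i<n. complex_of_real (w i j)) = 1" using tY by simp
    thus ?thesis using of_real_eq_iff by (metis of_real_1 of_real_sum)
  qed
  show ?thesis by (rule that[OF nonneg mu row col])
qed

text \<open>Divided by \<kappa>, row i of w is a probability distribution for which l has mean
  \<open>\<mu> i / \<kappa>\<close>; averaging the supporting line of f at this mean gives Jensen's
  inequality for the row. In the sum over i the column sums 1 restore each \<open>f (l j)\<close>
  with weight one.\<close>

lemma weighted_jensen: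
  fixes f :: "real \<Rightarrow> real" and n m :: nat
  assumes tangent: "\<And>m. m > 0 \<Longrightarrow> \<exists>c. \<forall>x\<ge>0. f m + c * (x - m) \<le> f x" and f0: "f 0 = 0"
    and \<kappa>: "\<kappa> > 0" and w: "\<And>i j. 0 \<le> w i j"
    and mu: "\<And>i. i < n \<Longrightarrow> \<mu> i = (\<Sum>j<m. w i j * l j)"
    and row: "\<And>i. i < n \<Longrightarrow> (\<Sum>j<m. w i j) = \<kappa>"
    and col: "\<And>j. j < m \<Longrightarrow> (\<Sum>i<n. w i j) = 1"
    and l: "\<And>j. j < m \<Longrightarrow> 0 \<le> l j"
  shows "\<kappa> * (\<Sum>i<n. f (\<mu> i / \<kappa>)) \<le> (\<Sum>j<m. f (l j))"
proof -
  have "\<kappa> * f (\<mu> i / \<kappa>) \<le> (\<Sum>j<m. w i j * f (l j))" if i: "i < n" for i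
  proof (cases "\<mu> i = 0")
    \<comment> \<open>At 0 a supporting line of finite slope may fail to exist, as for x log x.
      There the mean is zero only if every term \<open>w i j * l j\<close> is zero, and
      \<open>f 0 = 0\<close> makes both sides vanish.\<close>
    case True
    have sum0: "(\<Sum>j<m. w i j * l j) = 0" using True mu[OF i] by simp
    have "(\<Sum>j<m. w i j * f (l j)) = 0"
    proof (intro sum.neutral ballI)
      fix j assume "j \<in> {..<m}"
      hence "w i j * l j = 0"
        using sum_nonneg_0[OF finite_lessThan _ sum0] w l by (metis lessThan_iff mult_nonneg_nonneg)
      thus "w i j * f (l j) = 0" using f0 by (metis mult_eq_0_iff)
    qed
    thus ?thesis using True f0 by simp
  next
    case False
    have "\<mu> i \<ge> 0" unfolding mu[OF i] using w l by (intro sum_nonneg) simp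
    hence "\<mu> i / \<kappa> > 0" using False \<kappa> by simp
    from tangent[OF this] obtain c where c: "\<And>x. x \<ge> 0 \<Longrightarrow> f (\<mu> i / \<kappa>) + c * (x - \<mu> i / \<kappa>) \<le> f x" by blast
    have "(\<Sum>j<m. w i j * (f (\<mu> i / \<kappa>) + c * (l j - \<mu> i / \<kappa>))) \<le> (\<Sum>j<m. w i j * f (l j))"
      using w by (intro sum_mono mult_left_mono c) (auto intro: l)
    moreover have "(\<Sum>j<m. w i j * (f (\<mu> i / \<kappa>) + c * (l j - \<mu> i / \<kappa>)))
      = (\<Sum>j<m. w i j) * (f (\<mu> i / \<kappa>) - c * (\<mu> i / \<kappa>)) + c * (\<Sum>j<m. w i j * l j)"
      unfolding sum_distrib_left sum_distrib_right sum.distrib[symmetric] by (intro sum.cong) (auto simp: algebra_simps)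
    moreover have "\<dots> = \<kappa> * f (\<mu> i / \<kappa>)"
      unfolding row[OF i] mu[OF i, symmetric] using \<kappa> by (simp add: field_simps)
    ultimately show ?thesis by simp
  qed
  hence "(\<Sum>i<n. \<kappa> * f (\<mu> i / \<kappa>)) \<le> (\<Sum>i<n. \<Sum>j<m. w i j * f (l j))" by (intro sum_mono) auto
  also have "\<dots> = (\<Sum>j<m. (\<Sum>i<n. w i j) * f (l j))"
    by (subst sum.swap) (simp add: sum_distrib_right)
  also have "\<dots> = (\<Sum>j<m. f (l j))" using col by (intro sum.cong) auto
  finally show ?thesis by (simp add: sum_distrib_left)
qed

text \<open>This is the weighted inequality of arithmetic and geometric means for t and 1. It
  follows from ln y \<le> y - 1 at y = t/A and y = 1/A, where A is the arithmetic mean, because the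
  right-hand sides average to 0.\<close>

lemma powr_concave_tangent_one:
  fixes a t :: real
  assumes "0 < a" "a < 1" "0 \<le> t"
  shows "t powr a \<le> 1 + a * (t - 1)"
proof (cases "t = 0")
  case False
  hence t: "t > 0" using assms by simp
  define A where "A = a * t + (1 - a)"
  have A: "A > 0" unfolding A_def using assms t by (intro add_pos_pos mult_pos_pos) auto
  have "ln (t / A) \<le> t / A - 1" "ln (1 / A) \<le> 1 / A - 1" using t A by (intro ln_le_minus_one; simp)+
  hence "a * ln (t / A) + (1 - a) * ln (1 / A) \<le> a * (t / A - 1) + (1 - a) * (1 / A - 1)"
    using assms by (intro add_mono mult_left_mono) auto
  also have "\<dots> = (a * t + (1 - a)) / A - 1" by (simp add: algebra_simps add_divide_distrib diff_divide_distrib)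
  also have "\<dots> = 0" using A by (simp add: A_def)
  finally have "a * ln t \<le> ln A" using t A by (simp add: ln_div algebra_simps)
  hence "exp (a * ln t) \<le> A" using A by (metis exp_le_cancel_iff exp_ln)
  thus ?thesis using t by (simp add: powr_def A_def algebra_simps)
qed (use assms in simp)

text \<open>Homogeneity of the power carries a tangent at 1 to a tangent at m.\<close>

lemma powr_scale_tangent:
  fixes a m x :: real
  assumes "m > 0" "x \<ge> 0"
  shows "m powr a * ((x / m) powr a) = x powr a" "m powr a * (1 + a * (x / m - 1)) = m powr a + a * m powr a / m * (x - m)"
proof -
  have "m powr a * ((x / m) powr a) = (m * (x / m)) powr a" using assms by (intro powr_mult[symmetric])
  thus "m powr a * ((x / m) powr a) = x powr a" using assms by simp
  have "x / m - 1 = (x - m) / m" using assms by (simp add: diff_divide_distrib)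
  thus "m powr a * (1 + a * (x / m - 1)) = m powr a + a * m powr a / m * (x - m)"
    by (simp add: distrib_left)
qed

lemma powr_concave_tangent:
  fixes a m x :: real
  assumes "0 < a" "a < 1" "m > 0" "x \<ge> 0"
  shows "x powr a \<le> m powr a + a * m powr a / m * (x - m)"
proof -
  have "m powr a * (x / m) powr a \<le> m powr a * (1 + a * (x / m - 1))"
    using assms by (intro mult_left_mono powr_concave_tangent_one) auto
  thus ?thesis unfolding powr_scale_tangent[OF assms(3,4)] .
qed

text \<open>Reduces to the concave case: the exponent 1/a lies below 1, and
  \<open>powr_concave_tangent_one\<close> is applied to the point \<open>t powr a\<close>.\<close>

lemma powr_convex_tangent:
  fixes a m x :: real
  assumes "1 < a" "m > 0" "x \<ge> 0"
  shows "m powr a + a * m powr a / m * (x - m) \<le> x powr a"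
proof -
  define t where "t = x / m"
  have t: "t \<ge> 0" using assms by (simp add: t_def)
  have "(t powr a) powr (1 / a) \<le> 1 + (1 / a) * (t powr a - 1)"
    using assms t by (intro powr_concave_tangent_one) auto
  hence "a * t \<le> a * (1 + (1 / a) * (t powr a - 1))"
    using assms t by (intro mult_left_mono) (auto simp: powr_powr)
  hence "1 + a * (t - 1) \<le> t powr a" using assms by (simp add: algebra_simps)
  hence "m powr a * (1 + a * (x / m - 1)) \<le> m powr a * (x / m) powr a"
    using assms unfolding t_def by (intro mult_left_mono) auto
  thus ?thesis unfolding powr_scale_tangent[OF assms(2,3)] .
qed

text \<open>For x > 0 this is ln y \<le> y - 1 at y = m/x, multiplied by x.\<close>

lemma xlogx_tangent:
  fixes m x :: real
  assumes "m > 0" "x \<ge> 0"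
  shows "m * log0 m + (ln m + 1) * (x - m) \<le> x * log0 x"
proof (cases "x = 0")
  case True thus ?thesis using assms by (simp add: log0_def algebra_simps)
next
  case False
  hence x: "x > 0" using assms by simp
  have "ln (m / x) \<le> m / x - 1" using assms x by (intro ln_le_minus_one) auto
  hence "x * ln (m / x) \<le> x * (m / x - 1)" using x by (intro mult_left_mono) auto
  thus ?thesis using assms x by (simp add: log0_def ln_div algebra_simps)
qed

section \<open>Monotonicity of the sandwiched Renyi relative entropy\<close>

lemma sum_lessThan_mult:
  fixes f :: "nat \<Rightarrow> 'a :: comm_monoid_add"
  shows "(\<Sum>p<K * r. f p) = (\<Sum>a<K. \<Sum>x<r. f (a * r + x))"
proof -
  have "(\<Sum>p<K * r. f p) = (\<Sum>a<K. sum f {a * r..<a * r + r})" by (rule sum.nat_group[symmetric])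
  also have "\<dots> = (\<Sum>a<K. \<Sum>x<r. f (a * r + x))"
  proof (rule sum.cong[OF refl])
    fix a
    have "sum f {0 + a * r..<r + a * r} = (\<Sum>x\<in>{0..<r}. f (x + a * r))" by (rule sum.shift_bounds_nat_ivl)
    thus "sum f {a * r..<a * r + r} = (\<Sum>x<r. f (a * r + x))" by (simp add: add.commute atLeast0LessThan)
  qed
  finally show ?thesis .
qed

lemma mult_add_less: "a < K \<Longrightarrow> x < r \<Longrightarrow> a * r + x < K * (r::nat)"
proof -
  assume "a < K" "x < r"
  hence "a * r + x < Suc a * r" by simp
  also have "\<dots> \<le> K * r" using \<open>a < K\<close> by (intro mult_le_mono1) simp
  finally show ?thesis .
qed

lemma less_mult_div_mod:
  assumes "p < K * (r::nat)"
  shows "p div r < K" "p mod r < r" "p = (p div r) * r + p mod r"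
proof -
  have r: "r > 0" using assms by (cases r) auto
  show "p div r < K" using assms by (simp add: less_mult_imp_div_less)
  show "p mod r < r" using r by simp
qed simp

text \<open>\<open>amp K r B\<close> is I_K \<otimes> B; in \<open>tens r A\<close> below the ancilla is again the second factor: A \<otimes> I_r.\<close>

definition amp :: "nat \<Rightarrow> nat \<Rightarrow> complex mat \<Rightarrow> complex mat" where
  "amp K r B = mat (K * r) (K * r) (\<lambda>(p,q). if p div r = q div r then B $$ (p mod r, q mod r) else 0)"

lemma amp_carrier [simp]: "amp K r B \<in> carrier_mat (K * r) (K * r)"
  by (simp add: amp_def)

lemma amp_dim [simp]: "dim_row (amp K r B) = K * r" "dim_col (amp K r B) = K * r"
  by (simp_all add: amp_def)

lemma amp_index:
  assumes "a < K" "b < K" "x < r" "y < r"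
  shows "amp K r B $$ (a * r + x, b * r + y) = (if a = b then B $$ (x,y) else 0)"
  using assms mult_add_less[of a K x r] mult_add_less[of b K y r] by (simp add: amp_def)

lemma eq_mat_blockI:
  assumes "A \<in> carrier_mat (K * r) (L * s)" "B \<in> carrier_mat (K * r) (L * s)"
    and "\<And>a x b y. a < K \<Longrightarrow> x < r \<Longrightarrow> b < L \<Longrightarrow> y < s \<Longrightarrow> A $$ (a * r + x, b * s + y) = B $$ (a * r + x, b * s + y)"
  shows "A = (B :: complex mat)"
proof (rule eq_matI)
  fix i j assume "i < dim_row B" "j < dim_col B"
  hence ij: "i < K * r" "j < L * s" using assms by auto
  show "A $$ (i,j) = B $$ (i,j)"
    using assms(3)[OF less_mult_div_mod(1,2)[OF ij(1)] less_mult_div_mod(1,2)[OF ij(2)]] by simp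
qed (use assms in auto)

lemma mult_amp_index:
  assumes A: "A \<in> carrier_mat n (K * r)" and i: "i < n" and b: "b < K" and y: "y < r"
  shows "(A * amp K r B) $$ (i, b * r + y) = (\<Sum>x<r. A $$ (i, b * r + x) * B $$ (x,y))"
proof -
  have "(A * amp K r B) $$ (i, b * r + y) = (\<Sum>a<K. \<Sum>x<r. A $$ (i, a * r + x) * amp K r B $$ (a * r + x, b * r + y))"
    by (subst mat_mult_index[OF A amp_carrier i mult_add_less[OF b y]]) (rule sum_lessThan_mult)
  also have "\<dots> = (\<Sum>a<K. if a = b then (\<Sum>x<r. A $$ (i, b * r + x) * B $$ (x,y)) else 0)"
    by (intro sum.cong refl) (auto simp: amp_index b y intro!: sum.cong)
  also have "\<dots> = (\<Sum>x<r. A $$ (i, b * r + x) * B $$ (x,y))" using b by simp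
  finally show ?thesis .
qed

lemma amp_mult_index:
  assumes A: "A \<in> carrier_mat (K * r) n" and i: "i < n" and b: "b < K" and y: "y < r"
  shows "(amp K r B * A) $$ (b * r + y, i) = (\<Sum>x<r. B $$ (y,x) * A $$ (b * r + x, i))"
proof -
  have "(amp K r B * A) $$ (b * r + y, i) = (\<Sum>a<K. \<Sum>x<r. amp K r B $$ (b * r + y, a * r + x) * A $$ (a * r + x, i))"
    by (subst mat_mult_index[OF amp_carrier A mult_add_less[OF b y] i]) (rule sum_lessThan_mult)
  also have "\<dots> = (\<Sum>a<K. if a = b then (\<Sum>x<r. B $$ (y,x) * A $$ (b * r + x, i)) else 0)"
    by (intro sum.cong refl) (auto simp: amp_index b y intro!: sum.cong)
  also have "\<dots> = (\<Sum>x<r. B $$ (y,x) * A $$ (b * r + x, i))" using b by simp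
  finally show ?thesis .
qed

lemma amp_mult:
  assumes A: "A \<in> carrier_mat r r" and B: "B \<in> carrier_mat r r"
  shows "amp K r A * amp K r B = amp K r (A * B)"
  by (rule eq_mat_blockI[of _ K r K r])
     (auto simp: mult_amp_index[OF amp_carrier] mult_add_less amp_index mat_mult_index[OF A B] intro!: carrier_matI)

lemma amp_adjoint: "B \<in> carrier_mat r r \<Longrightarrow> mat_adjoint (amp K r B) = amp K r (mat_adjoint B)"
  by (rule eq_mat_blockI[of _ K r K r]) (auto simp: mult_add_less amp_index intro!: carrier_matI)

lemma amp_one: "amp K r (1\<^sub>m r) = 1\<^sub>m (K * r)"
  by (rule eq_mat_blockI[of _ K r K r])
    (auto simp: mult_add_less amp_index, metis div_mult_self3 div_less add.right_neutral bot_nat_0.not_eq_extremum less_nat_zero_code add.commute)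

lemma amp_smult: "B \<in> carrier_mat r r \<Longrightarrow> amp K r (c \<cdot>\<^sub>m B) = c \<cdot>\<^sub>m amp K r B"
  by (rule eq_mat_blockI[of _ K r K r]) (auto simp: mult_add_less amp_index)

lemma amp_diff: "A \<in> carrier_mat r r \<Longrightarrow> B \<in> carrier_mat r r \<Longrightarrow> amp K r (A - B) = amp K r A - amp K r B"
  by (rule eq_mat_blockI[of _ K r K r]) (auto simp: mult_add_less amp_index)

lemma amp_zero: "amp K r (0\<^sub>m r r) = 0\<^sub>m (K * r) (K * r)"
  by (rule eq_mat_blockI[of _ K r K r]) (auto simp: mult_add_less amp_index)

lemma amp_real_diag: "amp K r (real_diag r l) = real_diag (K * r) (\<lambda>p. l (p mod r))"
proof (rule eq_mat_blockI[of _ K r K r])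
  fix a x b y assume h: "a < K" "x < r" "b < K" "y < r"
  have "a * r + x = b * r + y \<longleftrightarrow> a = b \<and> x = y"
    using h by (metis div_mult_self3 div_less add.right_neutral gr_implies_not0 mod_mult_self3 mod_less)
  thus "amp K r (real_diag r l) $$ (a * r + x, b * r + y) = real_diag (K * r) (\<lambda>p. l (p mod r)) $$ (a * r + x, b * r + y)"
    using h by (auto simp: amp_index real_diag_def mult_add_less)
qed auto

lemma mtrace_amp: "B \<in> carrier_mat r r \<Longrightarrow> mtrace (amp K r B) = of_nat K * mtrace B"
  by (simp add: mtrace_def sum_lessThan_mult amp_index)

lemma amp_unitary:
  assumes "unitary_mat r V" shows "unitary_mat (K * r) (amp K r V)"
  using unitary_matD[OF assms] by (simp add: unitary_mat_def amp_adjoint amp_mult amp_one)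

lemma amp_conj_real_diag:
  assumes V: "unitary_mat r V"
  shows "amp K r (V * real_diag r l * mat_adjoint V)
    = amp K r V * real_diag (K * r) (\<lambda>p. l (p mod r)) * mat_adjoint (amp K r V)"
  using unitary_matD[OF V]
  by (simp add: amp_real_diag[symmetric] amp_adjoint amp_mult)

text \<open>I \<otimes> V diagonalizes I \<otimes> B and repeats every eigenvalue K times, so a
  function of the operator acts on the ancilla factor alone.\<close>

lemma matfun_amp:
  assumes V: "unitary_mat r V"
  shows "matfun f (amp K r (V * real_diag r l * mat_adjoint V)) = amp K r (V * real_diag r (f \<circ> l) * mat_adjoint V)"
  unfolding amp_conj_real_diag[OF V]
  by (subst matfun_eq[OF amp_unitary[OF V] refl]) (simp add: o_def)

text \<open>Abstract form of T, from dimension \<open>K1\<close> to dimension \<open>K2\<close>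
  beside an ancilla of dimension r. The scalar in \<open>unital\<close> is the only one compatible
  with trace preservation, as the traces of the two identities show. \<open>intertwine\<close> says
  that the Kraus operators do nothing to the ancilla.\<close>

locale amp_kraus =
  fixes K1 K2 r :: nat and I :: "'s set" and W :: "'s \<Rightarrow> complex mat"
  assumes pos: "K1 > 0" "K2 > 0" "r > 0"
    and W: "\<forall>s\<in>I. W s \<in> carrier_mat (K2 * r) (K1 * r)"
    and trace_preserving: "\<And>X. X \<in> carrier_mat (K1 * r) (K1 * r) \<Longrightarrow> mtrace (kmap (K2 * r) I W X) = mtrace X"
    and unital: "kmap (K2 * r) I W (1\<^sub>m (K1 * r)) = complex_of_real (real K1 / real K2) \<cdot>\<^sub>m 1\<^sub>m (K2 * r)"
    and intertwine: "\<And>B s. s \<in> I \<Longrightarrow> B \<in> carrier_mat r r \<Longrightarrow> W s * amp K1 r B = amp K2 r B * W s"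
begin

abbreviation "T \<equiv> kmap (K2 * r) I W"
abbreviation "\<kappa> \<equiv> real K1 / real K2"

lemma intertwine_adjoint:
  assumes s: "s \<in> I" and B: "B \<in> carrier_mat r r"
  shows "amp K1 r B * mat_adjoint (W s) = mat_adjoint (W s) * amp K2 r B"
proof -
  have "mat_adjoint (W s * amp K1 r (mat_adjoint B)) = mat_adjoint (amp K2 r (mat_adjoint B) * W s)"
    using intertwine[OF s mat_adjoint_carrier[OF B]] by simp
  thus ?thesis
    unfolding mat_adjoint_mult[OF bspec[OF W s] amp_carrier] mat_adjoint_mult[OF amp_carrier bspec[OF W s]]
    using B by (simp add: amp_adjoint)
qed

lemma T_sandwich:
  assumes X: "X \<in> carrier_mat (K1 * r) (K1 * r)" and A: "A \<in> carrier_mat r r" and B: "B \<in> carrier_mat r r"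
  shows "T (amp K1 r A * X * amp K1 r B) = amp K2 r A * T X * amp K2 r B"
  by (rule kmap_intertwine[OF W X]) (use A B intertwine intertwine_adjoint in auto)

lemma T_mult_amp:
  assumes X: "X \<in> carrier_mat (K1 * r) (K1 * r)" and B: "B \<in> carrier_mat r r"
  shows "T (X * amp K1 r B) = T X * amp K2 r B"
  using T_sandwich[OF X one_carrier_mat B] X left_mult_one_mat[OF kmap_carrier[of "K2 * r" I W X]] by (simp add: amp_one)

lemma T_amp:
  assumes B: "B \<in> carrier_mat r r"
  shows "T (amp K1 r B) = complex_of_real \<kappa> \<cdot>\<^sub>m amp K2 r B"
  using T_mult_amp[OF one_carrier_mat B] left_mult_one_mat[OF amp_carrier]
  unfolding unital mult_smult_assoc_mat[OF one_carrier_mat amp_carrier] by simp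

lemma T_spectral:
  assumes X: "psd (K1 * r) X"
  obtains V l U \<mu> w where "unitary_mat (K1 * r) V" "X = V * real_diag (K1 * r) l * mat_adjoint V"
    "unitary_mat (K2 * r) U" "T X = U * real_diag (K2 * r) \<mu> * mat_adjoint U"
    "\<forall>j<K1 * r. 0 \<le> l j" "\<forall>i<K2 * r. 0 \<le> \<mu> i"
    "\<forall>i j. 0 \<le> w i j"
    "\<forall>i<K2 * r. \<mu> i = (\<Sum>j<K1 * r. w i j * l j)"
    "\<forall>i<K2 * r. (\<Sum>j<K1 * r. w i j) = \<kappa>"
    "\<forall>j<K1 * r. (\<Sum>i<K2 * r. w i j) = 1"
proof -
  from psd_spectral[OF X] obtain V l where V: "unitary_mat (K1 * r) V"
    "X = V * real_diag (K1 * r) l * mat_adjoint V" "\<And>j. j < K1 * r \<Longrightarrow> 0 \<le> l j" by blast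
  from psd_spectral[OF psd_kmap[OF W X]] obtain U \<mu> where U: "unitary_mat (K2 * r) U"
    "T X = U * real_diag (K2 * r) \<mu> * mat_adjoint U" "\<And>i. i < K2 * r \<Longrightarrow> 0 \<le> \<mu> i" by blast
  from kmap_spectral_weights[OF W trace_preserving unital V(1) U(1) U(2)[unfolded V(2)]]
  obtain w where w: "\<And>i j. 0 \<le> w i j"
    "\<And>i. i < K2 * r \<Longrightarrow> \<mu> i = (\<Sum>j<K1 * r. w i j * l j)"
    "\<And>i. i < K2 * r \<Longrightarrow> (\<Sum>j<K1 * r. w i j) = \<kappa>"
    "\<And>j. j < K1 * r \<Longrightarrow> (\<Sum>i<K2 * r. w i j) = 1" by blast
  show ?thesis by (rule that[OF V(1,2) U(1,2), of w]) (use V(3) U(3) w in blast)+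
qed

end

lemma sum_column_stochastic:
  fixes w :: "nat \<Rightarrow> nat \<Rightarrow> real"
  assumes "\<And>i. i < n \<Longrightarrow> \<mu> i = (\<Sum>j<m. w i j * l j)" "\<And>j. j < m \<Longrightarrow> (\<Sum>i<n. w i j) = 1"
  shows "(\<Sum>i<n. \<mu> i) = (\<Sum>j<m. l j)"
proof -
  have "(\<Sum>i<n. \<mu> i) = (\<Sum>i<n. \<Sum>j<m. w i j * l j)" using assms(1) by simp
  also have "\<dots> = (\<Sum>j<m. (\<Sum>i<n. w i j) * l j)" by (subst sum.swap) (simp add: sum_distrib_right)
  also have "\<dots> = (\<Sum>j<m. l j)" using assms(2) by simp
  finally show ?thesis .
qed

text \<open>The link between X and R is the domination of X by a multiple of the reference: it
  places the support of X inside that of the reference and survives T, so that it also controls the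
  supports of the outputs.\<close>

locale amp_kraus_state = amp_kraus +
  fixes R X :: "complex mat" and c :: real
  assumes R: "psd r R" "mtrace R = 1" and X: "psd (K1 * r) X" "mtrace X = 1"
    and dom: "0 \<le> c" "psd (K1 * r) (complex_of_real c \<cdot>\<^sub>m amp K1 r ((1 / of_nat K1) \<cdot>\<^sub>m R) - X)"
begin

abbreviation "\<sigma>1 \<equiv> amp K1 r ((1 / of_nat K1) \<cdot>\<^sub>m R)"
abbreviation "\<sigma>2 \<equiv> amp K2 r ((1 / of_nat K2) \<cdot>\<^sub>m R)"

lemma Rc: "R \<in> carrier_mat r r" using psdD(1)[OF R(1)] .
lemma Xc: "X \<in> carrier_mat (K1 * r) (K1 * r)" using psdD(1)[OF X(1)] .

text \<open>The factor \<kappa> from \<open>T_amp\<close> turns the weight 1/K1 of the input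
  reference into 1/K2.\<close>

lemma T_reference: "T \<sigma>1 = \<sigma>2"
proof -
  have c: "(1 / of_nat K1) \<cdot>\<^sub>m R \<in> carrier_mat r r" using Rc by simp
  show ?thesis unfolding T_amp[OF c]
    using Rc pos by (intro eq_matI) (auto simp: amp_def less_mult_div_mod)
qed

lemma T_dominated:
  assumes "psd (K1 * r) (complex_of_real k \<cdot>\<^sub>m \<sigma>1 - X)"
  shows "psd (K2 * r) (complex_of_real k \<cdot>\<^sub>m \<sigma>2 - T X)"
  using psd_kmap[OF W assms] unfolding kmap_diff[OF W amp_carrier Xc] T_reference .

lemma supp_in: "supp_le X \<sigma>1"
  by (rule supp_le_if_dominated[OF X(1) amp_carrier dom(2)])

lemma supp_out: "supp_le (T X) \<sigma>2"
  by (rule supp_le_if_dominated[OF psd_kmap[OF W X(1)] amp_carrier T_dominated[OF dom(2)]])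

text \<open>T is positive and maps reference to reference, so each constant admissible for X is
  admissible for T X, and the infimum can only drop.\<close>

lemma renyi_infinity_mono: "sandwiched_renyi \<infinity> (T X) \<sigma>2 \<le> sandwiched_renyi \<infinity> X \<sigma>1"
proof -
  let ?C1 = "{k::real. 0 \<le> k \<and> psd (dim_row X) (of_real k \<cdot>\<^sub>m \<sigma>1 - X)}"
  let ?C2 = "{k::real. 0 \<le> k \<and> psd (dim_row (T X)) (of_real k \<cdot>\<^sub>m \<sigma>2 - T X)}"
  have d: "dim_row X = K1 * r" "dim_row (T X) = K2 * r" using Xc by (auto simp: kmap_def)
  have sub: "?C1 \<subseteq> ?C2" unfolding d using T_dominated by blast
  have ne: "?C1 \<noteq> {}" unfolding d using dom by blast
  \<comment> \<open>Comparing traces of two operators of trace one. The bound keeps both infima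
    positive, where ln is monotone.\<close>
  have ge1: "1 \<le> k" if "k \<in> ?C2" for k
  proof -
    have t: "mtrace \<sigma>2 = 1" using Rc R(2) pos by (subst mtrace_amp) (auto simp: mtrace_def sum_divide_distrib[symmetric])
    have "mtrace (of_real k \<cdot>\<^sub>m \<sigma>2 - T X) = of_real k * mtrace \<sigma>2 - mtrace (T X)"
      by (simp add: mtrace_def kmap_def sum_subtractf sum_distrib_left)
    also have "\<dots> = of_real k - 1" using t trace_preserving[OF Xc] X(2) by simp
    finally show ?thesis using psd_mtrace_nonneg that d by fastforce
  qed
  have "1 \<le> Inf ?C2" using ne sub ge1 by (intro cInf_greatest) auto
  moreover have "Inf ?C2 \<le> Inf ?C1" using ne sub by (intro cInf_superset_mono) (auto intro!: bdd_belowI[of _ 0])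
  ultimately have "ln (Inf ?C2) \<le> ln (Inf ?C1)" by simp
  thus ?thesis unfolding sandwiched_renyi_def using supp_in supp_out by simp
qed

text \<open>Two shifts by ln \<kappa> cancel. Passing from one reference to the other adds ln
  \<kappa> to the trace of the state against the logarithm, and Jensen's inequality for x log x
  bounds the negative entropy of T X by that of X plus ln \<kappa>.\<close>

lemma renyi_one_mono: "sandwiched_renyi 1 (T X) \<sigma>2 \<le> sandwiched_renyi 1 X \<sigma>1"
proof -
  obtain V l U \<mu> w where
    V: "unitary_mat (K1 * r) V" "X = V * real_diag (K1 * r) l * mat_adjoint V" and
    U: "unitary_mat (K2 * r) U" "T X = U * real_diag (K2 * r) \<mu> * mat_adjoint U" and
    l: "\<forall>j<K1 * r. 0 \<le> l j" and mu0: "\<forall>i<K2 * r. 0 \<le> \<mu> i" and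
    w: "\<forall>i j. 0 \<le> w i j" and
    mu: "\<forall>i<K2 * r. \<mu> i = (\<Sum>j<K1 * r. w i j * l j)" and
    row: "\<forall>i<K2 * r. (\<Sum>j<K1 * r. w i j) = \<kappa>" and
    col: "\<forall>j<K1 * r. (\<Sum>i<K2 * r. w i j) = 1" by (rule T_spectral[OF X(1)])
  note l = l[rule_format] and mu0 = mu0[rule_format] and w = w[rule_format]
    and mu = mu[rule_format] and row = row[rule_format] and col = col[rule_format]
  from psd_spectral[OF R(1)] obtain S \<nu> where S: "unitary_mat r S" "R = S * real_diag r \<nu> * mat_adjoint S"
    and nu: "\<And>i. i < r \<Longrightarrow> 0 \<le> \<nu> i" by blast
  have kappa: "\<kappa> > 0" using pos by simp
  define B where "B K = S * real_diag r (\<lambda>i. log0 (1 / real K * \<nu> i)) * mat_adjoint S" for K :: nat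
  \<comment> \<open>The projection onto the support of R. Because \<open>log0\<close> is 0 at 0,
    rescaling R changes its logarithm on this support only.\<close>
  define P where "P = S * real_diag r (\<lambda>i. if \<nu> i > 0 then 1 else 0) * mat_adjoint S"
  have Bc: "B K \<in> carrier_mat r r" for K unfolding B_def by (rule conj_real_diag_carrier[OF S(1)])
  have Pc: "P \<in> carrier_mat r r" unfolding P_def by (rule conj_real_diag_carrier[OF S(1)])
  have logref: "matfun log0 (amp K r ((1 / of_nat K) \<cdot>\<^sub>m R)) = amp K r (B K)" for K :: nat
  proof -
    have "(1 / of_nat K) \<cdot>\<^sub>m R = S * real_diag r (\<lambda>i. 1 / real K * \<nu> i) * mat_adjoint S"
      using conj_real_diag_smult[OF S(1), of "1 / real K" \<nu>] unfolding S(2) by simp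
    thus ?thesis unfolding B_def using matfun_amp[OF S(1), of log0 K "\<lambda>i. 1 / real K * \<nu> i"] by (simp add: o_def)
  qed
  have xlogx: "mtrace (A * matfun log0 A) = complex_of_real (\<Sum>i<n. k i * log0 (k i))"
    if "unitary_mat n Z" "A = Z * real_diag n k * mat_adjoint Z" for A Z k n
    unfolding matfun_eq[OF that] unfolding that(2) conj_real_diag_mult[OF that(1)] mtrace_conj_real_diag[OF that(1)]
    by simp
  have diffB: "B K2 - B K1 = complex_of_real (ln \<kappa>) \<cdot>\<^sub>m P"
  proof (rule eq_matI)
    note s = unitary_matD[OF S(1)]
    fix i j assume "i < dim_row (complex_of_real (ln \<kappa>) \<cdot>\<^sub>m P)" "j < dim_col (complex_of_real (ln \<kappa>) \<cdot>\<^sub>m P)"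
    hence ij: "i < r" "j < r" using Pc by auto
    have ln: "log0 (1 / real K2 * \<nu> k) - log0 (1 / real K1 * \<nu> k) = ln \<kappa> * (if \<nu> k > 0 then 1 else 0)" if "k < r" for k
    proof (cases "\<nu> k > 0")
      case True thus ?thesis using pos by (simp add: log0_def ln_div)
    next
      case False hence "\<nu> k = 0" using nu[OF that] by simp
      thus ?thesis by (simp add: log0_def)
    qed
    have "(B K2 - B K1) $$ (i,j) = (\<Sum>k<r. S $$ (i,k) * complex_of_real (log0 (1 / real K2 * \<nu> k) - log0 (1 / real K1 * \<nu> k)) * cnj (S $$ (j,k)))"
      using ij Bc carrier_matD[OF Bc] unfolding B_def
      by (simp add: conj_real_diag_index[OF s(1)] sum_subtractf[symmetric] algebra_simps)
    also have "\<dots> = complex_of_real (ln \<kappa>) * P $$ (i,j)"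
      unfolding P_def conj_real_diag_index[OF s(1) ij] sum_distrib_left
      by (intro sum.cong refl) (subst ln, auto)
    finally show "(B K2 - B K1) $$ (i,j) = (complex_of_real (ln \<kappa>) \<cdot>\<^sub>m P) $$ (i,j)"
      using ij Pc by simp
  qed (use Bc Pc in auto)
  \<comment> \<open>X lives on the support: the reference annihilates I \<otimes> (1 - P), hence X
    does as well, and the whole trace of X is seen by I \<otimes> P.\<close>
  have trP: "mtrace (X * amp K1 r P) = 1"
  proof -
    have RP: "R * P = R"
    proof -
      have "R * P = S * real_diag r (\<lambda>i. \<nu> i * (if \<nu> i > 0 then 1 else 0)) * mat_adjoint S"
        unfolding S(2) P_def by (rule conj_real_diag_mult[OF S(1)])
      also have "real_diag r (\<lambda>i. \<nu> i * (if \<nu> i > 0 then 1 else 0)) = real_diag r \<nu>"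
        by (rule eq_matI) (use nu in \<open>force simp: real_diag_def\<close>)+
      finally show ?thesis using S(2) by simp
    qed
    have c: "1\<^sub>m r - P \<in> carrier_mat r r" by (rule minus_carrier_mat[OF Pc])
    have "(1 / of_nat K1) \<cdot>\<^sub>m R * (1\<^sub>m r - P) = (1 / of_nat K1) \<cdot>\<^sub>m (R * 1\<^sub>m r - R * P)"
      unfolding mult_smult_assoc_mat[OF Rc c] mult_minus_distrib_mat[OF Rc one_carrier_mat Pc] ..
    also have "\<dots> = 0\<^sub>m r r" unfolding RP using Rc by (intro eq_matI) auto
    finally have z: "\<sigma>1 * amp K1 r (1\<^sub>m r - P) = 0\<^sub>m (K1 * r) (K1 * r)"
      using Rc c by (simp add: amp_mult amp_zero)
    have "X * amp K1 r (1\<^sub>m r - P) = 0\<^sub>m (K1 * r) (K1 * r)"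
      by (rule supp_le_mult_zero[OF supp_in Xc amp_carrier amp_carrier z])
    hence "X - X * amp K1 r P = 0\<^sub>m (K1 * r) (K1 * r)"
      using Pc Xc by (simp add: amp_diff amp_one mult_minus_distrib_mat[of _ "K1 * r" "K1 * r" _ "K1 * r"])
    hence "mtrace X - mtrace (X * amp K1 r P) = 0"
      using Xc by (metis (no_types, lifting) amp_dim(2) carrier_matD eq_iff_diff_eq_0 index_minus_mat(1) index_mult_mat(2,3) index_zero_mat(1) mtrace_def lessThan_iff sum.cong)
    thus ?thesis using X(2) by simp
  qed
  have trdiff: "mtrace (Z * (M - N)) = mtrace (Z * M) - mtrace (Z * N)"
    if "Z \<in> carrier_mat n n" "M \<in> carrier_mat n n" "N \<in> carrier_mat n n" for n and Z M N :: "complex mat"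
    using that by (simp add: mult_minus_distrib_mat[of _ n n _ n] mtrace_def sum_subtractf)
  have matfun_c: "matfun log0 X \<in> carrier_mat (K1 * r) (K1 * r)" "matfun log0 (T X) \<in> carrier_mat (K2 * r) (K2 * r)"
    unfolding matfun_eq[OF V] matfun_eq[OF U] by (rule conj_real_diag_carrier[OF V(1)], rule conj_real_diag_carrier[OF U(1)])
  have D1: "mtrace (X * (matfun log0 X - matfun log0 \<sigma>1)) = complex_of_real (\<Sum>j<K1 * r. l j * log0 (l j)) - mtrace (X * amp K1 r (B K1))"
    unfolding logref trdiff[OF Xc matfun_c(1) amp_carrier] xlogx[OF V] ..
  \<comment> \<open>The logarithm of the output reference acts on the ancilla only, so it can be
    pulled inside T and the trace evaluated before T.\<close>
  have "mtrace (T X * amp K2 r (B K2)) = mtrace (X * amp K1 r (B K2))"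
    unfolding T_mult_amp[OF Xc Bc, symmetric] by (rule trace_preserving) (use Xc in auto)
  also have "\<dots> = mtrace (X * amp K1 r (B K1)) + ln \<kappa>"
  proof -
    have "mtrace (X * amp K1 r (B K2)) - mtrace (X * amp K1 r (B K1)) = mtrace (X * amp K1 r (B K2 - B K1))"
      unfolding amp_diff[OF Bc Bc] by (rule trdiff[symmetric, OF Xc amp_carrier amp_carrier])
    also have "\<dots> = complex_of_real (ln \<kappa>) * mtrace (X * amp K1 r P)"
      unfolding diffB amp_smult[OF Pc] mult_smult_distrib[OF Xc amp_carrier]
      using Xc by (simp add: mtrace_def sum_distrib_left)
    finally show ?thesis unfolding trP by (simp add: algebra_simps)
  qed
  finally have D2: "mtrace (T X * (matfun log0 (T X) - matfun log0 \<sigma>2))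
    = complex_of_real (\<Sum>i<K2 * r. \<mu> i * log0 (\<mu> i)) - (mtrace (X * amp K1 r (B K1)) + ln \<kappa>)"
    unfolding logref trdiff[OF kmap_carrier matfun_c(2) amp_carrier] xlogx[OF U] by simp
  have suml: "(\<Sum>j<K1 * r. l j) = 1"
    using X(2) unfolding V(2) mtrace_conj_real_diag[OF V(1)] by (metis of_real_1 of_real_eq_iff of_real_sum)
  have summu: "(\<Sum>i<K2 * r. \<mu> i) = 1" by (rule trans[OF sum_column_stochastic[OF mu col] suml])
  have "\<kappa> * (\<Sum>i<K2 * r. \<mu> i / \<kappa> * log0 (\<mu> i / \<kappa>)) \<le> (\<Sum>j<K1 * r. l j * log0 (l j))"
    by (rule weighted_jensen[where f = "\<lambda>x. x * log0 x" and w = w])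
       (use xlogx_tangent kappa w mu row col l in \<open>auto\<close>)
  moreover have "\<kappa> * (\<Sum>i<K2 * r. \<mu> i / \<kappa> * log0 (\<mu> i / \<kappa>)) = (\<Sum>i<K2 * r. \<mu> i * log0 (\<mu> i)) - ln \<kappa>"
  proof -
    have "\<kappa> * (\<Sum>i<K2 * r. \<mu> i / \<kappa> * log0 (\<mu> i / \<kappa>)) = (\<Sum>i<K2 * r. \<mu> i * log0 (\<mu> i) - \<mu> i * ln \<kappa>)"
      unfolding sum_distrib_left
    proof (rule sum.cong[OF refl])
      fix i assume "i \<in> {..<K2 * r}"
      hence "\<mu> i = 0 \<or> \<mu> i > 0" using mu0[of i] by auto
      thus "\<kappa> * (\<mu> i / \<kappa> * log0 (\<mu> i / \<kappa>)) = \<mu> i * log0 (\<mu> i) - \<mu> i * ln \<kappa>"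
      proof
        assume m: "\<mu> i > 0"
        hence "log0 (\<mu> i / \<kappa>) = log0 (\<mu> i) - ln \<kappa>"
          using kappa unfolding log0_def by (simp only: ln_divide_pos divide_pos_pos if_True)
        moreover have "\<kappa> * (\<mu> i / \<kappa> * log0 (\<mu> i / \<kappa>)) = \<mu> i * log0 (\<mu> i / \<kappa>)" using pos by simp
        ultimately show ?thesis by (simp add: right_diff_distrib)
      qed simp
    qed
    thus ?thesis using summu by (simp add: sum_subtractf sum_distrib_right[symmetric])
  qed
  ultimately have "(\<Sum>i<K2 * r. \<mu> i * log0 (\<mu> i)) - ln \<kappa> \<le> (\<Sum>j<K1 * r. l j * log0 (l j))" by simp
  thus ?thesis unfolding sandwiched_renyi_def D1 D2 using supp_in supp_out
    by (simp del: of_real_sum)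
qed

text \<open>Let Y be X sandwiched by the input reference. The sandwiched output is
  \<kappa>^(2\<gamma>) T Y, and 2 \<gamma> a = 1 - a. The a-th power of the scalar is therefore
  \<kappa>^(1-a), which writes the output trace as \<kappa> times the sum of (\<mu> i/\<kappa>)^a,
  the very quantity that \<open>weighted_jensen\<close> compares with the sum of (l j)^a.\<close>

lemma renyi_finite_mono:
  fixes \<alpha> :: ereal
  assumes a: "\<alpha> = ereal a" "1 / 2 \<le> a" "a \<noteq> 1"
  shows "sandwiched_renyi \<alpha> (T X) \<sigma>2 \<le> sandwiched_renyi \<alpha> X \<sigma>1"
proof -
  define \<gamma> where "\<gamma> = (1 - a) / (2 * a)"
  from psd_spectral[OF R(1)] obtain S \<nu> where S: "unitary_mat r S" "R = S * real_diag r \<nu> * mat_adjoint S"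
    and nu: "\<And>i. i < r \<Longrightarrow> 0 \<le> \<nu> i" by blast
  have kappa: "\<kappa> > 0" using pos by simp
  define B where "B K = S * real_diag r (\<lambda>i. (1 / real K * \<nu> i) powr \<gamma>) * mat_adjoint S" for K :: nat
  have Bc: "B K \<in> carrier_mat r r" for K unfolding B_def by (rule conj_real_diag_carrier[OF S(1)])
  have ref: "matfun (\<lambda>x. x powr \<gamma>) (amp K r ((1 / of_nat K) \<cdot>\<^sub>m R)) = amp K r (B K)" for K :: nat
  proof -
    have "(1 / of_nat K) \<cdot>\<^sub>m R = S * real_diag r (\<lambda>i. 1 / real K * \<nu> i) * mat_adjoint S"
      using conj_real_diag_smult[OF S(1), of "1 / real K" \<nu>] unfolding S(2) by simp
    thus ?thesis unfolding B_def using matfun_amp[OF S(1), of "\<lambda>x. x powr \<gamma>" K "\<lambda>i. 1 / real K * \<nu> i"] by (simp add: o_def)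
  qed
  \<comment> \<open>Eigenvalue by eigenvalue, 1/K2 equals \<kappa> times 1/K1 and powers are
    multiplicative; on the kernel of R both sides are 0, since 0 to any power is 0 here.\<close>
  have B2: "B K2 = complex_of_real (\<kappa> powr \<gamma>) \<cdot>\<^sub>m B K1"
    unfolding B_def conj_real_diag_smult[OF S(1)]
  proof (rule arg_cong[where f = "\<lambda>D. S * D * mat_adjoint S"], rule eq_matI)
    fix i j assume "i < dim_row (real_diag r (\<lambda>i. \<kappa> powr \<gamma> * (1 / real K1 * \<nu> i) powr \<gamma>))" "j < dim_col (real_diag r (\<lambda>i. \<kappa> powr \<gamma> * (1 / real K1 * \<nu> i) powr \<gamma>))"
    hence ij: "i < r" "j < r" by auto
    have "\<kappa> powr \<gamma> * (1 / real K1 * \<nu> i) powr \<gamma> = (\<kappa> * (1 / real K1 * \<nu> i)) powr \<gamma>"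
      using nu[OF ij(1)] by (intro powr_mult[symmetric])
    also have "\<kappa> * (1 / real K1 * \<nu> i) = 1 / real K2 * \<nu> i" using pos by simp
    finally show "real_diag r (\<lambda>i. (1 / real K2 * \<nu> i) powr \<gamma>) $$ (i,j) = real_diag r (\<lambda>i. \<kappa> powr \<gamma> * (1 / real K1 * \<nu> i) powr \<gamma>) $$ (i,j)"
      using ij unfolding real_diag_def by (simp only: index_mat split)
  qed auto
  define Y where "Y = amp K1 r (B K1) * X * amp K1 r (B K1)"
  have hermB: "mat_adjoint (amp K1 r (B K1)) = amp K1 r (B K1)"
    unfolding amp_adjoint[OF Bc] unfolding B_def conj_real_diag_adjoint[OF S(1)] ..
  have Y: "psd (K1 * r) Y"
  proof -
    \<comment> \<open>Conjugation by a hermitian matrix is a Kraus map with a single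
      operator.\<close>
    have "psd (K1 * r) (kmap (K1 * r) {()} (\<lambda>_. amp K1 r (B K1)) X)" by (rule psd_kmap) (use X in auto)
    also have "kmap (K1 * r) {()} (\<lambda>_. amp K1 r (B K1)) X = Y"
      unfolding Y_def kmap_def using Xc by (intro eq_matI) (auto simp: hermB)
    finally show ?thesis .
  qed
  have Yc: "Y \<in> carrier_mat (K1 * r) (K1 * r)" by (rule psdD(1)[OF Y])
  let ?k = "\<kappa> powr \<gamma> * \<kappa> powr \<gamma>"
  have Y2: "amp K2 r (B K2) * T X * amp K2 r (B K2) = complex_of_real ?k \<cdot>\<^sub>m T Y"
  proof -
    have c: "amp K2 r (B K1) * T X \<in> carrier_mat (K2 * r) (K2 * r)" by (rule mult_carrier_mat[OF amp_carrier kmap_carrier])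
    have "amp K2 r (B K2) * T X * amp K2 r (B K2) = complex_of_real ?k \<cdot>\<^sub>m (amp K2 r (B K1) * T X * amp K2 r (B K1))"
      unfolding B2 amp_smult[OF Bc] mult_smult_assoc_mat[OF amp_carrier kmap_carrier]
        mult_smult_assoc_mat[OF c smult_carrier_mat[OF amp_carrier]] mult_smult_distrib[OF c amp_carrier]
      by (intro eq_matI) auto
    thus ?thesis unfolding Y_def T_sandwich[OF Xc Bc Bc] .
  qed
  obtain V l U \<mu> w where
    V: "unitary_mat (K1 * r) V" "Y = V * real_diag (K1 * r) l * mat_adjoint V" and
    U: "unitary_mat (K2 * r) U" "T Y = U * real_diag (K2 * r) \<mu> * mat_adjoint U" and
    l: "\<forall>j<K1 * r. 0 \<le> l j" and mu0: "\<forall>i<K2 * r. 0 \<le> \<mu> i" and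
    w: "\<forall>i j. 0 \<le> w i j" and
    mu: "\<forall>i<K2 * r. \<mu> i = (\<Sum>j<K1 * r. w i j * l j)" and
    row: "\<forall>i<K2 * r. (\<Sum>j<K1 * r. w i j) = \<kappa>" and
    col: "\<forall>j<K1 * r. (\<Sum>i<K2 * r. w i j) = 1" by (rule T_spectral[OF Y])
  note l = l[rule_format] and mu0 = mu0[rule_format] and w = w[rule_format]
    and mu = mu[rule_format] and row = row[rule_format] and col = col[rule_format]
  define Q1 where "Q1 = (\<Sum>j<K1 * r. l j powr a)"
  define Q2 where "Q2 = \<kappa> * (\<Sum>i<K2 * r. (\<mu> i / \<kappa>) powr a)"
  have q1: "Re (mtrace (matfun (\<lambda>x. x powr a) Y)) = Q1"
    unfolding matfun_eq[OF V] mtrace_conj_real_diag[OF V(1)] Q1_def by simp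
  have q2: "Re (mtrace (matfun (\<lambda>x. x powr a) (amp K2 r (B K2) * T X * amp K2 r (B K2)))) = Q2"
  proof -
    have e: "amp K2 r (B K2) * T X * amp K2 r (B K2) = U * real_diag (K2 * r) (\<lambda>i. ?k * \<mu> i) * mat_adjoint U"
      unfolding Y2 U(2) conj_real_diag_smult[OF U(1)] ..
    have "?k powr a = \<kappa> powr (1 - a)"
    proof -
      have "?k = \<kappa> powr (2 * \<gamma>)" by (simp add: powr_add[symmetric])
      hence "?k powr a = \<kappa> powr (2 * \<gamma> * a)" by (simp add: powr_powr)
      also have "2 * \<gamma> * a = 1 - a" using a unfolding \<gamma>_def by (simp add: field_simps)
      finally show ?thesis .
    qed
    moreover have "\<kappa> powr (1 - a) * \<mu> i powr a = \<kappa> * (\<mu> i / \<kappa>) powr a" if "i < K2 * r" for i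
    proof -
      have "(\<mu> i / \<kappa>) powr a = \<mu> i powr a / \<kappa> powr a" using mu0[OF that] kappa by (intro powr_divide)
      moreover have "\<kappa> powr (1 - a) = \<kappa> / \<kappa> powr a" using kappa by (simp only: powr_diff powr_one less_imp_le)
      ultimately show ?thesis by simp
    qed
    ultimately have "(?k * \<mu> i) powr a = \<kappa> * (\<mu> i / \<kappa>) powr a" if "i < K2 * r" for i
      using that mu0[OF that] by (simp add: powr_mult)
    thus ?thesis unfolding matfun_eq[OF U(1) e] mtrace_conj_real_diag[OF U(1)] Q2_def
      by (simp add: sum_distrib_left)
  qed
  \<comment> \<open>The definition returns \<infinity> when the trace is not positive, so a finite
    input value must not meet an infinite output value. The eigenvalues of Y and of T Y have the
    same sum, hence if one of the former is positive, so is one of the latter.\<close>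
  have pos_trans: "0 < Q2" if "0 < Q1"
  proof -
    have "\<exists>j<K1 * r. l j \<noteq> 0"
    proof (rule ccontr)
      assume "\<not> (\<exists>j<K1 * r. l j \<noteq> 0)"
      hence "Q1 = 0" unfolding Q1_def by (intro sum.neutral) auto
      thus False using that by simp
    qed
    then obtain j where j: "j < K1 * r" "l j > 0" using l by (metis order_le_imp_less_or_eq)
    have "0 < (\<Sum>j<K1 * r. l j)" using j l by (intro sum_pos2[of _ j]) auto
    also have "\<dots> = (\<Sum>i<K2 * r. \<mu> i)" by (rule sum_column_stochastic[OF mu col, symmetric])
    finally obtain i where i: "i < K2 * r" "\<mu> i > 0" using mu0
      by (metis (no_types, lifting) lessThan_iff less_irrefl order_le_imp_less_or_eq sum.neutral)
    have "0 < (\<Sum>i<K2 * r. (\<mu> i / \<kappa>) powr a)" using i pos by (intro sum_pos2[of _ i]) auto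
    thus ?thesis unfolding Q2_def using kappa by (intro mult_pos_pos)
  qed
  have defs: "sandwiched_renyi \<alpha> X \<sigma>1 = (if Q1 \<le> 0 then \<infinity> else ereal (ln Q1 / (a - 1)))"
    "sandwiched_renyi \<alpha> (T X) \<sigma>2 = (if Q2 \<le> 0 then \<infinity> else ereal (ln Q2 / (a - 1)))"
    using a supp_in supp_out q1 q2
    unfolding sandwiched_renyi_def Let_def Y_def by (auto simp: \<gamma>_def[symmetric] ref one_ereal_def)
  show ?thesis
  proof (cases "Q1 \<le> 0")
    case False
    hence q: "0 < Q1" "0 < Q2" using pos_trans by auto
    have "ln Q2 / (a - 1) \<le> ln Q1 / (a - 1)"
    proof (cases "a > 1")
      case True
      have "Q2 \<le> Q1" unfolding Q1_def Q2_def
      proof (rule weighted_jensen[where f = "\<lambda>x. x powr a" and w = w])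
        fix m :: real assume m: "m > 0"
        show "\<exists>c. \<forall>x\<ge>0. m powr a + c * (x - m) \<le> x powr a"
          using powr_convex_tangent[OF True m] by blast
      qed (use kappa w mu row col l in auto)
      thus ?thesis using q True by (intro divide_right_mono) auto
    next
      case False
      hence a1: "0 < a" "a < 1" using a by auto
      \<comment> \<open>Below 1 the power is concave, so Jensen's inequality is applied to its
        negative. The reversed comparison of the traces is reversed once more by the negative
        divisor a - 1.\<close>
      have "\<kappa> * (\<Sum>i<K2 * r. - ((\<mu> i / \<kappa>) powr a)) \<le> (\<Sum>j<K1 * r. - (l j powr a))"
      proof (rule weighted_jensen[where f = "\<lambda>x. - (x powr a)" and w = w])
        fix m :: real assume m: "m > 0"
        show "\<exists>c. \<forall>x\<ge>0. - (m powr a) + c * (x - m) \<le> - (x powr a)"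
        proof (intro exI[of _ "- (a * m powr a / m)"] allI impI)
          fix x :: real assume "0 \<le> x"
          from powr_concave_tangent[OF a1 m this]
          show "- (m powr a) + - (a * m powr a / m) * (x - m) \<le> - (x powr a)"
            unfolding mult_minus_left by linarith
        qed
      qed (use kappa w mu row col l in auto)
      hence "Q1 \<le> Q2" unfolding Q1_def Q2_def by (simp add: sum_negf)
      thus ?thesis using q a1 by (intro divide_right_mono_neg) auto
    qed
    thus ?thesis unfolding defs using q by simp
  qed (simp add: defs)
qed

lemma renyi_mono:
  assumes "ereal (1/2) \<le> \<alpha>"
  shows "sandwiched_renyi \<alpha> (T X) \<sigma>2 \<le> sandwiched_renyi \<alpha> X \<sigma>1"
proof (cases \<alpha>)
  case (real a)
  show ?thesis
  proof (cases "a = 1")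
    case True thus ?thesis using real renyi_one_mono by (simp add: one_ereal_def)
  qed (use assms real renyi_finite_mono in auto)
qed (use assms renyi_infinity_mono in auto)

end

section \<open>Tensor products with an ancilla\<close>

definition tens :: "nat \<Rightarrow> complex mat \<Rightarrow> complex mat" where
  "tens r A = mat (dim_row A * r) (dim_col A * r)
     (\<lambda>(p,q). if p mod r = q mod r then A $$ (p div r, q div r) else 0)"

lemma tens_carrier: "A \<in> carrier_mat n m \<Longrightarrow> tens r A \<in> carrier_mat (n * r) (m * r)"
  by (auto simp: tens_def)

lemma tens_index:
  assumes "A \<in> carrier_mat n m" "a < n" "b < m" "x < r" "y < r"
  shows "tens r A $$ (a * r + x, b * r + y) = (if x = y then A $$ (a,b) else 0)"
  using assms mult_add_less[of a n x r] mult_add_less[of b m y r] by (auto simp: tens_def)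

text \<open>Operators on different tensor factors commute; this supplies \<open>intertwine\<close>
  for Kraus operators of the form A \<otimes> I.\<close>

lemma tens_amp_commute:
  assumes A: "A \<in> carrier_mat n m" and B: "B \<in> carrier_mat r r"
  shows "tens r A * amp m r B = amp n r B * tens r A"
proof (rule eq_mat_blockI[of _ n r m r])
  note t = tens_carrier[OF A, of r]
  fix a x b y assume h: "a < n" "x < r" "b < m" "y < r"
  have "(tens r A * amp m r B) $$ (a * r + x, b * r + y) = (\<Sum>z<r. if z = x then A $$ (a,b) * B $$ (x,y) else 0)"
    unfolding mult_amp_index[OF t mult_add_less[OF h(1,2)] h(3,4)]
    using h by (intro sum.cong refl) (auto simp: tens_index[OF A])
  moreover have "(amp n r B * tens r A) $$ (a * r + x, b * r + y) = (\<Sum>z<r. if z = y then B $$ (x,y) * A $$ (a,b) else 0)"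
    unfolding amp_mult_index[OF t mult_add_less[OF h(3,4)] h(1,2)]
    using h by (intro sum.cong refl) (auto simp: tens_index[OF A])
  ultimately show "(tens r A * amp m r B) $$ (a * r + x, b * r + y) = (amp n r B * tens r A) $$ (a * r + x, b * r + y)"
    using h by simp
qed (use tens_carrier[OF A, of r] in auto)

text \<open>Each \<open>tens r (W s)\<close> is diagonal in the ancilla index, so x and y are mere
  spectators and the sums over the ancilla collapse.\<close>

lemma kmap_tens_index:
  assumes W: "\<forall>s\<in>I. W s \<in> carrier_mat n m" and X: "X \<in> carrier_mat (m * r) (m * r)"
    and h: "a < n" "x < r" "b < n" "y < r"
  shows "kmap (n * r) I (\<lambda>s. tens r (W s)) X $$ (a * r + x, b * r + y)
    = (\<Sum>s\<in>I. \<Sum>i<m. \<Sum>j<m. W s $$ (a,i) * X $$ (i * r + x, j * r + y) * cnj (W s $$ (b,j)))"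
proof -
  have t: "\<forall>s\<in>I. tens r (W s) \<in> carrier_mat (n * r) (m * r)" using W tens_carrier by blast
  have one: "(\<Sum>q<m * r. c * X $$ (p,q) * cnj (tens r (W s) $$ (b * r + y, q)))
      = (\<Sum>j<m. c * X $$ (p, j * r + y) * cnj (W s $$ (b,j)))" if s: "s \<in> I" for s p c
  proof -
    have "(\<Sum>q<m * r. c * X $$ (p,q) * cnj (tens r (W s) $$ (b * r + y, q)))
      = (\<Sum>j<m. \<Sum>z<r. if z = y then c * X $$ (p, j * r + y) * cnj (W s $$ (b,j)) else 0)"
      unfolding sum_lessThan_mult using h
      by (intro sum.cong refl) (auto simp: tens_index[OF bspec[OF W s]])
    thus ?thesis using h by simp
  qed
  have "kmap (n * r) I (\<lambda>s. tens r (W s)) X $$ (a * r + x, b * r + y) =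
    (\<Sum>s\<in>I. \<Sum>p<m * r. \<Sum>q<m * r. tens r (W s) $$ (a * r + x, p) * X $$ (p,q) * cnj (tens r (W s) $$ (b * r + y, q)))"
    by (rule kmap_index[OF t X mult_add_less[OF h(1,2)] mult_add_less[OF h(3,4)]])
  also have "\<dots> = (\<Sum>s\<in>I. \<Sum>p<m * r. \<Sum>j<m. tens r (W s) $$ (a * r + x, p) * X $$ (p, j * r + y) * cnj (W s $$ (b,j)))"
    by (intro sum.cong refl one)
  also have "\<dots> = (\<Sum>s\<in>I. \<Sum>i<m. \<Sum>z<r. if z = x then (\<Sum>j<m. W s $$ (a,i) * X $$ (i * r + x, j * r + y) * cnj (W s $$ (b,j))) else 0)"
    unfolding sum_lessThan_mult using h
    by (intro sum.cong refl) (auto simp: tens_index[OF bspec[OF W]] intro!: sum.neutral)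
  finally show ?thesis using h by simp
qed

lemma sum_swap_outer_inner:
  "(\<Sum>k\<in>C. \<Sum>s\<in>S. \<Sum>i\<in>A. \<Sum>j\<in>B. f k s i j) = (\<Sum>i\<in>A. \<Sum>j\<in>B. \<Sum>s\<in>S. \<Sum>k\<in>C. (f k s i j :: complex))"
proof -
  have "(\<Sum>k\<in>C. \<Sum>s\<in>S. \<Sum>i\<in>A. \<Sum>j\<in>B. f k s i j) = (\<Sum>s\<in>S. \<Sum>k\<in>C. \<Sum>i\<in>A. \<Sum>j\<in>B. f k s i j)" by (rule sum.swap)
  also have "\<dots> = (\<Sum>s\<in>S. \<Sum>i\<in>A. \<Sum>k\<in>C. \<Sum>j\<in>B. f k s i j)" by (rule sum.cong[OF refl], rule sum.swap)
  also have "\<dots> = (\<Sum>i\<in>A. \<Sum>s\<in>S. \<Sum>k\<in>C. \<Sum>j\<in>B. f k s i j)" by (rule sum.swap)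
  also have "\<dots> = (\<Sum>i\<in>A. \<Sum>s\<in>S. \<Sum>j\<in>B. \<Sum>k\<in>C. f k s i j)"
    by (rule sum.cong[OF refl], rule sum.cong[OF refl], rule sum.swap)
  also have "\<dots> = (\<Sum>i\<in>A. \<Sum>j\<in>B. \<Sum>s\<in>S. \<Sum>k\<in>C. f k s i j)" by (rule sum.cong[OF refl], rule sum.swap)
  finally show ?thesis .
qed

lemma kmap_tens_trace_preserving:
  assumes W: "\<forall>s\<in>I. W s \<in> carrier_mat n m" and X: "X \<in> carrier_mat (m * r) (m * r)"
    and tp: "\<And>i j. i < m \<Longrightarrow> j < m \<Longrightarrow> (\<Sum>s\<in>I. \<Sum>k<n. W s $$ (k,i) * cnj (W s $$ (k,j))) = (if i = j then 1 else 0)"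
  shows "mtrace (kmap (n * r) I (\<lambda>s. tens r (W s)) X) = mtrace X"
proof -
  have "mtrace (kmap (n * r) I (\<lambda>s. tens r (W s)) X)
    = (\<Sum>k<n. \<Sum>x<r. \<Sum>s\<in>I. \<Sum>i<m. \<Sum>j<m. W s $$ (k,i) * X $$ (i * r + x, j * r + x) * cnj (W s $$ (k,j)))"
    unfolding mtrace_carrier[OF kmap_carrier] sum_lessThan_mult
    by (intro sum.cong refl) (simp add: kmap_tens_index[OF W X])
  also have "\<dots> = (\<Sum>x<r. \<Sum>k<n. \<Sum>s\<in>I. \<Sum>i<m. \<Sum>j<m. X $$ (i * r + x, j * r + x) * (W s $$ (k,i) * cnj (W s $$ (k,j))))"
    by (subst sum.swap) (simp add: ac_simps)
  also have "\<dots> = (\<Sum>x<r. \<Sum>i<m. \<Sum>j<m. X $$ (i * r + x, j * r + x) * (\<Sum>s\<in>I. \<Sum>k<n. W s $$ (k,i) * cnj (W s $$ (k,j))))"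
    by (rule sum.cong[OF refl], subst sum_swap_outer_inner, simp add: sum_distrib_left)
  also have "\<dots> = (\<Sum>x<r. \<Sum>i<m. \<Sum>j<m. if j = i then X $$ (i * r + x, j * r + x) else 0)"
    by (intro sum.cong refl) (auto simp: tp)
  also have "\<dots> = (\<Sum>i<m. \<Sum>x<r. X $$ (i * r + x, i * r + x))"
    by (subst sum.swap) simp
  also have "\<dots> = mtrace X" unfolding mtrace_carrier[OF X] sum_lessThan_mult ..
  finally show ?thesis .
qed

lemma kmap_tens_unital:
  assumes W: "\<forall>s\<in>I. W s \<in> carrier_mat n m"
    and un: "\<And>i j. i < n \<Longrightarrow> j < n \<Longrightarrow> (\<Sum>s\<in>I. \<Sum>k<m. W s $$ (i,k) * cnj (W s $$ (j,k))) = (if i = j then \<kappa> else 0)"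
  shows "kmap (n * r) I (\<lambda>s. tens r (W s)) (1\<^sub>m (m * r)) = \<kappa> \<cdot>\<^sub>m 1\<^sub>m (n * r)"
proof (rule eq_mat_blockI[of _ n r n r])
  fix a x b y assume h: "a < n" "x < r" "b < n" "y < r"
  have one: "(1\<^sub>m (k * r) :: complex mat) $$ (i * r + x, j * r + y) = (if i = j \<and> x = y then 1 else 0)"
    if "i < k" "j < k" for i j k
    using amp_index[OF that h(2,4), of "1\<^sub>m r"] h unfolding amp_one by auto
  have "kmap (n * r) I (\<lambda>s. tens r (W s)) (1\<^sub>m (m * r)) $$ (a * r + x, b * r + y)
    = (\<Sum>s\<in>I. \<Sum>i<m. \<Sum>j<m. if j = i then (if x = y then W s $$ (a,i) * cnj (W s $$ (b,i)) else 0) else 0)"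
    unfolding kmap_tens_index[OF W one_carrier_mat h]
    by (intro sum.cong refl) (auto simp: one)
  also have "\<dots> = (if x = y then (\<Sum>s\<in>I. \<Sum>i<m. W s $$ (a,i) * cnj (W s $$ (b,i))) else 0)" by simp
  also have "\<dots> = (\<kappa> \<cdot>\<^sub>m 1\<^sub>m (n * r)) $$ (a * r + x, b * r + y)"
    unfolding un[OF h(1,3)] using h one[OF h(1,3)] by (simp add: mult_add_less)
  finally show "kmap (n * r) I (\<lambda>s. tens r (W s)) (1\<^sub>m (m * r)) $$ (a * r + x, b * r + y)
     = (\<kappa> \<cdot>\<^sub>m 1\<^sub>m (n * r)) $$ (a * r + x, b * r + y)" .
qed auto

section \<open>Partial trace over the first factor, and domination by its result\<close>

definition marg :: "nat \<Rightarrow> nat \<Rightarrow> complex mat \<Rightarrow> complex mat" where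
  "marg N r X = mat r r (\<lambda>(x,y). \<Sum>a<N. X $$ (a * r + x, a * r + y))"

lemma marg_carrier [simp]: "marg N r X \<in> carrier_mat r r"
  by (simp add: marg_def)

lemma mtrace_marg: "X \<in> carrier_mat (N * r) (N * r) \<Longrightarrow> mtrace (marg N r X) = mtrace X"
  unfolding mtrace_carrier[OF marg_carrier]
  by (simp add: mtrace_def sum_lessThan_mult marg_def) (rule sum.swap)

lemma qform_block:
  assumes b: "b < N"
  shows "qform (N * r) M (\<lambda>p. if p div r = b then f (p mod r) else 0)
    = (\<Sum>x<r. \<Sum>y<r. cnj (f x) * M $$ (b * r + x, b * r + y) * f y)"
proof -
  have "qform (N * r) M (\<lambda>p. if p div r = b then f (p mod r) else 0)
    = (\<Sum>a<N. \<Sum>x<r. \<Sum>a'<N. \<Sum>y<r. if a' = b then (if a = b then cnj (f x) * M $$ (b * r + x, b * r + y) * f y else 0) else 0)"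
    unfolding qform_def sum_lessThan_mult by (intro sum.cong refl) auto
  also have "\<dots> = (\<Sum>a<N. \<Sum>x<r. \<Sum>a'<N. if a' = b then (\<Sum>y<r. if a = b then cnj (f x) * M $$ (b * r + x, b * r + y) * f y else 0) else 0)"
    by (intro sum.cong refl) auto
  also have "\<dots> = (\<Sum>a<N. \<Sum>x<r. \<Sum>y<r. if a = b then cnj (f x) * M $$ (b * r + x, b * r + y) * f y else 0)"
    using b by simp
  also have "\<dots> = (\<Sum>a<N. if a = b then (\<Sum>x<r. \<Sum>y<r. cnj (f x) * M $$ (b * r + x, b * r + y) * f y) else 0)"
    by (intro sum.cong refl) auto
  finally show ?thesis using b by simp
qed

text \<open>The partial trace is the sum of the diagonal blocks, and the form of each block is a
  form of M at a vector supported in that block. Positivity of the marginal follows.\<close>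

lemma qform_marg:
  "qform r (marg N r M) f = (\<Sum>b<N. qform (N * r) M (\<lambda>p. if p div r = b then f (p mod r) else 0))"
proof -
  have "qform r (marg N r M) f = (\<Sum>x<r. \<Sum>y<r. \<Sum>b<N. cnj (f x) * M $$ (b * r + x, b * r + y) * f y)"
    unfolding qform_def by (intro sum.cong refl) (simp add: marg_def sum_distrib_left sum_distrib_right)
  also have "\<dots> = (\<Sum>x<r. \<Sum>b<N. \<Sum>y<r. cnj (f x) * M $$ (b * r + x, b * r + y) * f y)"
    by (rule sum.cong[OF refl], rule sum.swap)
  also have "\<dots> = (\<Sum>b<N. \<Sum>x<r. \<Sum>y<r. cnj (f x) * M $$ (b * r + x, b * r + y) * f y)" by (rule sum.swap)
  finally show ?thesis by (simp add: qform_block)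
qed

lemma psd_marg:
  assumes "psd (N * r) M" shows "psd r (marg N r M)"
proof -
  note M = psdD[OF assms]
  have "mat_adjoint (marg N r M) = marg N r M"
  proof (rule eq_matI)
    fix x y assume "x < dim_row (marg N r M)" "y < dim_col (marg N r M)"
    hence h: "x < r" "y < r" by (auto simp: marg_def)
    have "cnj (M $$ (a * r + y, a * r + x)) = M $$ (a * r + x, a * r + y)" if "a < N" for a
      using arg_cong[OF M(2), of "\<lambda>Z. Z $$ (a * r + x, a * r + y)"] M(1) h that by (simp add: mult_add_less)
    thus "mat_adjoint (marg N r M) $$ (x,y) = marg N r M $$ (x,y)" using h by (simp add: marg_def)
  qed (auto simp: marg_def)
  thus ?thesis unfolding psd_iff_qform using M(3) by (auto simp: qform_marg intro!: sum_nonneg)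
qed

lemma qform_amp:
  "qform (K * r) (amp K r B) v = (\<Sum>a<K. qform r B (\<lambda>x. v (a * r + x)))"
proof -
  have "qform (K * r) (amp K r B) v
    = (\<Sum>a<K. \<Sum>x<r. \<Sum>b<K. if b = a then (\<Sum>y<r. cnj (v (a * r + x)) * B $$ (x,y) * v (a * r + y)) else 0)"
    unfolding qform_def sum_lessThan_mult by (intro sum.cong refl) (auto simp: amp_index intro!: sum.neutral)
  thus ?thesis unfolding qform_def by simp
qed

text \<open>A crude bound, from estimating each modulus by the root of the sum of squares;
  Cauchy-Schwarz would give N in place of N^2.\<close>

lemma cmod_sum_square_le:
  fixes g :: "nat \<Rightarrow> complex"
  shows "(cmod (\<Sum>a<N. g a))\<^sup>2 \<le> (real N)\<^sup>2 * (\<Sum>a<N. (cmod (g a))\<^sup>2)"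
proof -
  let ?m = "sqrt (\<Sum>a<N. (cmod (g a))\<^sup>2)"
  have "cmod (g a) \<le> ?m" if "a < N" for a
    using that by (intro real_le_rsqrt member_le_sum) auto
  hence "(\<Sum>a<N. cmod (g a)) \<le> (\<Sum>a<N. ?m)" by (intro sum_mono) auto
  hence "cmod (\<Sum>a<N. g a) \<le> real N * ?m" using norm_sum[of g "{..<N}"] by simp
  hence "(cmod (\<Sum>a<N. g a))\<^sup>2 \<le> (real N * ?m)\<^sup>2" by (intro power_mono) auto
  thus ?thesis by (simp add: power_mult_distrib sum_nonneg)
qed

text \<open>The scalar bound applied to every eigenvector coordinate. For vectors \<open>u a\<close>
  that are the blocks of one vector it is a pinching inequality: M is at most N^2 times its block
  diagonal part.\<close>

lemma psd_qform_sum_le: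
  assumes "psd n M"
  shows "Re (qform n M (\<lambda>p. \<Sum>a<N. u a p)) \<le> (real N)\<^sup>2 * (\<Sum>a<N. Re (qform n M (u a)))"
proof -
  from psd_spectral[OF assms] obtain U l where U: "unitary_mat n U"
    and eq: "M = U * real_diag n l * mat_adjoint U" and l: "\<And>i. i < n \<Longrightarrow> 0 \<le> l i" by blast
  let ?g = "\<lambda>k a. \<Sum>i<n. cnj (U $$ (i,k)) * u a i"
  have s: "(\<Sum>i<n. cnj (U $$ (i,k)) * (\<Sum>a<N. u a i)) = (\<Sum>a<N. ?g k a)" for k
    unfolding sum_distrib_left by (rule sum.swap)
  have "Re (qform n M (\<lambda>p. \<Sum>a<N. u a p)) = (\<Sum>k<n. l k * (cmod (\<Sum>a<N. ?g k a))\<^sup>2)"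
    unfolding eq qform_conj_real_diag[OF unitary_matD(1)[OF U]] s by simp
  also have "\<dots> \<le> (\<Sum>k<n. l k * ((real N)\<^sup>2 * (\<Sum>a<N. (cmod (?g k a))\<^sup>2)))"
    using l by (intro sum_mono mult_left_mono cmod_sum_square_le) auto
  also have "\<dots> = (real N)\<^sup>2 * (\<Sum>k<n. \<Sum>a<N. l k * (cmod (?g k a))\<^sup>2)"
    by (simp add: sum_distrib_left ac_simps)
  also have "\<dots> = (real N)\<^sup>2 * (\<Sum>a<N. \<Sum>k<n. l k * (cmod (?g k a))\<^sup>2)"
    by (subst sum.swap) simp
  also have "\<dots> = (real N)\<^sup>2 * (\<Sum>a<N. Re (qform n M (u a)))"
    unfolding eq qform_conj_real_diag[OF unitary_matD(1)[OF U]] by simp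
  finally show ?thesis .
qed

text \<open>Only the existence of a dominating constant matters: it yields the inclusion of supports and keeps the infimum in the max-relative entropy from being taken over the empty set.\<close>

lemma dominated_by_marginal:
  assumes M: "psd (N * r) M" and N: "N > 0"
  shows "psd (N * r) (complex_of_real (real N ^ 3) \<cdot>\<^sub>m amp N r ((1 / of_nat N) \<cdot>\<^sub>m marg N r M) - M)"
proof -
  note m = psdD[OF M] and g = psdD[OF psd_marg[OF M]]
  let ?A = "amp N r ((1 / of_nat N) \<cdot>\<^sub>m marg N r M)"
  have adj: "mat_adjoint ?A = ?A"
  proof -
    have "mat_adjoint ((1 / of_nat N) \<cdot>\<^sub>m marg N r M) = (1 / of_nat N) \<cdot>\<^sub>m mat_adjoint (marg N r M)"
      by (rule eq_matI) (auto simp: marg_def)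
    thus ?thesis using g by (simp add: amp_adjoint)
  qed
  have "mat_adjoint (complex_of_real (real N ^ 3) \<cdot>\<^sub>m ?A - M) = complex_of_real (real N ^ 3) \<cdot>\<^sub>m mat_adjoint ?A - mat_adjoint M"
    using m(1) by (intro eq_matI) auto
  hence herm: "mat_adjoint (complex_of_real (real N ^ 3) \<cdot>\<^sub>m ?A - M) = complex_of_real (real N ^ 3) \<cdot>\<^sub>m ?A - M"
    unfolding adj m(2) .
  have "0 \<le> Re (qform (N * r) (complex_of_real (real N ^ 3) \<cdot>\<^sub>m ?A - M) v)" for v
  proof -
    \<comment> \<open>\<open>u a\<close> is the a-th block of v. In the constant N^3 the factor N^2
      is the pinching constant, and the last N cancels the weight 1/N of the reference.\<close>
    define u where "u a p = (if p div r = a then v (a * r + p mod r) else 0)" for a p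
    have "qform (N * r) M v = qform (N * r) M (\<lambda>p. \<Sum>a<N. u a p)"
    proof -
      have "v p = (\<Sum>a<N. u a p)" if "p < N * r" for p
        unfolding u_def using less_mult_div_mod[OF that] by simp
      thus ?thesis unfolding qform_def by (intro sum.cong refl) auto
    qed
    hence "Re (qform (N * r) M v) \<le> (real N)\<^sup>2 * (\<Sum>a<N. Re (qform (N * r) M (u a)))"
      using psd_qform_sum_le[OF M] by simp
    also have "\<dots> \<le> (real N)\<^sup>2 * (\<Sum>a<N. Re (qform r (marg N r M) (\<lambda>x. v (a * r + x))))"
    proof (intro mult_left_mono sum_mono)
      fix a assume a: "a \<in> {..<N}"
      have "Re (qform (N * r) M (u a)) = Re (qform (N * r) M (\<lambda>p. if p div r = a then v (a * r + p mod r) else 0))"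
        unfolding u_def ..
      \<comment> \<open>The block of M at a is one of the nonnegative summands of the partial trace,
        tested on the same ancilla vector.\<close>
      also have "\<dots> \<le> (\<Sum>b<N. Re (qform (N * r) M (\<lambda>p. if p div r = b then v (a * r + p mod r) else 0)))"
        by (rule member_le_sum[of a "{..<N}" "\<lambda>b. Re (qform (N * r) M (\<lambda>p. if p div r = b then v (a * r + p mod r) else 0))"])
           (use a m(3) in auto)
      finally show "Re (qform (N * r) M (u a)) \<le> Re (qform r (marg N r M) (\<lambda>x. v (a * r + x)))"
        by (simp add: qform_marg)
    qed simp
    also have "\<dots> = (real N)\<^sup>2 * Re (qform (N * r) (amp N r (marg N r M)) v)" by (simp add: qform_amp)
    finally have le: "Re (qform (N * r) M v) \<le> (real N)\<^sup>2 * Re (qform (N * r) (amp N r (marg N r M)) v)" .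
    have qs: "qform n (c \<cdot>\<^sub>m B) v = c * qform n B v" if "B \<in> carrier_mat n n" for c n B
      unfolding qform_def sum_distrib_left using that by (intro sum.cong refl) auto
    have "complex_of_real (real N ^ 3) * qform (N * r) ?A v = complex_of_real ((real N)\<^sup>2) * qform (N * r) (amp N r (marg N r M)) v"
      unfolding amp_smult[OF marg_carrier] qs[OF amp_carrier] using N by (simp add: power2_eq_square power3_eq_cube)
    moreover have "Re (complex_of_real k * z) = k * Re z" for k z by simp
    ultimately have "Re (complex_of_real (real N ^ 3) * qform (N * r) ?A v) = (real N)\<^sup>2 * Re (qform (N * r) (amp N r (marg N r M)) v)"
      by metis
    thus ?thesis unfolding qform_diff[OF amp_carrier m(1)] using le by simp
  qed
  thus ?thesis unfolding psd_iff_qform using herm m(1) by auto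
qed

section \<open>Channels tensored with the identity on an ancilla\<close>

lemma tensor_map_id_index:
  assumes h: "k < N" "x < r" "k' < N" "y < r"
  shows "tensor_map \<Lambda> (\<lambda>X. X) N r X $$ (k * r + x, k' * r + y)
    = (\<Sum>a<N. \<Sum>b<N. X $$ (a * r + x, b * r + y) * \<Lambda> (unit_mat N a b) $$ (k,k'))"
proof -
  have "tensor_map \<Lambda> (\<lambda>X. X) N r X $$ (k * r + x, k' * r + y)
    = (\<Sum>a<N. \<Sum>b<N. \<Sum>c<r. \<Sum>e<r. X $$ (a * r + c, b * r + e) * \<Lambda> (unit_mat N a b) $$ (k,k') * unit_mat r c e $$ (x,y))"
    unfolding tensor_map_def using h by (simp add: mult_add_less)
  also have "\<dots> = (\<Sum>a<N. \<Sum>b<N. \<Sum>c<r. \<Sum>e<r. if e = y then (if c = x then X $$ (a * r + x, b * r + y) * \<Lambda> (unit_mat N a b) $$ (k,k') else 0) else 0)"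
    using h by (intro sum.cong refl) (auto simp: unit_mat_def)
  also have "\<dots> = (\<Sum>a<N. \<Sum>b<N. X $$ (a * r + x, b * r + y) * \<Lambda> (unit_mat N a b) $$ (k,k'))"
    using h by simp
  finally show ?thesis .
qed

lemma tensor_map_carrier [simp]: "tensor_map \<Lambda>1 \<Lambda>2 N r X \<in> carrier_mat (N * r) (N * r)"
  by (simp add: tensor_map_def)

lemma unit_mat_carrier [simp]: "unit_mat N a b \<in> carrier_mat N N"
  by (simp add: unit_mat_def)

lemma mtrace_unit_mat: "a < N \<Longrightarrow> b < N \<Longrightarrow> mtrace (unit_mat N a b) = (if a = b then 1 else 0)"
  by (auto simp: mtrace_def unit_mat_def)

lemma tensor_map_depol:
  assumes N: "N > 0"
  shows "tensor_map (depol N) (\<lambda>X. X) N r X = amp N r ((1 / of_nat N) \<cdot>\<^sub>m marg N r X)"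
proof (rule eq_mat_blockI[of _ N r N r])
  fix k x k' y assume h: "k < N" "x < r" "k' < N" "y < r"
  have "tensor_map (depol N) (\<lambda>X. X) N r X $$ (k * r + x, k' * r + y)
    = (\<Sum>a<N. \<Sum>b<N. if b = a then (if k = k' then X $$ (a * r + x, a * r + y) / of_nat N else 0) else 0)"
    unfolding tensor_map_id_index[OF h]
    using h by (intro sum.cong refl) (auto simp: depol_def mtrace_unit_mat)
  also have "\<dots> = amp N r ((1 / of_nat N) \<cdot>\<^sub>m marg N r X) $$ (k * r + x, k' * r + y)"
    unfolding amp_index[OF h(1,3,2,4)] using h by (simp add: marg_def sum_divide_distrib)
  finally show "tensor_map (depol N) (\<lambda>X. X) N r X $$ (k * r + x, k' * r + y) = amp N r ((1 / of_nat N) \<cdot>\<^sub>m marg N r X) $$ (k * r + x, k' * r + y)" .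
qed auto

text \<open>\<open>tensor_map\<close> evaluates a channel on matrix units only, so the Kraus data
  are extracted in terms of those values.\<close>

lemma is_channelE:
  assumes "is_channel N \<Lambda>"
  obtains M :: nat and K where "\<forall>s\<in>{..<M}. K s \<in> carrier_mat N N"
    "\<forall>i<N. \<forall>j<N. (\<Sum>s<M. \<Sum>k<N. K s $$ (k,i) * cnj (K s $$ (k,j))) = (if i = j then 1 else 0)"
    "\<forall>a<N. \<forall>b<N. \<forall>k<N. \<forall>k'<N. \<Lambda> (unit_mat N a b) $$ (k,k') = (\<Sum>s<M. K s $$ (k,a) * cnj (K s $$ (k',b)))"
proof -
  from assms obtain Ks where Ks: "\<forall>K\<in>set Ks. K \<in> carrier_mat N N"
    and one: "mat N N (\<lambda>(i,j). \<Sum>k<length Ks. (mat_adjoint (Ks!k) * Ks!k) $$ (i,j)) = 1\<^sub>m N"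
    and L: "\<forall>\<rho>\<in>carrier_mat N N. \<Lambda> \<rho> = mat N N (\<lambda>(i,j). \<Sum>k<length Ks. (Ks!k * \<rho> * mat_adjoint (Ks!k)) $$ (i,j))"
    unfolding is_channel_def by blast
  have K: "Ks ! s \<in> carrier_mat N N" if "s < length Ks" for s using Ks that by auto
  show ?thesis
  proof (rule that[of "length Ks" "\<lambda>s. Ks ! s"])
    show "\<forall>s\<in>{..<length Ks}. Ks ! s \<in> carrier_mat N N" using K by auto
    show "\<forall>i<N. \<forall>j<N. (\<Sum>s<length Ks. \<Sum>k<N. (Ks ! s) $$ (k,i) * cnj ((Ks ! s) $$ (k,j))) = (if i = j then 1 else 0)"
    proof (intro allI impI)
      fix i j assume ij: "i < N" "j < N"
      have "(\<Sum>s<length Ks. \<Sum>k<N. (Ks ! s) $$ (k,i) * cnj ((Ks ! s) $$ (k,j))) = (\<Sum>s<length Ks. (mat_adjoint (Ks!s) * Ks!s) $$ (j,i))"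
      proof (rule sum.cong[OF refl])
        fix s assume "s \<in> {..<length Ks}"
        hence s: "Ks ! s \<in> carrier_mat N N" using K by simp
        show "(\<Sum>k<N. (Ks ! s) $$ (k,i) * cnj ((Ks ! s) $$ (k,j))) = (mat_adjoint (Ks!s) * Ks!s) $$ (j,i)"
          unfolding mat_mult_index[OF mat_adjoint_carrier[OF s] s ij(2,1)] using s ij by (intro sum.cong refl) auto
      qed
      also have "\<dots> = (1\<^sub>m N :: complex mat) $$ (j,i)" unfolding one[symmetric] using ij by simp
      finally show "(\<Sum>s<length Ks. \<Sum>k<N. (Ks ! s) $$ (k,i) * cnj ((Ks ! s) $$ (k,j))) = (if i = j then 1 else 0)"
        using ij by auto
    qed
    show "\<forall>a<N. \<forall>b<N. \<forall>k<N. \<forall>k'<N. \<Lambda> (unit_mat N a b) $$ (k,k') = (\<Sum>s<length Ks. (Ks ! s) $$ (k,a) * cnj ((Ks ! s) $$ (k',b)))"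
    proof (intro allI impI)
      fix a b k k' assume h: "a < N" "b < N" "k < N" "k' < N"
      have "\<Lambda> (unit_mat N a b) $$ (k,k') = (\<Sum>s<length Ks. (Ks!s * unit_mat N a b * mat_adjoint (Ks!s)) $$ (k,k'))"
        using L h by simp
      also have "\<dots> = (\<Sum>s<length Ks. \<Sum>p<N. \<Sum>q<N. (Ks!s) $$ (k,p) * unit_mat N a b $$ (p,q) * cnj ((Ks!s) $$ (k',q)))"
        using h K by (intro sum.cong refl conj_index) auto
      also have "\<dots> = (\<Sum>s<length Ks. \<Sum>p<N. \<Sum>q<N. if q = b then (if p = a then (Ks!s) $$ (k,a) * cnj ((Ks!s) $$ (k',b)) else 0) else 0)"
        by (intro sum.cong refl) (auto simp: unit_mat_def)
      also have "\<dots> = (\<Sum>s<length Ks. (Ks!s) $$ (k,a) * cnj ((Ks!s) $$ (k',b)))" using h by simp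
      finally show "\<Lambda> (unit_mat N a b) $$ (k,k') = (\<Sum>s<length Ks. (Ks!s) $$ (k,a) * cnj ((Ks!s) $$ (k',b)))" .
    qed
  qed
qed

text \<open>On operators of the right size \<Lambda> \<otimes> id is the Kraus map with operators
  K_s \<otimes> I, whence positivity. The marginal is kept because the image of a matrix unit has
  the trace of that matrix unit.\<close>

lemma tensor_map_channel:
  assumes "is_channel N \<Lambda>" and X: "psd (N * r) X"
  shows "psd (N * r) (tensor_map \<Lambda> (\<lambda>X. X) N r X)"
    "marg N r (tensor_map \<Lambda> (\<lambda>X. X) N r X) = marg N r X"
proof -
  obtain M :: nat and K where K: "\<forall>s\<in>{..<M}. K s \<in> carrier_mat N N"
    and tp: "\<forall>i<N. \<forall>j<N. (\<Sum>s<M. \<Sum>k<N. K s $$ (k,i) * cnj (K s $$ (k,j))) = (if i = j then 1 else 0)"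
    and L: "\<forall>a<N. \<forall>b<N. \<forall>k<N. \<forall>k'<N. \<Lambda> (unit_mat N a b) $$ (k,k') = (\<Sum>s<M. K s $$ (k,a) * cnj (K s $$ (k',b)))"
    by (rule is_channelE[OF assms(1)])
  note Xc = psdD(1)[OF X]
  have "tensor_map \<Lambda> (\<lambda>X. X) N r X = kmap (N * r) {..<M} (\<lambda>s. tens r (K s)) X"
  proof (rule eq_mat_blockI[of _ N r N r])
    fix k x k' y assume h: "k < N" "x < r" "k' < N" "y < r"
    have "tensor_map \<Lambda> (\<lambda>X. X) N r X $$ (k * r + x, k' * r + y)
      = (\<Sum>a<N. \<Sum>b<N. \<Sum>s<M. K s $$ (k,a) * X $$ (a * r + x, b * r + y) * cnj (K s $$ (k',b)))"
      unfolding tensor_map_id_index[OF h] using h L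
      by (intro sum.cong refl) (simp add: sum_distrib_left ac_simps)
    also have "\<dots> = (\<Sum>a<N. \<Sum>s<M. \<Sum>b<N. K s $$ (k,a) * X $$ (a * r + x, b * r + y) * cnj (K s $$ (k',b)))"
      by (rule sum.cong[OF refl], rule sum.swap)
    also have "\<dots> = (\<Sum>s<M. \<Sum>a<N. \<Sum>b<N. K s $$ (k,a) * X $$ (a * r + x, b * r + y) * cnj (K s $$ (k',b)))"
      by (rule sum.swap)
    finally show "tensor_map \<Lambda> (\<lambda>X. X) N r X $$ (k * r + x, k' * r + y) = kmap (N * r) {..<M} (\<lambda>s. tens r (K s)) X $$ (k * r + x, k' * r + y)"
      unfolding kmap_tens_index[OF K Xc h] .
  qed auto
  moreover have "\<forall>s\<in>{..<M}. tens r (K s) \<in> carrier_mat (N * r) (N * r)" using K tens_carrier by blast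
  ultimately show "psd (N * r) (tensor_map \<Lambda> (\<lambda>X. X) N r X)" using psd_kmap[OF _ X] by simp
  have trL: "(\<Sum>k<N. \<Lambda> (unit_mat N a b) $$ (k,k)) = (if a = b then 1 else 0)" if "a < N" "b < N" for a b
  proof -
    have "(\<Sum>k<N. \<Lambda> (unit_mat N a b) $$ (k,k)) = (\<Sum>s<M. \<Sum>k<N. K s $$ (k,a) * cnj (K s $$ (k,b)))"
      using that L by (subst sum.swap) simp
    thus ?thesis using tp that by simp
  qed
  show "marg N r (tensor_map \<Lambda> (\<lambda>X. X) N r X) = marg N r X"
  proof (rule eq_matI)
    fix x y assume "x < dim_row (marg N r X)" "y < dim_col (marg N r X)"
    hence h: "x < r" "y < r" by (auto simp: marg_def)
    have "marg N r (tensor_map \<Lambda> (\<lambda>X. X) N r X) $$ (x,y) = (\<Sum>k<N. \<Sum>a<N. \<Sum>b<N. X $$ (a * r + x, b * r + y) * \<Lambda> (unit_mat N a b) $$ (k,k))"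
      using h by (simp add: marg_def tensor_map_id_index)
    also have "\<dots> = (\<Sum>a<N. \<Sum>k<N. \<Sum>b<N. X $$ (a * r + x, b * r + y) * \<Lambda> (unit_mat N a b) $$ (k,k))" by (rule sum.swap)
    also have "\<dots> = (\<Sum>a<N. \<Sum>b<N. \<Sum>k<N. X $$ (a * r + x, b * r + y) * \<Lambda> (unit_mat N a b) $$ (k,k))"
      by (rule sum.cong[OF refl], rule sum.swap)
    also have "\<dots> = (\<Sum>a<N. \<Sum>b<N. if b = a then X $$ (a * r + x, b * r + y) else 0)"
      unfolding sum_distrib_left[symmetric] by (intro sum.cong refl) (auto simp: trL)
    also have "\<dots> = marg N r X $$ (x,y)" using h by (simp add: marg_def)
    finally show "marg N r (tensor_map \<Lambda> (\<lambda>X. X) N r X) $$ (x,y) = marg N r X $$ (x,y)" .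
  qed (auto simp: marg_def)
qed

section \<open>Convolution along a pair of Latin squares\<close>

lemma sum_pair: "(\<Sum>p\<in>A \<times> B. f p) = (\<Sum>a\<in>A. \<Sum>b\<in>B. f (a,b))"
  by (simp add: sum.cartesian_product)

text \<open>In the application (\<phi>, \<psi>) is the inverse of the permutation underlying the key unitary.\<close>

locale latin_pair =
  fixes D :: nat and \<phi> \<psi> :: "nat \<Rightarrow> nat \<Rightarrow> nat"
  assumes D_pos: "D > 0"
    and bij: "bij_betw (\<lambda>(k,l). (\<phi> k l, \<psi> k l)) ({..<D} \<times> {..<D}) ({..<D} \<times> {..<D})"
    and psi_inj: "\<And>l. l < D \<Longrightarrow> inj_on (\<lambda>k. \<psi> k l) {..<D}"
    and phi_bij: "\<And>k. k < D \<Longrightarrow> bij_betw (\<phi> k) {..<D} {..<D}"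
begin

lemma phi_psi_less: "k < D \<Longrightarrow> l < D \<Longrightarrow> \<phi> k l < D" "k < D \<Longrightarrow> l < D \<Longrightarrow> \<psi> k l < D"
  using bij_betw_apply[OF bij, of "(k,l)"] by auto

lemma psi_eq_iff: "k < D \<Longrightarrow> k' < D \<Longrightarrow> l < D \<Longrightarrow> \<psi> k l = \<psi> k' l \<longleftrightarrow> k = k'"
  using psi_inj[of l] by (auto dest: inj_onD)

lemma sum_reindex: "(\<Sum>l<D. \<Sum>k<D. g (\<phi> k l) (\<psi> k l)) = (\<Sum>i<D. \<Sum>j<D. (g i j :: complex))"
proof -
  have "(\<Sum>l<D. \<Sum>k<D. g (\<phi> k l) (\<psi> k l)) = (\<Sum>k<D. \<Sum>l<D. g (\<phi> k l) (\<psi> k l))" by (rule sum.swap)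
  also have "\<dots> = (\<Sum>p\<in>{..<D} \<times> {..<D}. (\<lambda>(i,j). g i j) ((\<lambda>(k,l). (\<phi> k l, \<psi> k l)) p))"
    unfolding sum.cartesian_product by (intro sum.cong refl) auto
  also have "\<dots> = (\<Sum>p\<in>{..<D} \<times> {..<D}. (\<lambda>(i,j). g i j) p)"
    by (rule sum.reindex_bij_betw[OF bij])
  finally show ?thesis unfolding sum.cartesian_product .
qed

text \<open>The matrices \<open>vmat m\<close> (tensored with the ancilla) are Kraus operators of \<rho> \<mapsto> \<omega>, and the matrices \<open>wmat (l, s)\<close> those of T. In row and column indices B comes before A, so that A joins the ancilla.\<close>

definition vmat :: "nat \<Rightarrow> complex mat" where
  "vmat m = mat (D * D) D (\<lambda>(q,i). if q div D = \<psi> i m \<and> q mod D = \<phi> i m then complex_of_real (1 / sqrt (real D)) else 0)"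

lemma vmat_carrier: "\<forall>m\<in>{..<D}. vmat m \<in> carrier_mat (D * D) D"
  by (simp add: vmat_def)

lemma vmat_index:
  assumes "c < D" "a < D" "i < D"
  shows "vmat m $$ (c * D + a, i) = (if c = \<psi> i m \<and> a = \<phi> i m then complex_of_real (1 / sqrt (real D)) else 0)"
  using assms mult_add_less[of c D a D] by (simp add: vmat_def)

text \<open>This is \<omega>. The index m runs through the basis states of the maximally mixed B,
  each of weight 1/D, which explains the 1/sqrt(D) in \<open>vmat\<close>.\<close>

definition inp :: "nat \<Rightarrow> complex mat \<Rightarrow> complex mat" where
  "inp r \<rho> = kmap (D * D * r) {..<D} (\<lambda>m. tens r (vmat m)) \<rho>"

lemma sqrt_square: "complex_of_real (1 / sqrt (real D)) * complex_of_real (1 / sqrt (real D)) = 1 / of_nat D"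
proof -
  have "1 / sqrt (real D) * (1 / sqrt (real D)) = 1 / real D" by simp
  thus ?thesis unfolding of_real_mult[symmetric] by simp
qed

lemma inp_index:
  assumes \<rho>: "\<rho> \<in> carrier_mat (D * r) (D * r)" and h: "c < D" "a < D" "x < r" "c' < D" "a' < D" "y < r"
  shows "inp r \<rho> $$ ((c * D + a) * r + x, (c' * D + a') * r + y)
    = (\<Sum>m<D. \<Sum>i<D. \<Sum>i'<D. if c = \<psi> i m \<and> a = \<phi> i m \<and> c' = \<psi> i' m \<and> a' = \<phi> i' m
          then \<rho> $$ (i * r + x, i' * r + y) / of_nat D else 0)"
proof -
  have "inp r \<rho> $$ ((c * D + a) * r + x, (c' * D + a') * r + y)
    = (\<Sum>m<D. \<Sum>i<D. \<Sum>i'<D. vmat m $$ (c * D + a, i) * \<rho> $$ (i * r + x, i' * r + y) * cnj (vmat m $$ (c' * D + a', i')))"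
    unfolding inp_def
    by (rule kmap_tens_index[OF vmat_carrier \<rho> mult_add_less[OF h(1,2)] h(3) mult_add_less[OF h(4,5)] h(6)])
  also have "\<dots> = (\<Sum>m<D. \<Sum>i<D. \<Sum>i'<D. if c = \<psi> i m \<and> a = \<phi> i m \<and> c' = \<psi> i' m \<and> a' = \<phi> i' m
          then \<rho> $$ (i * r + x, i' * r + y) * (complex_of_real (1 / sqrt (real D)) * complex_of_real (1 / sqrt (real D))) else 0)"
    using h by (intro sum.cong refl) (auto simp: vmat_index)
  finally show ?thesis unfolding sqrt_square mult_1_right times_divide_eq_right .
qed

lemma inp_state:
  assumes "is_state (D * r) \<rho>"
  shows "is_state (D * D * r) (inp r \<rho>)"
proof -
  have \<rho>: "psd (D * r) \<rho>" "mtrace \<rho> = 1" using assms by (auto simp: is_state_def)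
  have "\<forall>m\<in>{..<D}. tens r (vmat m) \<in> carrier_mat (D * D * r) (D * r)" using vmat_carrier tens_carrier by blast
  from psd_kmap[OF this \<rho>(1)] have p: "psd (D * D * r) (inp r \<rho>)" unfolding inp_def .
  have "mtrace (inp r \<rho>) = mtrace \<rho>" unfolding inp_def
  proof (rule kmap_tens_trace_preserving[OF vmat_carrier psdD(1)[OF \<rho>(1)]])
    fix i j assume ij: "i < D" "j < D"
    have "(\<Sum>m<D. \<Sum>k<D * D. vmat m $$ (k,i) * cnj (vmat m $$ (k,j)))
      = (\<Sum>m<D. \<Sum>c<D. \<Sum>a<D. if c = \<psi> i m then (if a = \<phi> i m then (if i = j then 1 / of_nat D else 0) else 0) else 0)"
      unfolding sum_lessThan_mult
    proof (intro sum.cong refl)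
      fix m c a assume "m \<in> {..<D}" "c \<in> {..<D}" "a \<in> {..<D}"
      hence h: "m < D" "c < D" "a < D" by auto
      show "vmat m $$ (c * D + a, i) * cnj (vmat m $$ (c * D + a, j))
        = (if c = \<psi> i m then (if a = \<phi> i m then (if i = j then 1 / of_nat D else 0) else 0) else 0)"
        unfolding vmat_index[OF h(2,3) ij(1)] vmat_index[OF h(2,3) ij(2)]
        using psi_eq_iff[OF ij h(1)] sqrt_square by auto
    qed
    also have "\<dots> = (\<Sum>m<D. \<Sum>c<D. if c = \<psi> i m then (\<Sum>a<D. if a = \<phi> i m then (if i = j then 1 / of_nat D else 0) else 0) else 0)"
      by (intro sum.cong refl) auto
    also have "\<dots> = (\<Sum>m<D. if i = j then 1 / of_nat D else 0)"
      using ij phi_psi_less by (intro sum.cong refl) auto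
    also have "\<dots> = (if i = j then 1 else 0)" using D_pos by simp
    finally show "(\<Sum>m<D. \<Sum>k<D * D. vmat m $$ (k,i) * cnj (vmat m $$ (k,j))) = (if i = j then 1 else 0)" .
  qed
  thus ?thesis using p \<rho>(2) by (simp add: is_state_def)
qed

lemma block_assoc: "(c * D + a) * r + x = c * (D * r) + (a * r + (x::nat))"
  by (simp add: algebra_simps)

text \<open>Tracing out B keeps only the terms with \<psi> i m = \<psi> i' m, that is i = i', and so
  removes all coherences of \<rho> between different basis states. For each remaining i the map
  \<phi> i is a permutation, so averaging over m makes A uniform and independent of i.\<close>

lemma marg_inp:
  assumes \<rho>: "\<rho> \<in> carrier_mat (D * r) (D * r)"
  shows "marg D (D * r) (inp r \<rho>) = amp D r ((1 / of_nat D) \<cdot>\<^sub>m marg D r \<rho>)"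
proof (rule eq_mat_blockI[of _ D r D r])
  fix a x a' y assume h: "a < D" "x < r" "a' < D" "y < r"
  let ?t = "\<lambda>i. \<rho> $$ (i * r + x, i * r + y) / of_nat D"
  have "marg D (D * r) (inp r \<rho>) $$ (a * r + x, a' * r + y)
    = (\<Sum>c<D. inp r \<rho> $$ ((c * D + a) * r + x, (c * D + a') * r + y))"
    using h by (simp add: marg_def mult_add_less block_assoc)
  also have "\<dots> = (\<Sum>c<D. \<Sum>m<D. \<Sum>i<D. \<Sum>i'<D. if c = \<psi> i m \<and> a = \<phi> i m \<and> c = \<psi> i' m \<and> a' = \<phi> i' m
          then \<rho> $$ (i * r + x, i' * r + y) / of_nat D else 0)"
    using h by (intro sum.cong refl inp_index[OF \<rho>]) auto
  also have "\<dots> = (\<Sum>c<D. \<Sum>m<D. \<Sum>i<D. \<Sum>i'<D. if i' = i then (if c = \<psi> i m then (if a = \<phi> i m \<and> a' = \<phi> i m then ?t i else 0) else 0) else 0)"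
    using psi_eq_iff by (intro sum.cong refl) auto
  also have "\<dots> = (\<Sum>c<D. \<Sum>m<D. \<Sum>i<D. if c = \<psi> i m then (if a = \<phi> i m \<and> a' = \<phi> i m then ?t i else 0) else 0)"
    by simp
  also have "\<dots> = (\<Sum>m<D. \<Sum>i<D. \<Sum>c<D. if c = \<psi> i m then (if a = \<phi> i m \<and> a' = \<phi> i m then ?t i else 0) else 0)"
    by (rule trans[OF sum.swap], rule sum.cong[OF refl], rule sum.swap)
  also have "\<dots> = (\<Sum>m<D. \<Sum>i<D. if a = \<phi> i m \<and> a' = \<phi> i m then ?t i else 0)"
    using phi_psi_less by (intro sum.cong refl) auto
  also have "\<dots> = (\<Sum>i<D. \<Sum>m<D. (\<lambda>j. if a = j \<and> a' = j then ?t i else 0) (\<phi> i m))"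
    by (rule sum.swap)
  also have "\<dots> = (\<Sum>i<D. \<Sum>j<D. if a = j \<and> a' = j then ?t i else 0)"
    using phi_bij by (intro sum.cong refl sum.reindex_bij_betw) auto
  also have "\<dots> = (\<Sum>i<D. \<Sum>j<D. if j = a then (if a = a' then ?t i else 0) else 0)"
    by (intro sum.cong refl) auto
  also have "\<dots> = amp D r ((1 / of_nat D) \<cdot>\<^sub>m marg D r \<rho>) $$ (a * r + x, a' * r + y)"
    unfolding amp_index[OF h(1,3,2,4)] using h by (simp add: marg_def sum_divide_distrib)
  finally show "marg D (D * r) (inp r \<rho>) $$ (a * r + x, a' * r + y) = amp D r ((1 / of_nat D) \<cdot>\<^sub>m marg D r \<rho>) $$ (a * r + x, a' * r + y)" .
qed auto

text \<open>Identifies the reference for B with ancilla AR, which \<Lambda>2 sees, with the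
  reference for the joint system BA with ancilla R, which T sees.\<close>

lemma amp_amp:
  assumes B: "B \<in> carrier_mat r r"
  shows "amp D (D * r) ((1 / of_nat D) \<cdot>\<^sub>m amp D r ((1 / of_nat D) \<cdot>\<^sub>m B)) = amp (D * D) r ((1 / of_nat (D * D)) \<cdot>\<^sub>m B)"
proof (rule eq_mat_blockI[of _ "D * D" r "D * D" r])
  fix p x q y assume h: "p < D * D" "x < r" "q < D * D" "y < r"
  define b a b' a' where "b = p div D" and "a = p mod D" and "b' = q div D" and "a' = q mod D"
  have p: "p = b * D + a" "b < D" "a < D" and q: "q = b' * D + a'" "b' < D" "a' < D"
    using less_mult_div_mod[OF h(1)] less_mult_div_mod[OF h(3)] by (auto simp: b_def a_def b'_def a'_def)
  have pq: "p = q \<longleftrightarrow> b = b' \<and> a = a'" unfolding b_def a_def b'_def a'_def by (metis div_mult_mod_eq)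
  show "amp D (D * r) ((1 / of_nat D) \<cdot>\<^sub>m amp D r ((1 / of_nat D) \<cdot>\<^sub>m B)) $$ (p * r + x, q * r + y)
    = amp (D * D) r ((1 / of_nat (D * D)) \<cdot>\<^sub>m B) $$ (p * r + x, q * r + y)"
    unfolding amp_index[OF h(1,3,2,4)] pq
    unfolding p(1) q(1) block_assoc amp_index[OF p(2) q(2) mult_add_less[OF p(3) h(2)] mult_add_less[OF q(3) h(4)]]
    using B h p q by (auto simp: mult_add_less amp_index)
qed (auto simp: mult.assoc)

lemma inp_sum:
  assumes \<rho>: "\<rho> \<in> carrier_mat (D * r) (D * r)" and xy: "x < r" "y < r"
  shows "(\<Sum>a<D. \<Sum>a'<D. \<Sum>c<D. \<Sum>c'<D. F a a' c c' * inp r \<rho> $$ ((c * D + a) * r + x, (c' * D + a') * r + y))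
    = (\<Sum>m<D. \<Sum>i<D. \<Sum>i'<D. F (\<phi> i m) (\<phi> i' m) (\<psi> i m) (\<psi> i' m) * \<rho> $$ (i * r + x, i' * r + y) / of_nat D)"
proof -
  let ?N = "{..<D}"
  let ?t = "\<lambda>i i'. \<rho> $$ (i * r + x, i' * r + y) / of_nat D"
  let ?g = "\<lambda>a a' c c' m i i'. if c' = \<psi> i' m then (if c = \<psi> i m then (if a' = \<phi> i' m then (if a = \<phi> i m then F a a' c c' * ?t i i' else 0) else 0) else 0) else 0"
  have "(\<Sum>a<D. \<Sum>a'<D. \<Sum>c<D. \<Sum>c'<D. F a a' c c' * inp r \<rho> $$ ((c * D + a) * r + x, (c' * D + a') * r + y))
    = (\<Sum>a<D. \<Sum>a'<D. \<Sum>c<D. \<Sum>c'<D. \<Sum>m<D. \<Sum>i<D. \<Sum>i'<D. ?g a a' c c' m i i')"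
  proof (intro sum.cong refl)
    fix a a' c c' assume "a \<in> ?N" "a' \<in> ?N" "c \<in> ?N" "c' \<in> ?N"
    hence h: "a < D" "a' < D" "c < D" "c' < D" by auto
    show "F a a' c c' * inp r \<rho> $$ ((c * D + a) * r + x, (c' * D + a') * r + y) = (\<Sum>m<D. \<Sum>i<D. \<Sum>i'<D. ?g a a' c c' m i i')"
      unfolding inp_index[OF \<rho> h(3,1) xy(1) h(4,2) xy(2)] sum_distrib_left
      by (intro sum.cong refl) auto
  qed
  \<comment> \<open>Packed into tuples, the four sums can be exchanged with the three sums from
    \<open>inp_index\<close> in a single swap.\<close>
  also have "\<dots> = (\<Sum>p\<in>?N \<times> ?N \<times> ?N \<times> ?N. \<Sum>q\<in>?N \<times> ?N \<times> ?N. case p of (a,a',c,c') \<Rightarrow> case q of (m,i,i') \<Rightarrow> ?g a a' c c' m i i')"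
    by (simp only: sum_pair prod.case)
  also have "\<dots> = (\<Sum>q\<in>?N \<times> ?N \<times> ?N. \<Sum>p\<in>?N \<times> ?N \<times> ?N \<times> ?N. case p of (a,a',c,c') \<Rightarrow> case q of (m,i,i') \<Rightarrow> ?g a a' c c' m i i')"
    by (rule sum.swap)
  also have "\<dots> = (\<Sum>m<D. \<Sum>i<D. \<Sum>i'<D. \<Sum>a<D. \<Sum>a'<D. \<Sum>c<D. \<Sum>c'<D. ?g a a' c c' m i i')"
    by (simp only: sum_pair prod.case)
  also have "\<dots> = (\<Sum>m<D. \<Sum>i<D. \<Sum>i'<D. F (\<phi> i m) (\<phi> i' m) (\<psi> i m) (\<psi> i' m) * ?t i i')"
    using phi_psi_less by (intro sum.cong refl) auto
  finally show ?thesis by simp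
qed

section \<open>The Kraus operators of T\<close>

context
  fixes M :: nat and K :: "nat \<Rightarrow> complex mat"
  assumes K: "\<forall>s\<in>{..<M}. K s \<in> carrier_mat D D"
    and tp: "\<forall>i<D. \<forall>j<D. (\<Sum>s<M. \<Sum>k<D. K s $$ (k,i) * cnj (K s $$ (k,j))) = (if i = j then 1 else 0)"
begin

text \<open>In the application this is <l| U (K_s \<otimes> I): the channel \<Lambda>1 acts on A,
  then U, and the output B is projected onto the basis state l.\<close>

definition wmat :: "nat \<times> nat \<Rightarrow> complex mat" where
  "wmat = (\<lambda>(l,s). mat D (D * D) (\<lambda>(k,q). if q div D = \<psi> k l then K s $$ (\<phi> k l, q mod D) else 0))"

lemma wmat_carrier: "\<forall>p\<in>{..<D} \<times> {..<M}. wmat p \<in> carrier_mat D (D * D)"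
  by (auto simp: wmat_def)

lemma wmat_index:
  assumes "k < D" "b < D" "a < D"
  shows "wmat (l,s) $$ (k, b * D + a) = (if b = \<psi> k l then K s $$ (\<phi> k l, a) else 0)"
  using assms mult_add_less[of b D a D] by (simp add: wmat_def)

lemma wmat_sum:
  assumes k: "k < D" and l: "l < D" and zero: "\<And>q. g 0 q = (0::complex)"
  shows "(\<Sum>q<D * D. g (wmat (l,s) $$ (k,q)) q) = (\<Sum>a<D. g (K s $$ (\<phi> k l, a)) (\<psi> k l * D + a))"
proof -
  have "(\<Sum>q<D * D. g (wmat (l,s) $$ (k,q)) q)
    = (\<Sum>b<D. if b = \<psi> k l then (\<Sum>a<D. g (K s $$ (\<phi> k l, a)) (\<psi> k l * D + a)) else 0)"
    unfolding sum_lessThan_mult using k zero by (intro sum.cong refl) (auto simp: wmat_index)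
  thus ?thesis using phi_psi_less[OF k l] by simp
qed

text \<open>Trace preservation combines the bijection (\<phi>, \<psi>) with the Kraus relation. T(I)
  is a multiple of I even if \<Lambda>1 is not unital: injectivity of \<psi> in its first argument
  kills the off-diagonal entries, and summing over l, which permutes the rows through \<phi> k,
  makes each diagonal entry the total of all |K_s(i,a)|^2. This is the trace of the Kraus relation,
  namely D.\<close>

lemma amp_kraus_wmat:
  assumes r: "r > 0"
  shows "amp_kraus (D * D) D r ({..<D} \<times> {..<M}) (\<lambda>p. tens r (wmat p))"
proof
  show "0 < D * D" "0 < D" "0 < r" using D_pos r by auto
  show "\<forall>s\<in>{..<D} \<times> {..<M}. tens r (wmat s) \<in> carrier_mat (D * r) (D * D * r)"
    using wmat_carrier tens_carrier by blast
  show "tens r (wmat s) * amp (D * D) r B = amp D r B * tens r (wmat s)"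
    if "s \<in> {..<D} \<times> {..<M}" "B \<in> carrier_mat r r" for B s
    by (rule tens_amp_commute) (use that wmat_carrier in auto)
  show "mtrace (kmap (D * r) ({..<D} \<times> {..<M}) (\<lambda>p. tens r (wmat p)) X) = mtrace X"
    if X: "X \<in> carrier_mat (D * D * r) (D * D * r)" for X
  proof (rule kmap_tens_trace_preserving[OF wmat_carrier X])
    fix p q assume pq: "p < D * D" "q < D * D"
    define b a b' a' where "b = p div D" and "a = p mod D" and "b' = q div D" and "a' = q mod D"
    have p: "p = b * D + a" "b < D" "a < D" and q: "q = b' * D + a'" "b' < D" "a' < D"
      using less_mult_div_mod[OF pq(1)] less_mult_div_mod[OF pq(2)] by (auto simp: b_def a_def b'_def a'_def)
    have pqe: "p = q \<longleftrightarrow> b = b' \<and> a = a'" unfolding b_def a_def b'_def a'_def by (metis div_mult_mod_eq)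
    let ?g = "\<lambda>i j. if j = b \<and> j = b' then (\<Sum>s<M. K s $$ (i,a) * cnj (K s $$ (i,a'))) else 0"
    have "(\<Sum>s\<in>{..<D} \<times> {..<M}. \<Sum>k<D. wmat s $$ (k,p) * cnj (wmat s $$ (k,q)))
      = (\<Sum>l<D. \<Sum>s<M. \<Sum>k<D. wmat (l,s) $$ (k,p) * cnj (wmat (l,s) $$ (k,q)))"
      by (simp only: sum_pair prod.case)
    also have "\<dots> = (\<Sum>l<D. \<Sum>k<D. \<Sum>s<M. wmat (l,s) $$ (k,p) * cnj (wmat (l,s) $$ (k,q)))"
      by (rule sum.cong[OF refl], rule sum.swap)
    also have "\<dots> = (\<Sum>l<D. \<Sum>k<D. ?g (\<phi> k l) (\<psi> k l))"
      unfolding p(1) q(1) using p q by (intro sum.cong refl) (auto simp: wmat_index)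
    also have "\<dots> = (\<Sum>i<D. \<Sum>j<D. ?g i j)" by (rule sum_reindex)
    also have "\<dots> = (\<Sum>i<D. \<Sum>j<D. if j = b then (if b = b' then (\<Sum>s<M. K s $$ (i,a) * cnj (K s $$ (i,a'))) else 0) else 0)"
      by (intro sum.cong refl) auto
    also have "\<dots> = (if b = b' then (\<Sum>i<D. \<Sum>s<M. K s $$ (i,a) * cnj (K s $$ (i,a'))) else 0)"
      using p by simp
    also have "(\<Sum>i<D. \<Sum>s<M. K s $$ (i,a) * cnj (K s $$ (i,a'))) = (\<Sum>s<M. \<Sum>i<D. K s $$ (i,a) * cnj (K s $$ (i,a')))"
      by (rule sum.swap)
    also have "\<dots> = (if a = a' then 1 else 0)" using tp p q by simp
    finally show "(\<Sum>s\<in>{..<D} \<times> {..<M}. \<Sum>k<D. wmat s $$ (k,p) * cnj (wmat s $$ (k,q))) = (if p = q then 1 else 0)"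
      unfolding pqe by simp
  qed
  have "kmap (D * r) ({..<D} \<times> {..<M}) (\<lambda>p. tens r (wmat p)) (1\<^sub>m (D * D * r)) = of_nat D \<cdot>\<^sub>m 1\<^sub>m (D * r)"
  proof (rule kmap_tens_unital[OF wmat_carrier])
    fix k k' assume k: "k < D" "k' < D"
    have "(\<Sum>s\<in>{..<D} \<times> {..<M}. \<Sum>q<D * D. wmat s $$ (k,q) * cnj (wmat s $$ (k',q)))
      = (\<Sum>l<D. \<Sum>s<M. \<Sum>q<D * D. wmat (l,s) $$ (k,q) * cnj (wmat (l,s) $$ (k',q)))"
      by (simp only: sum_pair prod.case)
    also have "\<dots> = (\<Sum>l<D. \<Sum>s<M. \<Sum>a<D. K s $$ (\<phi> k l, a) * cnj (wmat (l,s) $$ (k', \<psi> k l * D + a)))"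
      using k by (intro sum.cong refl wmat_sum) auto
    also have "\<dots> = (\<Sum>l<D. \<Sum>s<M. \<Sum>a<D. if k = k' then K s $$ (\<phi> k l, a) * cnj (K s $$ (\<phi> k l, a)) else 0)"
      using k phi_psi_less by (intro sum.cong refl) (auto simp: wmat_index psi_eq_iff)
    also have "\<dots> = (if k = k' then (\<Sum>l<D. (\<lambda>i. \<Sum>s<M. \<Sum>a<D. K s $$ (i, a) * cnj (K s $$ (i, a))) (\<phi> k l)) else 0)"
      by simp
    also have "(\<Sum>l<D. (\<lambda>i. \<Sum>s<M. \<Sum>a<D. K s $$ (i, a) * cnj (K s $$ (i, a))) (\<phi> k l))
      = (\<Sum>i<D. \<Sum>s<M. \<Sum>a<D. K s $$ (i, a) * cnj (K s $$ (i, a)))"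
      by (rule sum.reindex_bij_betw[OF phi_bij[OF k(1)]])
    also have "\<dots> = (\<Sum>i<D. \<Sum>a<D. \<Sum>s<M. K s $$ (i, a) * cnj (K s $$ (i, a)))"
      by (rule sum.cong[OF refl], rule sum.swap)
    also have "\<dots> = (\<Sum>a<D. \<Sum>i<D. \<Sum>s<M. K s $$ (i, a) * cnj (K s $$ (i, a)))" by (rule sum.swap)
    also have "\<dots> = (\<Sum>a<D. \<Sum>s<M. \<Sum>i<D. K s $$ (i, a) * cnj (K s $$ (i, a)))"
      by (rule sum.cong[OF refl], rule sum.swap)
    also have "\<dots> = of_nat D" using tp by simp
    finally show "(\<Sum>s\<in>{..<D} \<times> {..<M}. \<Sum>q<D * D. wmat s $$ (k,q) * cnj (wmat s $$ (k',q))) = (if k = k' then of_nat D else 0)" .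
  qed
  thus "kmap (D * r) ({..<D} \<times> {..<M}) (\<lambda>p. tens r (wmat p)) (1\<^sub>m (D * D * r)) = complex_of_real (real (D * D) / real D) \<cdot>\<^sub>m 1\<^sub>m (D * r)"
    using D_pos by simp
qed

lemma kmap_wmat_index:
  assumes X: "X \<in> carrier_mat (D * D * r) (D * D * r)" and h: "k < D" "x < r" "k' < D" "y < r"
  shows "kmap (D * r) ({..<D} \<times> {..<M}) (\<lambda>p. tens r (wmat p)) X $$ (k * r + x, k' * r + y)
    = (\<Sum>l<D. \<Sum>a<D. \<Sum>a'<D. (\<Sum>s<M. K s $$ (\<phi> k l, a) * cnj (K s $$ (\<phi> k' l, a')))
         * X $$ ((\<psi> k l * D + a) * r + x, (\<psi> k' l * D + a') * r + y))"
proof -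
  have "kmap (D * r) ({..<D} \<times> {..<M}) (\<lambda>p. tens r (wmat p)) X $$ (k * r + x, k' * r + y)
    = (\<Sum>l<D. \<Sum>s<M. \<Sum>q<D * D. \<Sum>q'<D * D. wmat (l,s) $$ (k,q) * X $$ (q * r + x, q' * r + y) * cnj (wmat (l,s) $$ (k',q')))"
    unfolding kmap_tens_index[OF wmat_carrier X h] by (simp only: sum_pair prod.case)
  also have "\<dots> = (\<Sum>l<D. \<Sum>s<M. \<Sum>a<D. \<Sum>q'<D * D. K s $$ (\<phi> k l, a) * X $$ ((\<psi> k l * D + a) * r + x, q' * r + y) * cnj (wmat (l,s) $$ (k',q')))"
    using h by (intro sum.cong refl wmat_sum) auto
  also have "\<dots> = (\<Sum>l<D. \<Sum>s<M. \<Sum>a<D. \<Sum>a'<D. K s $$ (\<phi> k l, a) * X $$ ((\<psi> k l * D + a) * r + x, (\<psi> k' l * D + a') * r + y) * cnj (K s $$ (\<phi> k' l, a')))"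
    using h by (intro sum.cong refl wmat_sum) auto
  also have "\<dots> = (\<Sum>l<D. \<Sum>a<D. \<Sum>s<M. \<Sum>a'<D. K s $$ (\<phi> k l, a) * X $$ ((\<psi> k l * D + a) * r + x, (\<psi> k' l * D + a') * r + y) * cnj (K s $$ (\<phi> k' l, a')))"
    by (rule sum.cong[OF refl], rule sum.swap)
  also have "\<dots> = (\<Sum>l<D. \<Sum>a<D. \<Sum>a'<D. \<Sum>s<M. K s $$ (\<phi> k l, a) * X $$ ((\<psi> k l * D + a) * r + x, (\<psi> k' l * D + a') * r + y) * cnj (K s $$ (\<phi> k' l, a')))"
    by (rule sum.cong[OF refl], rule sum.cong[OF refl], rule sum.swap)
  finally show ?thesis by (simp add: sum_distrib_right ac_simps)
qed

end

text \<open>\<Gamma> enters through its values on matrix units, so the odd and the even case are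
  both instances. An ancilla of dimension r for \<Gamma> is matched with an ancilla of dimension D r
  for \<Lambda>2, the additional factor being A.\<close>

lemma chan_renyi_le:
  assumes \<Lambda>1: "is_channel D \<Lambda>1" and \<Lambda>2: "is_channel D \<Lambda>2" and \<alpha>: "ereal (1/2) \<le> \<alpha>"
    and \<Gamma>: "\<And>i i' k k'. i < D \<Longrightarrow> i' < D \<Longrightarrow> k < D \<Longrightarrow> k' < D \<Longrightarrow> \<Gamma> (unit_mat D i i') $$ (k,k')
      = (\<Sum>l<D. \<Sum>m<D. \<Lambda>1 (unit_mat D (\<phi> i m) (\<phi> i' m)) $$ (\<phi> k l, \<phi> k' l)
            * \<Lambda>2 (unit_mat D (\<psi> i m) (\<psi> i' m)) $$ (\<psi> k l, \<psi> k' l)) / of_nat D"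
  shows "chan_renyi \<alpha> D \<Gamma> \<le> chan_renyi \<alpha> D \<Lambda>2"
  unfolding chan_renyi_def
proof (intro SUP_least)
  fix r \<rho> assume "r \<in> {1..}" and "\<rho> \<in> {\<rho>. is_state (D * r) \<rho>}"
  hence r: "r > 0" and st: "is_state (D * r) \<rho>" by auto
  have \<rho>: "psd (D * r) \<rho>" "mtrace \<rho> = 1" using st by (auto simp: is_state_def)
  note \<rho>c = psdD(1)[OF \<rho>(1)]
  have ist: "is_state (D * (D * r)) (inp r \<rho>)" using inp_state[OF st] by (simp add: mult.assoc)
  hence ip: "psd (D * (D * r)) (inp r \<rho>)" "mtrace (inp r \<rho>) = 1" by (auto simp: is_state_def)
  define X where "X = tensor_map \<Lambda>2 (\<lambda>X. X) D (D * r) (inp r \<rho>)"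
  define R where "R = marg D r \<rho>"
  have Rc: "R \<in> carrier_mat r r" by (simp add: R_def)
  note tc = tensor_map_channel[OF \<Lambda>2 ip(1), folded X_def]
  have mX: "marg D (D * r) X = amp D r ((1 / of_nat D) \<cdot>\<^sub>m R)" unfolding tc(2) R_def by (rule marg_inp[OF \<rho>c])
  have Xc: "X \<in> carrier_mat (D * (D * r)) (D * (D * r))" by (simp add: X_def)
  have trX: "mtrace X = 1" using mtrace_marg[OF Xc] mtrace_marg[OF psdD(1)[OF ip(1)]] tc(2) ip(2) by simp
  have ref_in: "tensor_map (depol D) (\<lambda>X. X) D (D * r) (inp r \<rho>) = amp (D * D) r ((1 / of_nat (D * D)) \<cdot>\<^sub>m R)"
    unfolding tensor_map_depol[OF D_pos] marg_inp[OF \<rho>c] R_def by (rule amp_amp) simp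
  have ref_out: "tensor_map (depol D) (\<lambda>X. X) D r \<rho> = amp D r ((1 / of_nat D) \<cdot>\<^sub>m R)"
    unfolding R_def by (rule tensor_map_depol[OF D_pos])
  \<comment> \<open>Domination is obtained for system B with ancilla AR, where N = D yields D^3;
    \<open>amp_amp\<close> then rewrites the reference for the joint system.\<close>
  have dom: "psd (D * D * r) (complex_of_real (real D ^ 3) \<cdot>\<^sub>m amp (D * D) r ((1 / of_nat (D * D)) \<cdot>\<^sub>m R) - X)"
    using dominated_by_marginal[OF tc(1) D_pos] unfolding mX amp_amp[OF Rc] by (simp add: mult.assoc)
  obtain M :: nat and K where K: "\<forall>s\<in>{..<M}. K s \<in> carrier_mat D D"
    and tp: "\<forall>i<D. \<forall>j<D. (\<Sum>s<M. \<Sum>k<D. K s $$ (k,i) * cnj (K s $$ (k,j))) = (if i = j then 1 else 0)"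
    and L: "\<forall>a<D. \<forall>b<D. \<forall>k<D. \<forall>k'<D. \<Lambda>1 (unit_mat D a b) $$ (k,k') = (\<Sum>s<M. K s $$ (k,a) * cnj (K s $$ (k',b)))"
    by (rule is_channelE[OF \<Lambda>1])
  interpret ak: amp_kraus "D * D" D r "{..<D} \<times> {..<M}" "\<lambda>p. tens r (wmat K p)"
    by (rule amp_kraus_wmat[OF K tp r])
  interpret aks: amp_kraus_state "D * D" D r "{..<D} \<times> {..<M}" "\<lambda>p. tens r (wmat K p)" R X "real D ^ 3"
  proof
    show "psd r R" unfolding R_def by (rule psd_marg[OF \<rho>(1)])
    show "mtrace R = 1" unfolding R_def using mtrace_marg[OF \<rho>c] \<rho>(2) by simp
    show "psd (D * D * r) X" using tc(1) by (simp add: mult.assoc)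
  qed (use trX dom in auto)
  have Xc': "X \<in> carrier_mat (D * D * r) (D * D * r)" using Xc by (simp add: mult.assoc)
  \<comment> \<open>T applied to X is the output of \<Gamma> on the original \<rho>. Both sides
    expand to the same sum over l, m and the entries of \<rho>.\<close>
  have out: "kmap (D * r) ({..<D} \<times> {..<M}) (\<lambda>p. tens r (wmat K p)) X = tensor_map \<Gamma> (\<lambda>X. X) D r \<rho>"
  proof (rule eq_mat_blockI[of _ D r D r])
    fix k x k' y assume h: "k < D" "x < r" "k' < D" "y < r"
    let ?L1 = "\<lambda>l a a'. \<Lambda>1 (unit_mat D a a') $$ (\<phi> k l, \<phi> k' l)"
    let ?L2 = "\<lambda>l c c'. \<Lambda>2 (unit_mat D c c') $$ (\<psi> k l, \<psi> k' l)"
    have "kmap (D * r) ({..<D} \<times> {..<M}) (\<lambda>p. tens r (wmat K p)) X $$ (k * r + x, k' * r + y)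
      = (\<Sum>l<D. \<Sum>a<D. \<Sum>a'<D. ?L1 l a a' * X $$ ((\<psi> k l * D + a) * r + x, (\<psi> k' l * D + a') * r + y))"
      unfolding kmap_wmat_index[OF K tp Xc' h] using L h phi_psi_less by (intro sum.cong refl) auto
    also have "\<dots> = (\<Sum>l<D. \<Sum>a<D. \<Sum>a'<D. \<Sum>c<D. \<Sum>c'<D. (?L1 l a a' * ?L2 l c c') * inp r \<rho> $$ ((c * D + a) * r + x, (c' * D + a') * r + y))"
    proof (intro sum.cong refl)
      fix l a a' assume "l \<in> {..<D}" "a \<in> {..<D}" "a' \<in> {..<D}"
      hence a: "l < D" "a < D" "a' < D" by auto
      show "?L1 l a a' * X $$ ((\<psi> k l * D + a) * r + x, (\<psi> k' l * D + a') * r + y)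
        = (\<Sum>c<D. \<Sum>c'<D. (?L1 l a a' * ?L2 l c c') * inp r \<rho> $$ ((c * D + a) * r + x, (c' * D + a') * r + y))"
        unfolding X_def block_assoc
          tensor_map_id_index[OF phi_psi_less(2)[OF h(1) a(1)] mult_add_less[OF a(2) h(2)] phi_psi_less(2)[OF h(3) a(1)] mult_add_less[OF a(3) h(4)]]
        by (simp add: sum_distrib_left ac_simps)
    qed
    also have "\<dots> = (\<Sum>l<D. \<Sum>m<D. \<Sum>i<D. \<Sum>i'<D. ?L1 l (\<phi> i m) (\<phi> i' m) * ?L2 l (\<psi> i m) (\<psi> i' m) * \<rho> $$ (i * r + x, i' * r + y) / of_nat D)"
      by (intro sum.cong[OF refl] inp_sum[OF \<rho>c h(2,4)])
    also have "\<dots> = (\<Sum>i<D. \<Sum>i'<D. \<Sum>m<D. \<Sum>l<D. ?L1 l (\<phi> i m) (\<phi> i' m) * ?L2 l (\<psi> i m) (\<psi> i' m) * \<rho> $$ (i * r + x, i' * r + y) / of_nat D)"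
      by (rule sum_swap_outer_inner)
    also have "\<dots> = (\<Sum>i<D. \<Sum>i'<D. \<Sum>l<D. \<Sum>m<D. ?L1 l (\<phi> i m) (\<phi> i' m) * ?L2 l (\<psi> i m) (\<psi> i' m) * \<rho> $$ (i * r + x, i' * r + y) / of_nat D)"
      by (rule sum.cong[OF refl], rule sum.cong[OF refl], rule sum.swap)
    also have "\<dots> = (\<Sum>i<D. \<Sum>i'<D. \<rho> $$ (i * r + x, i' * r + y) * \<Gamma> (unit_mat D i i') $$ (k,k'))"
      using h by (intro sum.cong refl) (simp add: \<Gamma> sum_distrib_left sum_divide_distrib ac_simps)
    finally show "kmap (D * r) ({..<D} \<times> {..<M}) (\<lambda>p. tens r (wmat K p)) X $$ (k * r + x, k' * r + y) = tensor_map \<Gamma> (\<lambda>X. X) D r \<rho> $$ (k * r + x, k' * r + y)"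
      unfolding tensor_map_id_index[OF h] .
  qed auto
  have "sandwiched_renyi \<alpha> (tensor_map \<Gamma> (\<lambda>X. X) D r \<rho>) (tensor_map (depol D) (\<lambda>X. X) D r \<rho>)
    \<le> sandwiched_renyi \<alpha> (tensor_map \<Lambda>2 (\<lambda>X. X) D (D * r) (inp r \<rho>)) (tensor_map (depol D) (\<lambda>X. X) D (D * r) (inp r \<rho>))"
    using aks.renyi_mono[OF \<alpha>] unfolding out ref_in ref_out unfolding X_def .
  \<comment> \<open>The state \<open>inp r \<rho>\<close> with ancilla dimension
    \<open>D * r\<close> is one competitor in the supremum that defines the divergence of
    \<Lambda>2.\<close>
  also have "\<dots> \<le> (SUP Rd\<in>{1..}. SUP \<rho>\<in>{\<rho>. is_state (D * Rd) \<rho>}.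
      sandwiched_renyi \<alpha> (tensor_map \<Lambda>2 (\<lambda>X. X) D Rd \<rho>) (tensor_map (depol D) (\<lambda>X. X) D Rd \<rho>))"
    using D_pos r ist by (intro SUP_upper2[of "D * r"] SUP_upper2[of "inp r \<rho>"]) (auto simp: Suc_le_eq)
  finally show "sandwiched_renyi \<alpha> (tensor_map \<Gamma> (\<lambda>X. X) D r \<rho>) (tensor_map (depol D) (\<lambda>X. X) D r \<rho>)
    \<le> (SUP Rd\<in>{1..}. SUP \<rho>\<in>{\<rho>. is_state (D * Rd) \<rho>}.
      sandwiched_renyi \<alpha> (tensor_map \<Lambda>2 (\<lambda>X. X) D Rd \<rho>) (tensor_map (depol D) (\<lambda>X. X) D Rd \<rho>))" .
qed

end

section \<open>The key unitary\<close>

lemma encode_Suc: "encode d (Suc n) v = encode d n v + nat (v n mod int d) * d ^ n"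
  by (simp add: encode_def)

lemma encode_less:
  assumes "d > 0" shows "encode d n v < d ^ n"
proof (induction n)
  case (Suc n)
  have "nat (v n mod int d) < d" using assms by (simp add: nat_less_iff)
  from mult_add_less[OF this Suc] show ?case by (simp add: encode_Suc add.commute)
qed (simp add: encode_def)

lemma digit_encode:
  assumes d: "d > 0" and t: "t < n"
  shows "digit d (encode d n v) t = v t mod int d"
  using t
proof (induction n)
  case (Suc n)
  have less: "encode d n v < d ^ n" by (rule encode_less[OF d])
  have c: "nat (v n mod int d) < d" using d by (simp add: nat_less_iff)
  show ?case
  proof (cases "t = n")
    case True
    have "(encode d n v + nat (v n mod int d) * d ^ n) div d ^ n = nat (v n mod int d)"
      using less d by simp
    thus ?thesis using True c d by (simp add: digit_def encode_Suc)
  next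
    case False
    hence t: "t < n" using Suc.prems by simp
    \<comment> \<open>The new top term is a multiple of d^(t+1) and so does not reach digit
      t.\<close>
    then obtain j where j: "n = Suc (t + j)" using less_imp_Suc_add by blast
    have "(encode d n v + nat (v n mod int d) * d ^ n) div d ^ t
      = (encode d n v + d ^ t * (d * (nat (v n mod int d) * d ^ j))) div d ^ t"
      by (simp add: j power_add ac_simps)
    also have "\<dots> = d * (nat (v n mod int d) * d ^ j) + encode d n v div d ^ t"
      using d by (subst div_mult_self2) auto
    finally have "(encode d n v + nat (v n mod int d) * d ^ n) div d ^ t mod d = encode d n v div d ^ t mod d"
      by simp
    thus ?thesis using Suc.IH[OF t] by (simp add: digit_def encode_Suc)
  qed
qed simp

lemma encode_digit: "encode d n (digit d k) = k mod d ^ n"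
proof (induction n)
  case (Suc n)
  have "k mod d ^ Suc n = d ^ n * (k div d ^ n mod d) + k mod d ^ n"
    unfolding power_Suc2 by (rule mod_mult2_eq)
  thus ?case using Suc by (simp add: encode_Suc digit_def zmod_int[symmetric])
qed (simp add: encode_def)

text \<open>Reduces equality of basis indices to congruences modulo d, one digit at a time.\<close>

lemma eq_encodeI:
  assumes "k < d ^ n" "\<And>t. t < n \<Longrightarrow> [digit d k t = v t] (mod int d)"
  shows "encode d n v = k"
proof -
  have "encode d n v = encode d n (digit d k)"
    unfolding encode_def using assms(2) by (intro sum.cong refl) (simp add: cong_def)
  thus ?thesis using assms(1) by (simp add: encode_digit)
qed

lemma digit_cong_eqI:
  assumes "k < d ^ n" "k' < d ^ n" "\<And>t. t < n \<Longrightarrow> [digit d k t = digit d k' t] (mod int d)"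
  shows "k = k'"
  using eq_encodeI[OF assms(1,3)] encode_digit[of d n k'] assms(2) by simp

text \<open>The vector x k + y l over Z_d, as a basis index. Both components of the permutation in U
  and of its inverse have this shape, so inverting U becomes arithmetic with 2 by 2
  matrices.\<close>

definition lin :: "nat \<Rightarrow> nat \<Rightarrow> int \<Rightarrow> int \<Rightarrow> nat \<Rightarrow> nat \<Rightarrow> nat" where
  "lin d n x y k l = encode d n (\<lambda>t. x * digit d k t + y * digit d l t)"

lemma lin_less: "d > 0 \<Longrightarrow> lin d n x y k l < d ^ n"
  unfolding lin_def by (rule encode_less)

lemma digit_lin:
  "d > 0 \<Longrightarrow> t < n \<Longrightarrow> [digit d (lin d n x y k l) t = x * digit d k t + y * digit d l t] (mod int d)"
  by (simp add: lin_def digit_encode)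

text \<open>The two congruences say that the row (u, w) times the matrix with rows (x, y) and (z, v)
  is (1, 0).\<close>

lemma lin_lin:
  assumes d: "d > 0" and k: "k < d ^ n"
    and one: "[u * x + w * z = 1] (mod int d)" and zero: "[u * y + w * v = 0] (mod int d)"
  shows "lin d n u w (lin d n x y k l) (lin d n z v k l) = k"
  unfolding lin_def[of d n u w]
proof (rule eq_encodeI[OF k])
  fix t assume t: "t < n"
  let ?k = "digit d k t" and ?l = "digit d l t"
  have "[u * digit d (lin d n x y k l) t + w * digit d (lin d n z v k l) t
      = u * (x * ?k + y * ?l) + w * (z * ?k + v * ?l)] (mod int d)"
    by (intro cong_add cong_mult cong_refl digit_lin d t)
  also have "u * (x * ?k + y * ?l) + w * (z * ?k + v * ?l) = (u * x + w * z) * ?k + (u * y + w * v) * ?l"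
    by (simp add: algebra_simps)
  also have "[\<dots> = 1 * ?k + 0 * ?l] (mod int d)"
    by (intro cong_add cong_mult cong_refl one zero)
  finally show "[?k = u * digit d (lin d n x y k l) t + w * digit d (lin d n z v k l) t] (mod int d)"
    by (simp add: cong_sym)
qed

lemma lin_commute: "lin d n x y k l = lin d n y x l k"
  by (simp add: lin_def add.commute)

lemma coprime_if_not_cong_0:
  assumes "prime d" "\<not> [x = 0] (mod int d)" shows "coprime x (int d)"
proof -
  have "coprime (int d) x" using assms by (intro prime_imp_coprime) (auto simp: cong_0_iff)
  thus ?thesis by (simp add: coprime_commute)
qed

text \<open>A coefficient that is nonzero modulo the prime d is a unit there and can be cancelled in
  every digit.\<close>

lemma lin_inj:
  assumes p: "prime d" and nz: "nz d x" and k: "k < d ^ n" "k' < d ^ n"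
    and eq: "lin d n x y k l = lin d n x y k' l"
  shows "k = k'"
proof (rule digit_cong_eqI[OF k])
  have d: "d > 0" using p prime_gt_0_nat by blast
  fix t assume t: "t < n"
  have "[x * digit d k t + y * digit d l t = x * digit d k' t + y * digit d l t] (mod int d)"
    using digit_lin[OF d t, of x y k l] digit_lin[OF d t, of x y k' l] unfolding eq
    by (meson cong_sym cong_trans)
  hence "[x * digit d k t = x * digit d k' t] (mod int d)" by (simp add: cong_add_rcancel)
  moreover have "coprime x (int d)"
    using coprime_if_not_cong_0[OF p] nz by (simp add: nz_def)
  ultimately show "[digit d k t = digit d k' t] (mod int d)"
    by (simp add: cong_mult_lcancel)
qed

lemma invdet_inverse:
  assumes p: "prime d" and det: "\<not> [detG g00 g01 g10 g11 = 0] (mod int d)"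
  shows "[detG g00 g01 g10 g11 * invdet d g00 g01 g10 g11 = 1] (mod int d)"
proof -
  have "coprime (detG g00 g01 g10 g11) (int d)"
    by (rule coprime_if_not_cong_0[OF p det])
  hence "\<exists>k. [detG g00 g01 g10 g11 * k = 1] (mod int d)" by (rule cong_solve_coprime_int)
  thus ?thesis unfolding invdet_def by (rule someI_ex)
qed

lemma block_div: "x < r \<Longrightarrow> (a * r + x) div r = (a::nat)"
  by simp

lemma block_mod: "x < r \<Longrightarrow> (a * r + x) mod r = (x::nat)"
  by simp

text \<open>(\<pi>1, \<pi>2) are the components of \<open>keyperm\<close>. The pair (\<phi>, \<psi>)
  has the transpose of G as its matrix, and (\<pi>1, \<pi>2) the inverse of that transpose.\<close>

locale key_unitary =
  fixes d n :: nat and g00 g01 g10 g11 :: int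
  assumes prime: "prime d" and det: "\<not> [detG g00 g01 g10 g11 = 0] (mod int d)"
begin

abbreviation "D \<equiv> d ^ n"
abbreviation "\<phi> \<equiv> lin d n g00 g10"
abbreviation "\<psi> \<equiv> lin d n g01 g11"
abbreviation "Ni \<equiv> invdet d g00 g01 g10 g11"
abbreviation "\<pi>1 \<equiv> lin d n (Ni * g11) (- (Ni * g10))"
abbreviation "\<pi>2 \<equiv> lin d n (- (Ni * g01)) (Ni * g00)"

lemma d_pos: "d > 0" using prime prime_gt_0_nat by blast
lemma D_pos: "D > 0" using d_pos by simp

lemmas less = lin_less[OF d_pos, of n]

lemma inverse:
  assumes "a < D" "b < D"
  shows "\<phi> (\<pi>1 a b) (\<pi>2 a b) = a" "\<psi> (\<pi>1 a b) (\<pi>2 a b) = b" "\<pi>1 (\<phi> a b) (\<psi> a b) = a" "\<pi>2 (\<phi> a b) (\<psi> a b) = b"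
proof -
  have N: "[Ni * (g00 * g11 - g01 * g10) = 1] (mod int d)"
    using invdet_inverse[OF prime det] by (simp add: detG_def mult.commute)
  show "\<phi> (\<pi>1 a b) (\<pi>2 a b) = a"
    by (rule lin_lin[OF d_pos assms(1)]) (use N in \<open>simp_all add: algebra_simps\<close>)
  show "\<pi>1 (\<phi> a b) (\<psi> a b) = a"
    by (rule lin_lin[OF d_pos assms(1)]) (use N in \<open>simp_all add: algebra_simps\<close>)
  show "\<psi> (\<pi>1 a b) (\<pi>2 a b) = b"
    \<comment> \<open>Brings the variable to be recovered into the first position, where
      \<open>lin_lin\<close> expects it.\<close>
    unfolding lin_commute[of d n _ _ a b]
    by (rule lin_lin[OF d_pos assms(2)]) (use N in \<open>simp_all add: algebra_simps\<close>)
  show "\<pi>2 (\<phi> a b) (\<psi> a b) = b"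
    unfolding lin_commute[of d n _ _ a b]
    by (rule lin_lin[OF d_pos assms(2)]) (use N in \<open>simp_all add: algebra_simps\<close>)
qed

abbreviation "U \<equiv> keyU d n g00 g01 g10 g11"

lemma keyperm_eq:
  assumes "b < D"
  shows "keyperm d n g00 g01 g10 g11 (a * D + b) = \<pi>1 a b * D + \<pi>2 a b"
  unfolding keyperm_def Let_def lin_def block_div[OF assms] block_mod[OF assms] by simp

lemma pair_eq_iff:
  assumes "x < D" "y < D"
  shows "a * D + x = b * D + y \<longleftrightarrow> a = b \<and> x = y"
  using block_div[OF assms(1), of a] block_div[OF assms(2), of b] block_mod[OF assms(1), of a] block_mod[OF assms(2), of b]
  by auto

lemma keyU_index:
  assumes "k < D" "l < D" "a < D" "b < D"
  shows "U $$ (k * D + l, a * D + b) = (if a = \<phi> k l \<and> b = \<psi> k l then 1 else 0)"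
proof -
  have "k * D + l = \<pi>1 a b * D + \<pi>2 a b \<longleftrightarrow> k = \<pi>1 a b \<and> l = \<pi>2 a b"
    by (rule pair_eq_iff[OF assms(2) less])
  also have "\<dots> \<longleftrightarrow> a = \<phi> k l \<and> b = \<psi> k l" using inverse assms by auto
  finally show ?thesis using assms mult_add_less[of k D l D] mult_add_less[of a D b D]
    by (simp add: keyU_def keyperm_eq)
qed

text \<open>The same entry read as a delta in the row index. Conjugation by U sums over its columns
  and conjugation by the adjoint over its rows, and each sum collapses with the matching
  form.\<close>

lemma keyU_index':
  assumes "k < D" "l < D" "a < D" "b < D"
  shows "U $$ (k * D + l, a * D + b) = (if k = \<pi>1 a b \<and> l = \<pi>2 a b then 1 else 0)"
proof -
  have "a = \<phi> k l \<and> b = \<psi> k l \<longleftrightarrow> k = \<pi>1 a b \<and> l = \<pi>2 a b" using inverse assms by auto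
  thus ?thesis unfolding keyU_index[OF assms] by simp
qed

lemma U_carrier: "U \<in> carrier_mat (D * D) (D * D)" by (simp add: keyU_def)

lemma sum_delta_pair:
  fixes g :: "nat \<Rightarrow> nat \<Rightarrow> complex"
  assumes "A < D" "B < D"
  shows "(\<Sum>a<D. \<Sum>b<D. if a = A \<and> b = B then g a b else 0) = g A B"
proof -
  have "(\<Sum>a<D. \<Sum>b<D. if a = A \<and> b = B then g a b else 0) = (\<Sum>a<D. \<Sum>b<D. if b = B then (if a = A then g A B else 0) else 0)"
    by (intro sum.cong refl) auto
  thus ?thesis using assms by simp
qed

section \<open>The convolution evaluated on matrix units\<close>

lemma convE_index:
  assumes X: "X \<in> carrier_mat (D * D) (D * D)" and k: "k < D" "k' < D"
  shows "convE d n g00 g01 g10 g11 X $$ (k,k') = (\<Sum>l<D. X $$ (\<phi> k l * D + \<psi> k l, \<phi> k' l * D + \<psi> k' l))"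
proof -
  have "(U * X * mat_adjoint U) $$ (k * D + l, k' * D + l) = X $$ (\<phi> k l * D + \<psi> k l, \<phi> k' l * D + \<psi> k' l)" if l: "l < D" for l
  proof -
    have "(U * X * mat_adjoint U) $$ (k * D + l, k' * D + l)
      = (\<Sum>a<D. \<Sum>b<D. \<Sum>a'<D. \<Sum>b'<D. U $$ (k * D + l, a * D + b) * X $$ (a * D + b, a' * D + b') * cnj (U $$ (k' * D + l, a' * D + b')))"
      unfolding conj_index[OF U_carrier X mult_add_less[OF k(1) l] mult_add_less[OF k(2) l]] sum_lessThan_mult ..
    also have "\<dots> = (\<Sum>a<D. \<Sum>b<D. \<Sum>a'<D. \<Sum>b'<D. if a' = \<phi> k' l \<and> b' = \<psi> k' l then (if a = \<phi> k l \<and> b = \<psi> k l then X $$ (a * D + b, a' * D + b') else 0) else 0)"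
      using k l by (intro sum.cong refl) (auto simp: keyU_index)
    also have "\<dots> = (\<Sum>a<D. \<Sum>b<D. if a = \<phi> k l \<and> b = \<psi> k l then X $$ (a * D + b, \<phi> k' l * D + \<psi> k' l) else 0)"
      by (simp only: sum_delta_pair[OF less less])
    also have "\<dots> = X $$ (\<phi> k l * D + \<psi> k l, \<phi> k' l * D + \<psi> k' l)" by (rule sum_delta_pair[OF less less])
    finally show ?thesis .
  qed
  thus ?thesis using k by (simp add: convE_def Let_def ptrace2_def)
qed

lemma convEinv_index:
  assumes h: "a < D" "b < D" "a' < D" "b' < D"
  shows "convEinv d n g00 g01 g10 g11 \<rho> $$ (a * D + b, a' * D + b')
    = \<rho> $$ (\<pi>1 a b, \<pi>1 a' b') * (if \<pi>2 a b = \<pi>2 a' b' then 1 / of_nat D else 0)"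
proof -
  let ?X = "tensor_maxmixed D \<rho>"
  have X: "?X \<in> carrier_mat (D * D) (D * D)" by (simp add: tensor_maxmixed_def)
  have "(mat_adjoint U * ?X * U) $$ (a * D + b, a' * D + b')
    = (\<Sum>k<D. \<Sum>l<D. \<Sum>k'<D. \<Sum>l'<D. cnj (U $$ (k * D + l, a * D + b)) * ?X $$ (k * D + l, k' * D + l') * U $$ (k' * D + l', a' * D + b'))"
    using conj_index[OF mat_adjoint_carrier[OF U_carrier] X mult_add_less[OF h(1,2)] mult_add_less[OF h(3,4)]]
      U_carrier h
    by (simp add: sum_lessThan_mult mult_add_less)
  also have "\<dots> = (\<Sum>k<D. \<Sum>l<D. \<Sum>k'<D. \<Sum>l'<D. if k' = \<pi>1 a' b' \<and> l' = \<pi>2 a' b' then (if k = \<pi>1 a b \<and> l = \<pi>2 a b then ?X $$ (k * D + l, k' * D + l') else 0) else 0)"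
    using h by (intro sum.cong refl) (auto simp: keyU_index')
  also have "\<dots> = (\<Sum>k<D. \<Sum>l<D. if k = \<pi>1 a b \<and> l = \<pi>2 a b then ?X $$ (k * D + l, \<pi>1 a' b' * D + \<pi>2 a' b') else 0)"
    by (simp only: sum_delta_pair[OF less less])
  also have "\<dots> = ?X $$ (\<pi>1 a b * D + \<pi>2 a b, \<pi>1 a' b' * D + \<pi>2 a' b')" by (rule sum_delta_pair[OF less less])
  also have "\<dots> = \<rho> $$ (\<pi>1 a b, \<pi>1 a' b') * (if \<pi>2 a b = \<pi>2 a' b' then 1 / of_nat D else 0)"
    by (simp add: tensor_maxmixed_def mult_add_less less block_div[OF less] block_mod[OF less])
  finally show ?thesis by (simp add: convEinv_def Let_def)
qed

text \<open>The sum over m is introduced on purpose: m is the common basis state of the maximally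
  mixed system. The conditions are nested so that later sums over a, a', b, b' collapse one after
  another, starting with the innermost.\<close>

lemma convEinv_unit_mat:
  assumes h: "a < D" "b < D" "a' < D" "b' < D" and i: "i < D" "i' < D"
  shows "convEinv d n g00 g01 g10 g11 (unit_mat D i i') $$ (a * D + b, a' * D + b')
    = (\<Sum>m<D. if b' = \<psi> i' m then (if b = \<psi> i m then (if a' = \<phi> i' m then (if a = \<phi> i m then 1 / of_nat D else 0) else 0) else 0) else 0)"
proof -
  have eq: "(x = \<phi> j m \<and> y = \<psi> j m) = (\<pi>1 x y = j \<and> \<pi>2 x y = m)" if "x < D" "y < D" "j < D" "m < D" for x y j m
    using inverse that by auto
  have "(\<Sum>m<D. if b' = \<psi> i' m then (if b = \<psi> i m then (if a' = \<phi> i' m then (if a = \<phi> i m then 1 / of_nat D else 0) else 0) else 0) else (0::complex))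
    = (\<Sum>m<D. if m = \<pi>2 a b then (if \<pi>1 a b = i \<and> \<pi>1 a' b' = i' \<and> \<pi>2 a' b' = \<pi>2 a b then 1 / of_nat D else 0) else 0)"
  proof (rule sum.cong[OF refl])
    fix m assume "m \<in> {..<D}"
    hence m: "m < D" by simp
    have nest: "(if A then (if B then (if C then (if E then t else 0) else 0) else 0) else 0) = (if (E \<and> B) \<and> (C \<and> A) then t else 0)"
      for A B C E and t :: complex by simp
    have "((\<pi>1 a b = i \<and> \<pi>2 a b = m) \<and> (\<pi>1 a' b' = i' \<and> \<pi>2 a' b' = m))
      = (m = \<pi>2 a b \<and> (\<pi>1 a b = i \<and> \<pi>1 a' b' = i' \<and> \<pi>2 a' b' = \<pi>2 a b))" by blast
    thus "(if b' = \<psi> i' m then (if b = \<psi> i m then (if a' = \<phi> i' m then (if a = \<phi> i m then 1 / of_nat D else 0) else 0) else 0) else (0::complex))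
      = (if m = \<pi>2 a b then (if \<pi>1 a b = i \<and> \<pi>1 a' b' = i' \<and> \<pi>2 a' b' = \<pi>2 a b then 1 / of_nat D else 0) else 0)"
      unfolding nest eq[OF h(1,2) i(1) m] eq[OF h(3,4) i(2) m] by (cases "m = \<pi>2 a b") (simp_all only: if_True if_False simp_thms)
  qed
  thus ?thesis unfolding convEinv_index[OF h] using less by (simp add: unit_mat_def)
qed

text \<open>m comes from the maximally mixed input and l from the final partial trace.\<close>

lemma chan_conv_unit_mat:
  assumes i: "i < D" "i' < D" and k: "k < D" "k' < D"
  shows "chan_conv d n g00 g01 g10 g11 \<Lambda>1 \<Lambda>2 (unit_mat D i i') $$ (k,k')
    = (\<Sum>l<D. \<Sum>m<D. \<Lambda>1 (unit_mat D (\<phi> i m) (\<phi> i' m)) $$ (\<phi> k l, \<phi> k' l)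
          * \<Lambda>2 (unit_mat D (\<psi> i m) (\<psi> i' m)) $$ (\<psi> k l, \<psi> k' l)) / of_nat D"
proof -
  let ?\<tau> = "convEinv d n g00 g01 g10 g11 (unit_mat D i i')"
  have inner: "tensor_map \<Lambda>1 \<Lambda>2 D D ?\<tau> $$ (\<phi> k l * D + \<psi> k l, \<phi> k' l * D + \<psi> k' l)
    = (\<Sum>m<D. \<Lambda>1 (unit_mat D (\<phi> i m) (\<phi> i' m)) $$ (\<phi> k l, \<phi> k' l)
          * \<Lambda>2 (unit_mat D (\<psi> i m) (\<psi> i' m)) $$ (\<psi> k l, \<psi> k' l) / of_nat D)" for l
  proof -
    let ?F = "\<lambda>a a' b b'. \<Lambda>1 (unit_mat D a a') $$ (\<phi> k l, \<phi> k' l) * \<Lambda>2 (unit_mat D b b') $$ (\<psi> k l, \<psi> k' l)"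
    let ?g = "\<lambda>a a' b b' m. if b' = \<psi> i' m then (if b = \<psi> i m then (if a' = \<phi> i' m then (if a = \<phi> i m then ?F a a' b b' / of_nat D else 0) else 0) else 0) else 0"
    have "tensor_map \<Lambda>1 \<Lambda>2 D D ?\<tau> $$ (\<phi> k l * D + \<psi> k l, \<phi> k' l * D + \<psi> k' l)
      = (\<Sum>a<D. \<Sum>a'<D. \<Sum>b<D. \<Sum>b'<D. ?\<tau> $$ (a * D + b, a' * D + b') * \<Lambda>1 (unit_mat D a a') $$ (\<phi> k l, \<phi> k' l) * \<Lambda>2 (unit_mat D b b') $$ (\<psi> k l, \<psi> k' l))"
      by (simp add: tensor_map_def mult_add_less less block_div[OF less] block_mod[OF less])
    also have "\<dots> = (\<Sum>a<D. \<Sum>a'<D. \<Sum>b<D. \<Sum>b'<D. \<Sum>m<D. ?g a a' b b' m)"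
    proof (intro sum.cong refl)
      fix a a' b b' assume "a \<in> {..<D}" "a' \<in> {..<D}" "b \<in> {..<D}" "b' \<in> {..<D}"
      hence h: "a < D" "b < D" "a' < D" "b' < D" by auto
      show "?\<tau> $$ (a * D + b, a' * D + b') * \<Lambda>1 (unit_mat D a a') $$ (\<phi> k l, \<phi> k' l) * \<Lambda>2 (unit_mat D b b') $$ (\<psi> k l, \<psi> k' l)
        = (\<Sum>m<D. ?g a a' b b' m)"
        unfolding convEinv_unit_mat[OF h i] sum_distrib_right by (intro sum.cong refl) auto
    qed
    also have "\<dots> = (\<Sum>p\<in>{..<D} \<times> {..<D} \<times> {..<D} \<times> {..<D}. \<Sum>m<D. case p of (a,a',b,b') \<Rightarrow> ?g a a' b b' m)"
      by (simp only: sum_pair prod.case)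
    also have "\<dots> = (\<Sum>m<D. \<Sum>p\<in>{..<D} \<times> {..<D} \<times> {..<D} \<times> {..<D}. case p of (a,a',b,b') \<Rightarrow> ?g a a' b b' m)"
      by (rule sum.swap)
    also have "\<dots> = (\<Sum>m<D. \<Sum>a<D. \<Sum>a'<D. \<Sum>b<D. \<Sum>b'<D. ?g a a' b b' m)"
      by (simp only: sum_pair prod.case)
    also have "\<dots> = (\<Sum>m<D. ?F (\<phi> i m) (\<phi> i' m) (\<psi> i m) (\<psi> i' m) / of_nat D)"
      using less by (intro sum.cong refl) simp
    finally show ?thesis .
  qed
  show ?thesis unfolding chan_conv_def convE_index[OF tensor_map_carrier k] inner sum_divide_distrib ..
qed

text \<open>The coefficient of k in \<psi> k l is g01 and that of l in \<phi> k l is g10, so these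
  two entries decide the injectivity that a Latin pair requires. With \<phi> and \<psi> exchanged,
  as in the even case, the coefficients become g00 and g11.\<close>

lemma latin_pair_odd:
  assumes "nz d g01" "nz d g10"
  shows "latin_pair D \<phi> \<psi>"
proof
  show "0 < D" by (rule D_pos)
  show "bij_betw (\<lambda>(k,l). (\<phi> k l, \<psi> k l)) ({..<D} \<times> {..<D}) ({..<D} \<times> {..<D})"
    by (rule bij_betw_byWitness[where f' = "\<lambda>(a,b). (\<pi>1 a b, \<pi>2 a b)"]) (auto simp: inverse less)
  show "inj_on (\<lambda>k. \<psi> k l) {..<D}" for l
    using lin_inj[OF prime assms(1)] by (auto simp: inj_on_def)
  show "bij_betw (\<phi> k) {..<D} {..<D}" for k
  proof -
    have "inj_on (\<phi> k) {..<D}"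
      using lin_inj[OF prime assms(2)] unfolding lin_commute[of d n g00 g10] by (auto simp: inj_on_def)
    moreover from this have "\<phi> k ` {..<D} = {..<D}" by (intro endo_inj_surj) (auto simp: less)
    ultimately show ?thesis by (simp add: bij_betw_def)
  qed
qed

lemma latin_pair_even:
  assumes "nz d g00" "nz d g11"
  shows "latin_pair D \<psi> \<phi>"
proof
  show "0 < D" by (rule D_pos)
  show "bij_betw (\<lambda>(k,l). (\<psi> k l, \<phi> k l)) ({..<D} \<times> {..<D}) ({..<D} \<times> {..<D})"
    by (rule bij_betw_byWitness[where f' = "\<lambda>(b,a). (\<pi>1 a b, \<pi>2 a b)"]) (auto simp: inverse less)
  show "inj_on (\<lambda>k. \<phi> k l) {..<D}" for l
    using lin_inj[OF prime assms(1)] by (auto simp: inj_on_def)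
  show "bij_betw (\<psi> k) {..<D} {..<D}" for k
  proof -
    have "inj_on (\<psi> k) {..<D}"
      using lin_inj[OF prime assms(2)] unfolding lin_commute[of d n g01 g11] by (auto simp: inj_on_def)
    moreover from this have "\<psi> k ` {..<D} = {..<D}" by (intro endo_inj_surj) (auto simp: less)
    ultimately show ?thesis by (simp add: bij_betw_def)
  qed
qed

end

theorem mainTheorem20:
  fixes d n :: nat and g00 g01 g10 g11 :: int and \<alpha> :: ereal
    and \<Lambda>1 \<Lambda>2 :: "complex mat \<Rightarrow> complex mat"
  assumes "prime d" and "n \<ge> 1"
    and "\<not> [detG g00 g01 g10 g11 = 0] (mod int d)"
    and "ereal (1/2) \<le> \<alpha>"
    and "is_channel (d ^ n) \<Lambda>1" and "is_channel (d ^ n) \<Lambda>2"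
  shows "(odd_parity_pos d g00 g01 g10 g11 \<longrightarrow>
            chan_entropy \<alpha> d n (chan_conv d n g00 g01 g10 g11 \<Lambda>1 \<Lambda>2) \<ge> chan_entropy \<alpha> d n \<Lambda>2)
       \<and> (even_parity_pos d g00 g01 g10 g11 \<longrightarrow>
            chan_entropy \<alpha> d n (chan_conv d n g00 g01 g10 g11 \<Lambda>1 \<Lambda>2) \<ge> chan_entropy \<alpha> d n \<Lambda>1)
       \<and> (positiveG d g00 g01 g10 g11 \<longrightarrow>
            chan_entropy \<alpha> d n (chan_conv d n g00 g01 g10 g11 \<Lambda>1 \<Lambda>2)
              \<ge> max (chan_entropy \<alpha> d n \<Lambda>1) (chan_entropy \<alpha> d n \<Lambda>2))"
proof -
  let ?\<Gamma> = "chan_conv d n g00 g01 g10 g11 \<Lambda>1 \<Lambda>2"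
  interpret key_unitary d n g00 g01 g10 g11 using assms(1,3) by unfold_locales
  have odd: "chan_entropy \<alpha> d n \<Lambda>2 \<le> chan_entropy \<alpha> d n ?\<Gamma>" if "odd_parity_pos d g00 g01 g10 g11"
  proof -
    interpret latin_pair "d ^ n" \<phi> \<psi> using that by (intro latin_pair_odd) (auto simp: odd_parity_pos_def)
    have "chan_renyi \<alpha> (d ^ n) ?\<Gamma> \<le> chan_renyi \<alpha> (d ^ n) \<Lambda>2"
      by (rule chan_renyi_le[OF assms(5,6,4)]) (rule chan_conv_unit_mat)
    thus ?thesis unfolding chan_entropy_def by (intro ereal_minus_mono order_refl)
  qed
  have even: "chan_entropy \<alpha> d n \<Lambda>1 \<le> chan_entropy \<alpha> d n ?\<Gamma>" if "even_parity_pos d g00 g01 g10 g11"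
  proof -
    \<comment> \<open>The channels change places together with \<phi> and \<psi>: now \<Lambda>2 is
      absorbed into T, and commutativity of the product matches the formula on matrix units.\<close>
    interpret latin_pair "d ^ n" \<psi> \<phi> using that by (intro latin_pair_even) (auto simp: even_parity_pos_def)
    have "chan_renyi \<alpha> (d ^ n) ?\<Gamma> \<le> chan_renyi \<alpha> (d ^ n) \<Lambda>1"
      by (rule chan_renyi_le[OF assms(6,5,4)]) (simp add: chan_conv_unit_mat mult.commute)
    thus ?thesis unfolding chan_entropy_def by (intro ereal_minus_mono order_refl)
  qed
  show ?thesis using odd even by (simp add: positiveG_def)
qed

end
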